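(* Let $n$ be a positive integer. There exists an $n$-vertex toric uniquely hamiltonian graph containing at most one vertex of degree $2$ if and only if $n\ge 11$.
   Context: Graphs are finite and simple. A graph is uniquely hamiltonian if it contains exactly one hamiltonian cycle (cycles are regarded as subgraphs). A graph is toric if it has (orientable) genus $1$, i.e. it embeds in the torus but not in the plane. *)

theory Defs
  imports "HOL-Analysis.Analysis"
begin

definition simple_graph :: "'a set \<Rightarrow> 'a set set \<Rightarrow> bool" where
  "simple_graph V E \<longleftrightarrow> finite V \<and> (\<forall>e\<in>E. e \<subseteq> V \<and> card e = 2)"

definition vertex_degree :: "'a set set \<Rightarrow> 'a \<Rightarrow> nat" where
  "vertex_degree E v = card {e \<in> E. v \<in> e}"

definition cyclic_edges :: "'a list \<Rightarrow> 'a set set" where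
  "cyclic_edges vs = {{vs ! i, vs ! (Suc i mod length vs)} | i. i < length vs}"

text \<open>A hamiltonian cycle is a spanning subgraph, so it is determined by its edge set \<open>C\<close>; the
  different starting points and orientations \<open>vs\<close> of a cycle give the same \<open>C\<close>.\<close>

definition hamiltonian_cycle :: "'a set \<Rightarrow> 'a set set \<Rightarrow> 'a set set \<Rightarrow> bool" where
  "hamiltonian_cycle V E C \<longleftrightarrow>
     C \<subseteq> E \<and> (\<exists>vs. distinct vs \<and> set vs = V \<and> length vs \<ge> 3 \<and> C = cyclic_edges vs)"

definition uniquely_hamiltonian :: "'a set \<Rightarrow> 'a set set \<Rightarrow> bool" where
  "uniquely_hamiltonian V E \<longleftrightarrow> (\<exists>!C. hamiltonian_cycle V E C)"

text \<open>Topological embedding in the subspace \<open>S\<close>: vertices become distinct points, edges become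
  simple arcs between the images of their ends, and these meet each other and the vertex
  points only at the images of common ends.\<close>

definition embeds_in :: "'a set \<Rightarrow> 'a set set \<Rightarrow> 'b::topological_space set \<Rightarrow> bool" where
  "embeds_in V E S \<longleftrightarrow>
     (\<exists>(\<phi> :: 'a \<Rightarrow> 'b) (\<gamma> :: 'a set \<Rightarrow> real \<Rightarrow> 'b).
        inj_on \<phi> V \<and> \<phi> ` V \<subseteq> S \<and>
        (\<forall>e\<in>E. arc (\<gamma> e) \<and> path_image (\<gamma> e) \<subseteq> S \<and>
               {pathstart (\<gamma> e), pathfinish (\<gamma> e)} = \<phi> ` e \<and>
               path_image (\<gamma> e) \<inter> \<phi> ` V = \<phi> ` e) \<and>
        (\<forall>e\<in>E. \<forall>f\<in>E. e \<noteq> f \<longrightarrow>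
               path_image (\<gamma> e) \<inter> path_image (\<gamma> f) = \<phi> ` (e \<inter> f)))"

definition torus :: "(complex \<times> complex) set" where
  "torus = sphere 0 1 \<times> sphere 0 1"

definition toric :: "'a set \<Rightarrow> 'a set set \<Rightarrow> bool" where
  "toric V E \<longleftrightarrow> embeds_in V E torus \<and> \<not> embeds_in V E (UNIV :: complex set)"

end

theory Submission
  imports Defs
begin

text \<open>The lower bound has nothing to do with surfaces: every uniquely hamiltonian graph with at most one
vertex of degree two has at least eleven vertices (\<open>uniquely_hamiltonian_order\<close>). Number the vertices
\<open>0, \<dots>, n - 1\<close> along the hamiltonian cycle so that only \<open>0\<close> may have degree two. Then each other vertex
is the end of a chord, while the chords together with the cycle must not contain a second
hamiltonian cycle. For \<open>n \<le> 10\<close> these two demands are contradictory. This is a finite case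
distinction on which chords are present, recorded as a decision tree for each \<open>n\<close>; a checker proved
sound in \<open>refutes_sound\<close> searches for second cycles in the leaves of the tree.

For \<open>n = 11\<close> the case distinction leaves, up to reflection, a single minimal graph, a cycle with six
chords. Its vertex of degree two may be blown up to a fan: if \<open>u\<close> has the neighbours \<open>a\<close> and \<open>b\<close>,
subdivide \<open>a u\<close> and join the new vertex to \<open>b\<close>. A hamiltonian cycle still has to traverse \<open>a\<close>, the new
vertex, \<open>u\<close>, \<open>b\<close> in this order, so uniqueness is preserved, and \<open>u\<close> remains the only vertex of degree
two. The resulting family is \<open>hamiltonian_fan\<close>. Its fan is forced into every hamiltonian cycle
(\<open>hamiltonian_fan_descent\<close>), which leaves a hamiltonian path problem on ten vertices.

These graphs contain a fixed subdivision of \<open>K\<^sub>3\<^sub>,\<^sub>3\<close> and are therefore not planar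
(\<open>K33_subdivision_not_planar\<close>): crossing chords of a closed curve lie on opposite sides of it, but three
pairwise crossing chords would need three sides. Opposite sides come from Janiszewski's theorem.

On the torus, the plane modulo a lattice, the ten base vertices are placed at integer points and the
edges between them are drawn as straight segments. That all translates of these segments meet only
where they should is certified by separating lines. The fan goes into one triangle inside a face of
this drawing, where polar coordinates around its hub make the intersections evident
(\<open>hamiltonian_fan_embeds_in_torus\<close>).\<close>

section \<open>Crossing chords of a closed curve in the plane\<close>

text \<open>The engine behind the non-planarity proof. Think of \<open>A \<union> B\<close> as a closed curve split into two arcs,
of \<open>K\<close> as a chord joining their common ends, of \<open>W\<close> as a side of the curve that \<open>K\<close> avoids, and
of \<open>D\<close> as the interior of a second chord, from \<open>x\<close> in \<open>A\<close> to \<open>y\<close> in \<open>B\<close>. Through \<open>y\<close> one passes from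
\<open>D\<close> to \<open>W\<close> without meeting \<open>A \<union> K\<close>, through \<open>x\<close> without meeting \<open>B \<union> K\<close>. As
\<open>(A \<union> K) \<inter> (B \<union> K) = K\<close> is connected, Janiszewski's theorem lets one pass without meeting either.\<close>

lemma Janiszewski_bridge:
  fixes A B K D W :: "complex set"
  assumes "compact A" "compact B" "compact K" "connected K" "A \<inter> B \<subseteq> K" "K \<inter> W = {}"
    and W: "connected W" "W \<inter> (A \<union> B) = {}" "A \<union> B \<subseteq> closure W"
    and D: "connected D" "D \<inter> (A \<union> B \<union> K) = {}"
    and x: "x \<in> A - B - K" "x \<in> closure D" and y: "y \<in> B - A - K" "y \<in> closure D"
  obtains C where "connected C" "C \<inter> (A \<union> B \<union> K) = {}" "C \<inter> D \<noteq> {}" "C \<inter> W \<noteq> {}"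
proof -
  obtain d where d: "d \<in> D" using x(2) by force
  obtain w where w: "w \<in> W" using W(3) x(1) by force
  \<comment> \<open>Adding a common limit point to two connected sets glues them together.\<close>
  have linked: "connected_component (- (S \<union> K)) d w"
    if "z \<in> closure D" "z \<in> closure W" "z \<notin> S \<union> K" "S \<subseteq> A \<union> B" for z S
  proof -
    have "connected (insert z D)" "connected (insert z W)"
      using that D(1) W(1) connected_intermediate_closure[of D "insert z D"]
        connected_intermediate_closure[of W "insert z W"] closure_subset by blast+
    then have "connected (insert z D \<union> insert z W)"
      by (intro connected_Un) auto
    moreover have "insert z D \<union> insert z W \<subseteq> - (S \<union> K)"
      using that D(2) W(2) assms(6) by blast
    ultimately show ?thesis
      unfolding connected_component_def using d w by blast
  qed
  have "connected_component (- (A \<union> K)) d w"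
    using linked[of y A] y W(3) by blast
  moreover have "connected_component (- (B \<union> K)) d w"
    using linked[of x B] x W(3) by blast
  moreover have "(A \<union> K) \<inter> (B \<union> K) = K" using assms(5) by blast
  ultimately have "connected_component (- ((A \<union> K) \<union> (B \<union> K))) d w"
    using assms(1-4) by (intro Janiszewski[of "A \<union> K" "B \<union> K"]) (simp_all add: compact_Un compact_imp_closed closed_Un)
  then show ?thesis
    using that d w unfolding connected_component_def by blast
qed

definition arc_between :: "'b::topological_space set \<Rightarrow> 'b \<Rightarrow> 'b \<Rightarrow> bool" where
  "arc_between S a b \<longleftrightarrow> (\<exists>g. arc g \<and> path_image g = S \<and> pathstart g = a \<and> pathfinish g = b)"

lemma arc_between_sym: "arc_between S a b \<Longrightarrow> arc_between S b a"
  unfolding arc_between_def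
  by (metis arc_reversepath path_image_reversepath pathfinish_reversepath pathstart_reversepath)

lemma arc_between_join:
  assumes "arc_between S a b" "arc_between T b c" "S \<inter> T = {b}"
  shows "arc_between (S \<union> T) a c"
proof -
  obtain g h where "arc g" "path_image g = S" "pathstart g = a" "pathfinish g = b"
    "arc h" "path_image h = T" "pathstart h = b" "pathfinish h = c"
    using assms unfolding arc_between_def by blast
  with assms(3) show ?thesis
    unfolding arc_between_def by (intro exI[of _ "g +++ h"]) (auto simp: arc_join path_image_join)
qed

lemma arc_between_props:
  fixes S :: "complex set"
  assumes "arc_between S a b"
  shows "compact S" "connected S" "connected (S - {a, b})" "a \<in> S" "b \<in> S" "a \<noteq> b"
    "S \<subseteq> closure (S - {a, b})"
proof -
  obtain g where g: "arc g" "path_image g = S" "pathstart g = a" "pathfinish g = b"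
    using assms unfolding arc_between_def by blast
  show "compact S" "connected S" "a \<in> S" "b \<in> S"
    using g by (auto simp: compact_arc_image connected_arc_image)
  show "connected (S - {a, b})" "a \<noteq> b"
    using g connected_simple_path_endless[OF arc_imp_simple_path[OF g(1)]] arc_distinct_ends[OF g(1)]
    by auto
  have inj: "inj_on g {0..1}" and cont: "continuous_on {0..1} g"
    using g(1) by (auto simp: arc_def path_def)
  have "S - {a, b} = g ` {0<..<1}"
  proof -
    have "{0..1::real} = insert 0 (insert 1 {0<..<1})" by auto
    then have "S = insert a (insert b (g ` {0<..<1}))"
      using g(2-4) unfolding path_image_def pathstart_def pathfinish_def by (metis image_insert)
    moreover have "a \<notin> g ` {0<..<1}" "b \<notin> g ` {0<..<1}"
      using inj g(3,4) unfolding pathstart_def pathfinish_def by (fastforce simp: inj_on_def)+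
    ultimately show ?thesis by simp
  qed
  moreover have "g ` closure {0<..<1} \<subseteq> closure (g ` {0<..<1})"
    using cont by (intro image_closure_subset) (auto simp: closure_subset)
  then have "g ` {0..1} \<subseteq> closure (g ` {0<..<1})" by simp
  ultimately show "S \<subseteq> closure (S - {a, b})"
    using g(2) by (auto simp: path_image_def)
qed

text \<open>If both chords were on one side of the curve, the other side could be taken for \<open>W\<close> above; the
connected set found there would leave a component of the complement of the curve.\<close>

lemma crossing_chords_opposite_sides:
  fixes A B K D :: "complex set"
  assumes A: "arc_between A a b" and B: "arc_between B a b" and AB: "A \<inter> B = {a, b}"
    and K: "arc_between K a b" "K \<inter> (A \<union> B) = {a, b}"
    and D: "arc_between D x y" "D \<inter> (A \<union> B) = {x, y}" "x \<in> A - B" "y \<in> B - A"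
    and KD: "K \<inter> D = {}"
  shows "K - {a, b} \<subseteq> inside (A \<union> B) \<longleftrightarrow> \<not> D - {x, y} \<subseteq> inside (A \<union> B)"
proof -
  obtain g h where gh: "arc g" "path_image g = A" "pathstart g = a" "pathfinish g = b"
    "arc h" "path_image h = B" "pathstart h = b" "pathfinish h = a"
    using A arc_between_sym[OF B] unfolding arc_between_def by blast
  define C where "C = g +++ h"
  have C: "simple_path C" "pathfinish C = pathstart C" "path_image C = A \<union> B"
    unfolding C_def using gh AB by (auto simp: simple_path_join_loop path_image_join)
  define I O' where "I = inside (A \<union> B)" and "O' = outside (A \<union> B)"
  have J: "open I" "open O'" "connected I" "connected O'" "I \<inter> O' = {}" "I \<union> O' = - (A \<union> B)"
    "frontier I = A \<union> B" "frontier O' = A \<union> B"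
    using Jordan_inside_outside[OF C(1,2), unfolded C(3), folded I_def O'_def] by blast+
  note pA = arc_between_props[OF A] and pB = arc_between_props[OF B]
    and pK = arc_between_props[OF K(1)] and pD = arc_between_props[OF D(1)]
  have side: "Z \<subseteq> I \<or> Z \<subseteq> O'" if "connected Z" "Z \<inter> (A \<union> B) = {}" for Z
    using that J(1,2,5,6) connectedD[of Z I O'] by blast
  have cross: False
    if W: "connected W" "W \<inter> (A \<union> B) = {}" "A \<union> B \<subseteq> closure W" "K \<inter> W = {}" "D \<inter> W = {}"
      and comp: "\<And>Z. connected Z \<Longrightarrow> Z \<inter> (A \<union> B) = {} \<Longrightarrow> Z \<inter> W \<noteq> {} \<Longrightarrow> Z \<subseteq> W" for W
  proof -
    have "A \<inter> B \<subseteq> K" using AB pK(4,5) by simp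
    moreover have "x \<in> A - B - K" "y \<in> B - A - K" using D(3,4) KD pD by auto
    moreover have "(D - {x, y}) \<inter> (A \<union> B \<union> K) = {}" using D(2) KD by blast
    moreover have "x \<in> closure (D - {x, y})" "y \<in> closure (D - {x, y})"
      using pD(4,5,7) by blast+
    ultimately obtain Z where "connected Z" "Z \<inter> (A \<union> B \<union> K) = {}"
      "Z \<inter> (D - {x, y}) \<noteq> {}" "Z \<inter> W \<noteq> {}"
      using Janiszewski_bridge[OF pA(1) pB(1) pK(1,2) _ W(4,1-3) pD(3)] by metis
    then show False using comp[of Z] W(5) by blast
  qed
  have closures: "A \<union> B \<subseteq> closure I" "A \<union> B \<subseteq> closure O'"
    using J(7,8) unfolding frontier_def by blast+
  have disj: "I \<inter> (A \<union> B) = {}" "O' \<inter> (A \<union> B) = {}"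
    using J(6) by blast+
  have ends: "{a, b, x, y} \<inter> I = {}" "{a, b, x, y} \<inter> O' = {}"
    using disj pA(4,5) D(3,4) by auto
  have K': "K - {a, b} \<subseteq> I \<or> K - {a, b} \<subseteq> O'"
    using K(2) by (intro side[OF pK(3)]) blast
  have D': "D - {x, y} \<subseteq> I \<or> D - {x, y} \<subseteq> O'"
    using D(2) by (intro side[OF pD(3)]) blast
  have "\<not> (K - {a, b} \<subseteq> I \<and> D - {x, y} \<subseteq> I)"
  proof
    assume "K - {a, b} \<subseteq> I \<and> D - {x, y} \<subseteq> I"
    then have "K \<inter> O' = {}" "D \<inter> O' = {}"
      using J(5) ends(2) by auto
    then show False
      using cross[OF J(4) disj(2) closures(2)] side J(5) by blast
  qed
  moreover have "\<not> (K - {a, b} \<subseteq> O' \<and> D - {x, y} \<subseteq> O')"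
  proof
    assume "K - {a, b} \<subseteq> O' \<and> D - {x, y} \<subseteq> O'"
    then have "K \<inter> I = {}" "D \<inter> I = {}"
      using J(5) ends(1) by auto
    then show False
      using cross[OF J(3) disj(1) closures(1)] side J(5) by blast
  qed
  ultimately show ?thesis
    using K' D' unfolding I_def by blast
qed

fun path_edges :: "'a list \<Rightarrow> 'a set set" where
  "path_edges (x # y # p) = insert {x, y} (path_edges (y # p))"
| "path_edges _ = {}"

lemma Union_path_edges: "length p \<ge> 2 \<Longrightarrow> \<Union>(path_edges p) = set p"
proof (induction p rule: path_edges.induct)
  case (1 x y p)
  then show ?case by (cases p) auto
qed auto

definition drawing :: "'a set \<Rightarrow> 'a set set \<Rightarrow> 'b::topological_space set
    \<Rightarrow> ('a \<Rightarrow> 'b) \<Rightarrow> ('a set \<Rightarrow> real \<Rightarrow> 'b) \<Rightarrow> bool" where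
  "drawing V E S \<phi> \<gamma> \<longleftrightarrow>
     inj_on \<phi> V \<and> \<phi> ` V \<subseteq> S \<and>
     (\<forall>e\<in>E. arc (\<gamma> e) \<and> path_image (\<gamma> e) \<subseteq> S \<and>
            {pathstart (\<gamma> e), pathfinish (\<gamma> e)} = \<phi> ` e \<and>
            path_image (\<gamma> e) \<inter> \<phi> ` V = \<phi> ` e) \<and>
     (\<forall>e\<in>E. \<forall>f\<in>E. e \<noteq> f \<longrightarrow> path_image (\<gamma> e) \<inter> path_image (\<gamma> f) = \<phi> ` (e \<inter> f))"

lemma embeds_in_iff_drawing: "embeds_in V E S \<longleftrightarrow> (\<exists>\<phi> \<gamma>. drawing V E S \<phi> \<gamma>)"
  unfolding embeds_in_def drawing_def by blast

text \<open>The drawing of a path of the graph; traversing paths as arcs makes subdivision vertices harmless,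
so that only the branch vertices of a subdivided graph matter.\<close>

definition path_drawing :: "('a set \<Rightarrow> real \<Rightarrow> 'b::topological_space) \<Rightarrow> 'a list \<Rightarrow> 'b set" where
  "path_drawing \<gamma> p = (\<Union>e\<in>path_edges p. path_image (\<gamma> e))"

lemma path_drawing_Int:
  assumes "drawing V E S \<phi> \<gamma>" "path_edges p \<union> path_edges q \<subseteq> E"
    "path_edges p \<inter> path_edges q = {}" "length p \<ge> 2" "length q \<ge> 2"
  shows "path_drawing \<gamma> p \<inter> path_drawing \<gamma> q = \<phi> ` (set p \<inter> set q)"
proof -
  have "path_drawing \<gamma> p \<inter> path_drawing \<gamma> q =
      (\<Union>e\<in>path_edges p. \<Union>f\<in>path_edges q. path_image (\<gamma> e) \<inter> path_image (\<gamma> f))"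
    unfolding path_drawing_def by blast
  also have "\<dots> = (\<Union>e\<in>path_edges p. \<Union>f\<in>path_edges q. \<phi> ` (e \<inter> f))"
    using assms(1-3) unfolding drawing_def by (intro SUP_cong refl) (metis Un_subset_iff disjoint_iff subsetD)
  also have "\<dots> = \<phi> ` (\<Union>(path_edges p) \<inter> \<Union>(path_edges q))"
    by blast
  finally show ?thesis
    using assms(4,5) by (simp add: Union_path_edges)
qed

lemma arc_between_path_drawing:
  assumes "drawing V E S \<phi> \<gamma>" "distinct p" "length p \<ge> 2" "path_edges p \<subseteq> E"
  shows "arc_between (path_drawing \<gamma> p) (\<phi> (hd p)) (\<phi> (last p))"
  using assms(2-4)
proof (induction p rule: path_edges.induct)
  case (1 x y p)
  have "{x, y} \<in> E" using 1 by auto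
  then have "arc (\<gamma> {x, y})" "{pathstart (\<gamma> {x, y}), pathfinish (\<gamma> {x, y})} = {\<phi> x, \<phi> y}"
    using assms(1) unfolding drawing_def by auto
  then have edge: "arc_between (path_image (\<gamma> {x, y})) (\<phi> x) (\<phi> y)"
    using arc_between_sym[of "path_image (\<gamma> {x, y})" "\<phi> y" "\<phi> x"]
    unfolding arc_between_def doubleton_eq_iff by blast
  show ?case
  proof (cases p)
    case Nil
    then show ?thesis using edge by (simp add: path_drawing_def)
  next
    case (Cons z q)
    have "{x, y} \<notin> path_edges (y # p)"
      using 1(2) Union_path_edges[of "y # p"] Cons by auto
    then have "path_drawing \<gamma> [x, y] \<inter> path_drawing \<gamma> (y # p) = \<phi> ` (set [x, y] \<inter> set (y # p))"
      using 1(4) Cons by (intro path_drawing_Int[OF assms(1)]) auto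
    then have "path_image (\<gamma> {x, y}) \<inter> path_drawing \<gamma> (y # p) = {\<phi> y}"
      using 1(2) by (auto simp: path_drawing_def)
    then show ?thesis
      using arc_between_join[OF edge, of "path_drawing \<gamma> (y # p)" "\<phi> (last (y # p))"] 1 Cons
      by (auto simp: path_drawing_def)
  qed
qed auto

lemma crossing_paths_opposite_sides:
  fixes \<gamma> :: "'a set \<Rightarrow> real \<Rightarrow> complex"
  assumes dr: "drawing V E UNIV \<phi> \<gamma>"
    and E: "path_edges p \<union> path_edges q \<union> path_edges k \<union> path_edges l \<subseteq> E"
    and V: "set p \<union> set q \<union> set k \<union> set l \<subseteq> V"
    and dist: "distinct p" "distinct q" "distinct k" "distinct l"
    and len: "2 \<le> length p" "2 \<le> length q" "2 \<le> length k" "2 \<le> length l"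
    and disj: "path_edges p \<inter> path_edges q = {}" "path_edges p \<inter> path_edges k = {}"
      "path_edges q \<inter> path_edges k = {}" "path_edges p \<inter> path_edges l = {}"
      "path_edges q \<inter> path_edges l = {}" "path_edges k \<inter> path_edges l = {}"
    and ends: "hd q = hd p" "last q = last p" "hd k = hd p" "last k = last p"
    and inter: "set p \<inter> set q = {hd p, last p}" "set k \<inter> (set p \<union> set q) = {hd p, last p}"
      "set l \<inter> (set p \<union> set q) = {hd l, last l}" "hd l \<in> set p - set q" "last l \<in> set q - set p"
      "set k \<inter> set l = {}"
  shows "path_drawing \<gamma> k - {\<phi> (hd k), \<phi> (last k)} \<subseteq> inside (path_drawing \<gamma> p \<union> path_drawing \<gamma> q) \<longleftrightarrow>
    \<not> path_drawing \<gamma> l - {\<phi> (hd l), \<phi> (last l)} \<subseteq> inside (path_drawing \<gamma> p \<union> path_drawing \<gamma> q)"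
proof -
  note arcs = arc_between_path_drawing[OF dr]
  note int = path_drawing_Int[OF dr]
  have E': "path_edges p \<subseteq> E" "path_edges q \<subseteq> E" "path_edges k \<subseteq> E" "path_edges l \<subseteq> E"
    using E by auto
  have pq: "path_drawing \<gamma> p \<inter> path_drawing \<gamma> q = {\<phi> (hd p), \<phi> (last p)}"
    using int[of p q] E' disj len inter by simp
  have kpq: "path_drawing \<gamma> k \<inter> (path_drawing \<gamma> p \<union> path_drawing \<gamma> q) = {\<phi> (hd p), \<phi> (last p)}"
  proof -
    have "path_drawing \<gamma> k \<inter> (path_drawing \<gamma> p \<union> path_drawing \<gamma> q) =
        \<phi> ` (set k \<inter> (set p \<union> set q))"
      unfolding Int_Un_distrib image_Un
      using int[of k p] int[of k q] E' disj len by (simp add: Int_commute)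
    then show ?thesis using inter(2) by simp
  qed
  have lpq: "path_drawing \<gamma> l \<inter> (path_drawing \<gamma> p \<union> path_drawing \<gamma> q) = {\<phi> (hd l), \<phi> (last l)}"
  proof -
    have "path_drawing \<gamma> l \<inter> (path_drawing \<gamma> p \<union> path_drawing \<gamma> q) =
        \<phi> ` (set l \<inter> (set p \<union> set q))"
      unfolding Int_Un_distrib image_Un
      using int[of l p] int[of l q] E' disj len by (simp add: Int_commute)
    then show ?thesis using inter(3) by simp
  qed
  have kl: "path_drawing \<gamma> k \<inter> path_drawing \<gamma> l = {}"
    using int[of k l] E' disj len inter(6) by simp
  have vert: "\<phi> v \<in> path_drawing \<gamma> r \<longleftrightarrow> v \<in> set r"
    if "path_edges r \<subseteq> E" "set r \<subseteq> V" "length r \<ge> 2" "v \<in> V" for r v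
  proof -
    have "path_drawing \<gamma> r \<inter> \<phi> ` V = (\<Union>e\<in>path_edges r. path_image (\<gamma> e) \<inter> \<phi> ` V)"
      unfolding path_drawing_def by blast
    also have "\<dots> = (\<Union>e\<in>path_edges r. \<phi> ` e)"
      using dr that(1) unfolding drawing_def by (intro SUP_cong refl) (meson subsetD)
    also have "\<dots> = \<phi> ` set r"
      unfolding Union_path_edges[OF that(3), symmetric] by blast
    finally have "path_drawing \<gamma> r \<inter> \<phi> ` V = \<phi> ` set r" .
    moreover have "inj_on \<phi> V" using dr unfolding drawing_def by blast
    ultimately show ?thesis
      using inj_on_image_mem_iff[of \<phi> V v "set r"] that(2,4) by blast
  qed
  have V': "hd l \<in> V" "last l \<in> V" using inter(4,5) V by auto
  have l: "\<phi> (hd l) \<in> path_drawing \<gamma> p - path_drawing \<gamma> q" "\<phi> (last l) \<in> path_drawing \<gamma> q - path_drawing \<gamma> p"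
    using vert[OF E'(1) _ len(1)] vert[OF E'(2) _ len(2)] V' V inter(4,5) by auto
  have arcs': "arc_between (path_drawing \<gamma> p) (\<phi> (hd k)) (\<phi> (last k))"
    "arc_between (path_drawing \<gamma> q) (\<phi> (hd k)) (\<phi> (last k))"
    using arcs[OF dist(1) len(1) E'(1)] arcs[OF dist(2) len(2) E'(2)] ends by simp_all
  show ?thesis
    using pq kpq
    by (intro crossing_chords_opposite_sides[OF arcs' _ arcs[OF dist(3) len(3) E'(3)] _
          arcs[OF dist(4) len(4) E'(4)] lpq l kl]) (simp_all add: ends)
qed

text \<open>The twelve edges form a subdivision of \<open>K\<^sub>3\<^sub>,\<^sub>3\<close> with sides \<open>{2, 4, 9}\<close> and \<open>{3, 6, 8}\<close>. Its hexagon
\<open>2 3 4 8 9 6\<close> has the three chords \<open>2 1 8\<close>, \<open>3 9\<close> and \<open>4 5 6\<close>, any two of which cross; hence they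
would lie on pairwise opposite sides of a curve that has only two sides.\<close>

lemma K33_subdivision_not_planar:
  fixes V :: "nat set"
  assumes E: "{{1,2}, {1,8}, {2,3}, {3,4}, {4,8}, {2,6}, {6,7}, {7,9}, {8,9}, {3,9}, {4,5}, {5,6}} \<subseteq> E"
    and V: "{1..9} \<subseteq> V"
  shows "\<not> embeds_in V E (UNIV :: complex set)"
proof
  assume "embeds_in V E (UNIV :: complex set)"
  then obtain \<phi> :: "nat \<Rightarrow> complex" and \<gamma> where dr: "drawing V E UNIV \<phi> \<gamma>"
    unfolding embeds_in_iff_drawing by blast
  define side where "side H k \<longleftrightarrow> path_drawing \<gamma> k - {\<phi> (hd k), \<phi> (last k)} \<subseteq> inside H" for H k
  have V': "{1,2,3,4,5,6,7,8,9} \<subseteq> V" using V by auto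
  have E': "{1,2} \<in> E" "{1,8} \<in> E" "{2,3} \<in> E" "{3,4} \<in> E" "{4,8} \<in> E" "{2,6} \<in> E" "{6,7} \<in> E"
    "{7,9} \<in> E" "{8,9} \<in> E" "{3,9} \<in> E" "{4,5} \<in> E" "{5,6} \<in> E"
    using E by simp_all
  note opposite = crossing_paths_opposite_sides[OF dr, folded side_def]
  \<comment> \<open>The same hexagon is cut into two arcs in three ways, at the ends of each chord in turn.\<close>
  let ?H = "path_drawing \<gamma> [2,3,4,8] \<union> path_drawing \<gamma> [2,6,7,9,8]"
  have 1: "side ?H [2,1,8] \<longleftrightarrow> \<not> side ?H [3,9]"
    by (rule opposite) (use V' E' in \<open>simp_all add: insert_commute doubleton_eq_iff\<close>)
  have "path_drawing \<gamma> [3,4,8,9] \<union> path_drawing \<gamma> [3,2,6,7,9] = ?H"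
    unfolding path_drawing_def by (auto simp: insert_commute)
  moreover have "side (path_drawing \<gamma> [3,4,8,9] \<union> path_drawing \<gamma> [3,2,6,7,9]) [3,9] \<longleftrightarrow>
     \<not> side (path_drawing \<gamma> [3,4,8,9] \<union> path_drawing \<gamma> [3,2,6,7,9]) [4,5,6]"
    by (rule opposite) (use V' E' in \<open>simp_all add: insert_commute doubleton_eq_iff\<close>)
  ultimately have 2: "side ?H [3,9] \<longleftrightarrow> \<not> side ?H [4,5,6]" by simp
  have "path_drawing \<gamma> [4,8,9,7,6] \<union> path_drawing \<gamma> [4,3,2,6] = ?H"
    unfolding path_drawing_def by (auto simp: insert_commute)
  moreover have "side (path_drawing \<gamma> [4,8,9,7,6] \<union> path_drawing \<gamma> [4,3,2,6]) [4,5,6] \<longleftrightarrow>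
     \<not> side (path_drawing \<gamma> [4,8,9,7,6] \<union> path_drawing \<gamma> [4,3,2,6]) [8,1,2]"
    by (rule opposite) (use V' E' in \<open>simp_all add: insert_commute doubleton_eq_iff\<close>)
  moreover have "side H [8,1,2] \<longleftrightarrow> side H [2,1,8]" for H
    unfolding side_def path_drawing_def by (simp add: insert_commute Un_commute)
  ultimately have 3: "side ?H [4,5,6] \<longleftrightarrow> \<not> side ?H [2,1,8]" by simp
  show False using 1 2 3 by blast
qed

section \<open>Polygons on the torus\<close>

text \<open>The torus as the plane modulo \<open>(6 \<int>) \<times> (6 \<int>)\<close>; the period \<open>6\<close> lets all vertices of the base
graph sit at integer points.\<close>

definition wrap :: "real \<times> real \<Rightarrow> complex \<times> complex" where
  "wrap z = (cis (pi * fst z / 3), cis (pi * snd z / 3))"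

lemma wrap_in_torus: "wrap z \<in> torus"
  by (simp add: wrap_def torus_def)

lemma continuous_on_wrap: "continuous_on S wrap"
  unfolding wrap_def by (intro continuous_intros) auto

lemma cis_sixth_eq_iff: "cis (pi * a / 3) = cis (pi * b / 3) \<longleftrightarrow> (\<exists>k::int. a = b + 6 * real_of_int k)"
proof -
  have "cis (pi * a / 3) = cis (pi * b / 3) \<longleftrightarrow>
      (\<exists>k::int. pi * a / 3 = pi * b / 3 + 2 * pi * real_of_int k)"
    using sin_cos_eq_iff[of "pi * a / 3" "pi * b / 3"] by (auto simp: complex_eq_iff)
  also have "\<dots> \<longleftrightarrow> (\<exists>k::int. a = b + 6 * real_of_int k)"
  proof (intro ex_cong1)
    fix k :: int
    have "pi * a / 3 = pi * b / 3 + 2 * pi * real_of_int k \<longleftrightarrow> pi * a = pi * (b + 6 * real_of_int k)"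
      by (simp add: field_simps)
    then show "pi * a / 3 = pi * b / 3 + 2 * pi * real_of_int k \<longleftrightarrow> a = b + 6 * real_of_int k" by simp
  qed
  finally show ?thesis .
qed

lemma wrap_eq_iff:
  "wrap z = wrap w \<longleftrightarrow>
    (\<exists>k l::int. fst z = fst w + 6 * real_of_int k \<and> snd z = snd w + 6 * real_of_int l)"
  by (simp add: wrap_def cis_sixth_eq_iff)

lemma wrap_inj_near:
  assumes "wrap z = wrap w" "\<bar>fst z - fst w\<bar> < 6" "\<bar>snd z - snd w\<bar> < 6"
  shows "z = w"
proof -
  obtain k l :: int
    where kl: "fst z = fst w + 6 * real_of_int k" "snd z = snd w + 6 * real_of_int l"
    using assms(1) wrap_eq_iff by blast
  have "\<bar>real_of_int k\<bar> < 1" "\<bar>real_of_int l\<bar> < 1" using assms(2,3) kl by auto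
  then have "k = 0" "l = 0" by linarith+
  then show ?thesis using kl by (simp add: prod_eq_iff)
qed

definition real_point :: "int \<times> int \<Rightarrow> real \<times> real" where
  "real_point P = (real_of_int (fst P), real_of_int (snd P))"

definition polygon :: "(int \<times> int) list \<Rightarrow> (real \<times> real) set" where
  "polygon X = convex hull (real_point ` set X)"

definition lin :: "int \<times> int \<Rightarrow> int \<times> int \<Rightarrow> int" where
  "lin L P = fst L * fst P + snd L * snd P"

definition real_lin :: "int \<times> int \<Rightarrow> real \<times> real \<Rightarrow> real" where
  "real_lin L z = real_of_int (fst L) * fst z + real_of_int (snd L) * snd z"

lemma real_lin_point: "real_lin L (real_point P) = lin L P"
  by (simp add: real_lin_def lin_def real_point_def)

lemma real_lin_affine: "real_lin L (u *\<^sub>R z + v *\<^sub>R w) = u * real_lin L z + v * real_lin L w"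
  by (simp add: real_lin_def algebra_simps)

lemma convex_le: "convex {z. real_lin L z \<le> c}" and convex_ge: "convex {z. c \<le> real_lin L z}"
proof -
  have "\<And>u v a b. 0 \<le> u \<Longrightarrow> 0 \<le> v \<Longrightarrow> u + v = 1 \<Longrightarrow> a \<le> c \<Longrightarrow> b \<le> c \<Longrightarrow> u * a + v * b \<le> c"
    using convex_bound_le by blast
  then show "convex {z. real_lin L z \<le> c}"
    by (auto simp: convex_def real_lin_affine)
  have "u * a + v * b \<ge> c" if "0 \<le> u" "0 \<le> v" "u + v = 1" "c \<le> a" "c \<le> b" for u v a b :: real
    using convex_bound_le[of "-a" "-c" "-b" u v] that by simp
  then show "convex {z. c \<le> real_lin L z}"
    by (auto simp: convex_def real_lin_affine)
qed

text \<open>Half-planes together with one point of their boundary line are still convex. This is what allows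
polygons that touch in a common corner to be treated like disjoint ones.\<close>

lemma convex_insert_exposed:
  fixes f :: "'a::real_vector \<Rightarrow> real"
  assumes affine: "\<And>u v x y. f (u *\<^sub>R x + v *\<^sub>R y) = u * f x + v * f y" and "f p \<le> c"
  shows "convex (insert p {z. f z < c})"
proof (rule convexI)
  fix x y and u v :: real
  assume xy: "x \<in> insert p {z. f z < c}" "y \<in> insert p {z. f z < c}"
    and uv: "0 \<le> u" "0 \<le> v" "u + v = 1"
  have le: "f x \<le> c" "f y \<le> c" using xy assms(2) by auto
  consider "x = p" "y = p" | "u = 0" | "v = 0" | "f x < c" "u > 0" | "f y < c" "v > 0"
    using xy uv by fastforce
  then show "u *\<^sub>R x + v *\<^sub>R y \<in> insert p {z. f z < c}"
  proof cases
    case 1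
    then show ?thesis using uv by (simp flip: scaleR_left_distrib)
  next
    case 4
    then have "u * f x < u * c" "v * f y \<le> v * c" using le uv by (auto intro: mult_left_mono)
    then have "u * f x + v * f y < (u + v) * c" by (simp add: distrib_right)
    then show ?thesis using affine uv by simp
  next
    case 5
    then have "v * f y < v * c" "u * f x \<le> u * c" using le uv by (auto intro: mult_left_mono)
    then have "u * f x + v * f y < (u + v) * c" by (simp add: distrib_right)
    then show ?thesis using affine uv by simp
  qed (use xy uv in auto)
qed

text \<open>A separating line may touch one of two polygons, but then in a single corner, which also has to be
a corner of the other one.\<close>

definition contact :: "(int \<times> int) list \<Rightarrow> (int \<times> int) list \<Rightarrow> bool" where
  "contact F Y \<longleftrightarrow> (case F of [] \<Rightarrow> True | [P] \<Rightarrow> P \<in> set Y | _ \<Rightarrow> False)"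

definition separates :: "int \<times> int \<Rightarrow> int \<Rightarrow> (int \<times> int) list \<Rightarrow> (int \<times> int) list \<Rightarrow> bool" where
  "separates L c X Y \<longleftrightarrow> (\<forall>P\<in>set X. lin L P \<le> c) \<and> (\<forall>Q\<in>set Y. c \<le> lin L Q) \<and>
     (contact (filter (\<lambda>P. lin L P = c) X) Y \<or> contact (filter (\<lambda>Q. lin L Q = c) Y) X)"

lemma exposed_point:
  assumes "\<forall>P\<in>set X. lin L P \<le> c" "contact (filter (\<lambda>P. lin L P = c) X) Y"
    and z: "z \<in> polygon X" "c \<le> real_lin L z"
  shows "\<exists>P\<in>set X \<inter> set Y. z = real_point P"
proof (cases "filter (\<lambda>P. lin L P = c) X")
  case Nil
  then have "\<forall>P\<in>set X. lin L P \<le> c - 1" using assms(1) by (fastforce simp: filter_empty_conv)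
  then have "polygon X \<subseteq> {z. real_lin L z \<le> c - 1}"
    unfolding polygon_def by (intro hull_minimal convex_le) (auto simp: real_lin_point)
  then show ?thesis using z by auto
next
  case (Cons P F)
  then have F: "filter (\<lambda>P. lin L P = c) X = [P]" "P \<in> set Y"
    using assms(2) by (auto simp: contact_def split: list.splits)
  then have P: "P \<in> set X" "lin L P = c"
    by (metis (mono_tags, lifting) list.set_intros(1) set_filter mem_Collect_eq)+
  have "lin L Q < c" if "Q \<in> set X" "Q \<noteq> P" for Q
  proof -
    have "Q \<notin> set (filter (\<lambda>P. lin L P = c) X)" using F(1) that by simp
    then show ?thesis using that assms(1) by force
  qed
  then have "real_point Q \<in> insert (real_point P) {z. real_lin L z < c}" if "Q \<in> set X" for Q
    using that by (cases "Q = P") (simp_all add: real_lin_point)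
  then have "real_point ` set X \<subseteq> insert (real_point P) {z. real_lin L z < c}"
    by blast
  then have "polygon X \<subseteq> insert (real_point P) {z. real_lin L z < c}"
    unfolding polygon_def using P(2)
    by (intro hull_minimal convex_insert_exposed real_lin_affine) (simp_all add: real_lin_point)
  then show ?thesis using z F(2) P by auto
qed

lemma separates_hull:
  assumes "separates L c X Y" "z \<in> polygon X" "z \<in> polygon Y"
  shows "\<exists>P\<in>set X \<inter> set Y. z = real_point P"
proof -
  have sep: "\<forall>P\<in>set X. lin L P \<le> c" "\<forall>Q\<in>set Y. c \<le> lin L Q"
    "contact (filter (\<lambda>P. lin L P = c) X) Y \<or> contact (filter (\<lambda>Q. lin L Q = c) Y) X"
    using assms(1) unfolding separates_def by auto
  have "polygon X \<subseteq> {z. real_lin L z \<le> c}" "polygon Y \<subseteq> {z. c \<le> real_lin L z}"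
    unfolding polygon_def using sep(1,2)
    by (intro hull_minimal convex_le convex_ge, force simp: real_lin_point)+
  then have z: "real_lin L z \<le> c" "c \<le> real_lin L z" using assms by auto
  show ?thesis
    using sep(3)
  proof
    assume "contact (filter (\<lambda>P. lin L P = c) X) Y"
    then show ?thesis using exposed_point[OF sep(1)] assms(2) z by blast
  next
    let ?L = "(- fst L, - snd L)"
    have neg: "lin ?L Q = - lin L Q" "real_lin ?L w = - real_lin L w" for Q w
      by (simp_all add: lin_def real_lin_def)
    assume "contact (filter (\<lambda>Q. lin L Q = c) Y) X"
    then show ?thesis
      using exposed_point[of Y ?L "- c" X z] assms(3) z sep(2) by (auto simp: neg)
  qed
qed

text \<open>Disjoint convex polygons in the plane can be separated by a line parallel to a side of one of them.\<close>

definition normals :: "(int \<times> int) list \<Rightarrow> (int \<times> int) list" where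
  "normals X = [(snd P - snd Q, fst Q - fst P). P \<leftarrow> X, Q \<leftarrow> X]"

definition separable :: "(int \<times> int) list \<Rightarrow> (int \<times> int) list \<Rightarrow> bool" where
  "separable X Y \<longleftrightarrow> (\<exists>L\<in>set (normals X @ normals Y). \<exists>P\<in>set X. separates L (lin L P) X Y)"

definition translate :: "int \<times> int \<Rightarrow> (int \<times> int) list \<Rightarrow> (int \<times> int) list" where
  "translate s Y = map (\<lambda>Q. (fst Q + 6 * fst s, snd Q + 6 * snd s)) Y"

text \<open>Polygons inside the window \<open>[-1, 9] \<times> [-1, 9]\<close> can meet on the torus only after a shift by at most
one period in each direction, because \<open>10 < 2 * 6\<close>.\<close>

definition separable_on_torus :: "(int \<times> int) list \<Rightarrow> (int \<times> int) list \<Rightarrow> bool" where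
  "separable_on_torus X Y \<longleftrightarrow> (\<forall>k\<in>{-1,0,1}. \<forall>l\<in>{-1,0,1}. separable X (translate (k, l) Y))"

definition within_window :: "(int \<times> int) list \<Rightarrow> bool" where
  "within_window X \<longleftrightarrow> (\<forall>P\<in>set X. - 1 \<le> fst P \<and> fst P \<le> 9 \<and> - 1 \<le> snd P \<and> snd P \<le> 9)"

lemma hull_within_window:
  assumes "within_window X" "z \<in> polygon X"
  shows "- 1 \<le> fst z" "fst z \<le> 9" "- 1 \<le> snd z" "snd z \<le> 9"
proof -
  have "polygon X \<subseteq> {-1..9} \<times> {-1..9}"
    unfolding polygon_def using assms(1)
    by (intro hull_minimal convex_Times convex_real_interval) (auto simp: within_window_def real_point_def)
  then show "- 1 \<le> fst z" "fst z \<le> 9" "- 1 \<le> snd z" "snd z \<le> 9" using assms(2) by auto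
qed

lemma hull_translate:
  assumes "z \<in> polygon Y" "fst w = fst z + 6 * real_of_int k" "snd w = snd z + 6 * real_of_int l"
  shows "w \<in> polygon (translate (k, l) Y)"
proof -
  let ?t = "(6 * real_of_int k, 6 * real_of_int l)"
  have "real_point ` set (translate (k, l) Y) = (\<lambda>x. ?t + x) ` real_point ` set Y"
    by (force simp: translate_def real_point_def image_image)
  then have "polygon (translate (k, l) Y) = (\<lambda>x. ?t + x) ` polygon Y"
    unfolding polygon_def by (simp add: convex_hull_translation)
  moreover have "w = ?t + z" using assms(2,3) by (simp add: prod_eq_iff)
  ultimately show ?thesis using assms(1) by blast
qed

lemma separable_on_torus_meet:
  assumes "separable_on_torus X Y" "within_window X" "within_window Y"
    and xy: "x \<in> polygon X" "y \<in> polygon Y" "wrap x = wrap y"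
  shows "\<exists>P\<in>set X. \<exists>Q\<in>set Y. x = real_point P \<and> wrap x = wrap (real_point Q)"
proof -
  obtain k l :: int
    where kl: "fst x = fst y + 6 * real_of_int k" "snd x = snd y + 6 * real_of_int l"
    using xy(3) wrap_eq_iff by blast
  have "\<bar>real_of_int k\<bar> < 2" "\<bar>real_of_int l\<bar> < 2"
    using kl hull_within_window[OF assms(2) xy(1)] hull_within_window[OF assms(3) xy(2)] by linarith+
  then have "k \<in> {-1,0,1}" "l \<in> {-1,0,1}" by (simp; linarith)+
  then have "separable X (translate (k, l) Y)"
    using assms(1) unfolding separable_on_torus_def by blast
  then obtain P where P: "P \<in> set X" "P \<in> set (translate (k, l) Y)" "x = real_point P"
    using separates_hull xy(1) hull_translate[OF xy(2) kl] unfolding separable_def by blast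
  then obtain Q where Q: "Q \<in> set Y" "P = (fst Q + 6 * k, snd Q + 6 * l)"
    by (auto simp: translate_def)
  have "wrap (real_point P) = wrap (real_point Q)"
    unfolding wrap_eq_iff using Q(2) by (intro exI[of _ k] exI[of _ l]) (simp add: real_point_def)
  then show ?thesis using P Q by blast
qed

definition position :: "nat \<Rightarrow> int \<times> int" where
  "position v = [(4,2), (1,4), (2,5), (4,0), (5,1), (4,1), (2,0), (5,5), (3,4), (0,0)] ! v"

text \<open>The straight-line drawing. Segments leave the square \<open>[0, 6] \<times> [0, 6]\<close> whenever an edge winds
around the torus; their ends are then lifts of the vertex positions.\<close>

definition base_segments :: "((nat \<times> nat) \<times> (int \<times> int) list) list" where
  "base_segments =
    [((0,1), [(4,2), (7,4)]), ((1,2), [(1,4), (2,5)]), ((2,3), [(2,5), (4,6)]), ((3,4), [(4,0), (5,1)]),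
     ((4,5), [(5,1), (4,1)]), ((5,6), [(4,1), (2,0)]), ((6,7), [(2,0), (-1,-1)]), ((7,8), [(5,5), (3,4)]),
     ((8,9), [(3,4), (6,6)]), ((0,5), [(4,2), (4,1)]), ((1,8), [(1,4), (3,4)]), ((2,6), [(2,5), (2,6)]),
     ((3,9), [(4,0), (6,0)]), ((4,8), [(5,1), (9,4)]), ((7,9), [(5,5), (6,6)])]"

text \<open>The triangle with corners at the vertices \<open>9\<close> and \<open>0\<close> and a free apex lies in a face of this
drawing, into which fans with any number of spokes are placed.\<close>

definition fan_triangle :: "(int \<times> int) list" where
  "fan_triangle = [(0,0), (4,2), (0,1)]"

lemma base_segments_separable:
  "sorted_wrt separable_on_torus (map snd base_segments)"
  by code_simp

lemma base_segments_fan_separable: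
  "list_all (separable_on_torus fan_triangle) (map snd base_segments)"
  by code_simp

section \<open>A family of graphs and its drawing on the torus\<close>

definition chords :: "(nat \<times> nat) list" where
  "chords = [(0,5), (1,8), (2,6), (3,9), (4,8), (7,9)]"

text \<open>The path \<open>0, \<dots>, n - 1\<close>, six chords on its first ten vertices, and a fan joining \<open>0\<close> to all later
vertices. For \<open>n = 11\<close> this is a cycle of length eleven with six chords, and increasing \<open>n\<close> only
lengthens the fan.\<close>

definition hamiltonian_fan :: "nat \<Rightarrow> nat set set" where
  "hamiltonian_fan n = {{i, Suc i} | i. Suc i < n} \<union> {{0, j} | j. 10 \<le> j \<and> j < n} \<union>
     {{u, v} | u v. (u, v) \<in> set chords}"

lemma hamiltonian_fan_cases:
  assumes "e \<in> hamiltonian_fan n"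
  obtains i where "e = {i, Suc i}" "Suc i < n" | i where "e = {0, i}" "10 \<le> i" "i < n"
    | u v where "e = {u, v}" "(u, v) \<in> set chords"
  using assms unfolding hamiltonian_fan_def by blast

lemma hamiltonian_fan_edges:
  "Suc i < n \<Longrightarrow> {i, Suc i} \<in> hamiltonian_fan n"
  "10 \<le> j \<Longrightarrow> j < n \<Longrightarrow> {0, j} \<in> hamiltonian_fan n"
  "(u, v) \<in> set chords \<Longrightarrow> {u, v} \<in> hamiltonian_fan n"
  unfolding hamiltonian_fan_def by blast+

lemma chords_less: "(u, v) \<in> set chords \<Longrightarrow> u < 10 \<and> v < 10 \<and> u \<noteq> v"
  by (auto simp: chords_def)

text \<open>The arcs are given by a relation between edges and point sets, which is easier to define by cases
than a function on edges, since an edge does not determine an order of its ends. That an arc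
avoids the vertices outside its edge follows from the intersection property, as every vertex
lies on some edge.\<close>

lemma embeds_inI:
  fixes S :: "'b::topological_space set" and R :: "('a set \<times> 'b set) set"
  assumes inj: "inj_on \<phi> V" "\<phi> ` V \<subseteq> S" and cover: "V = \<Union>E"
    and total: "\<And>e. e \<in> E \<Longrightarrow> \<exists>X. (e, X) \<in> R"
    and arcs: "\<And>e X. (e, X) \<in> R \<Longrightarrow> X \<subseteq> S \<and> (\<exists>u v. e = {u, v} \<and> arc_between X (\<phi> u) (\<phi> v))"
    and meet: "\<And>e f X Y. (e, X) \<in> R \<Longrightarrow> (f, Y) \<in> R \<Longrightarrow> e \<noteq> f \<Longrightarrow> X \<inter> Y \<subseteq> \<phi> ` (e \<inter> f)"
  shows "embeds_in V E S"
proof -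
  have "\<forall>e\<in>E. \<exists>g. (e, path_image g) \<in> R \<and> arc g \<and> {pathstart g, pathfinish g} = \<phi> ` e"
  proof
    fix e assume "e \<in> E"
    then obtain X where X: "(e, X) \<in> R" using total by blast
    then obtain u v where "e = {u, v}" "arc_between X (\<phi> u) (\<phi> v)" using arcs by blast
    then show "\<exists>g. (e, path_image g) \<in> R \<and> arc g \<and> {pathstart g, pathfinish g} = \<phi> ` e"
      using X unfolding arc_between_def by fastforce
  qed
  then obtain \<gamma> where \<gamma>: "\<And>e. e \<in> E \<Longrightarrow> (e, path_image (\<gamma> e)) \<in> R"
    "\<And>e. e \<in> E \<Longrightarrow> arc (\<gamma> e)" "\<And>e. e \<in> E \<Longrightarrow> {pathstart (\<gamma> e), pathfinish (\<gamma> e)} = \<phi> ` e"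
    by metis
  have ends: "\<phi> ` e \<subseteq> path_image (\<gamma> e)" if "e \<in> E" for e
    unfolding \<gamma>(3)[OF that, symmetric] by (simp add: pathstart_in_path_image pathfinish_in_path_image)
  have meets: "path_image (\<gamma> e) \<inter> path_image (\<gamma> f) = \<phi> ` (e \<inter> f)" if "e \<in> E" "f \<in> E" "e \<noteq> f" for e f
    using meet[OF \<gamma>(1)[OF that(1)] \<gamma>(1)[OF that(2)] that(3)] ends that(1,2) by blast
  have "path_image (\<gamma> e) \<inter> \<phi> ` V = \<phi> ` e" if e: "e \<in> E" for e
  proof (intro equalityI subsetI)
    fix z assume "z \<in> path_image (\<gamma> e) \<inter> \<phi> ` V"
    then obtain v where v: "v \<in> V" "z = \<phi> v" "\<phi> v \<in> path_image (\<gamma> e)" by blast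
    obtain f where f: "f \<in> E" "v \<in> f" using v(1) cover by blast
    show "z \<in> \<phi> ` e"
    proof (cases "e = f")
      case True
      then show ?thesis using f v by blast
    next
      case False
      then show ?thesis using meets[OF e f(1) False] ends[OF f(1)] f v by blast
    qed
  qed (use ends[OF e] e cover in blast)
  moreover have "path_image (\<gamma> e) \<subseteq> S" if "e \<in> E" for e
    using arcs[OF \<gamma>(1)[OF that]] by blast
  ultimately show ?thesis
    unfolding embeds_in_def using inj \<gamma>(2,3) meets
    by (intro exI[of _ \<phi>] exI[of _ \<gamma>] conjI ballI impI) auto
qed

lemma arc_between_interval:
  fixes h :: "real \<Rightarrow> 'b::topological_space"
  assumes "continuous_on {a..b} h" "inj_on h {a..b}" "a < b"
  shows "arc_between (h ` {a..b}) (h a) (h b)"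
proof -
  have "arc (h \<circ> linepath a b)"
  proof -
    have im: "linepath a b ` {0..1} = {a..b}"
      using path_image_linepath[of a b] assms(3)
      by (simp add: path_image_def closed_segment_eq_real_ivl)
    have "arc (linepath a b)" using assms(3) by simp
    then show ?thesis
      using assms im unfolding arc_def path_def
      by (intro conjI comp_inj_on continuous_on_compose) simp_all
  qed
  moreover have "path_image (h \<circ> linepath a b) = h ` {a..b}"
    using assms(3) by (simp add: path_image_compose closed_segment_eq_real_ivl)
  ultimately show ?thesis
    unfolding arc_between_def
    by (intro exI[of _ "h \<circ> linepath a b"]) (simp add: pathstart_compose pathfinish_compose)
qed

text \<open>Polar coordinates of the fan triangle: \<open>r\<close> is the relative distance from the hub \<open>(4, 2)\<close> and \<open>s\<close> the
position on the opposite side, from \<open>(0, 0)\<close> to \<open>(0, 1)\<close>. Spokes are lines of constant \<open>s\<close>, rim edges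
have \<open>r = 1\<close>.\<close>

definition fan_point :: "real \<Rightarrow> real \<Rightarrow> complex \<times> complex" where
  "fan_point r s = wrap (4 - 4 * r, 2 - r * (2 - s))"

lemma fan_point_in_torus: "fan_point r s \<in> torus"
  by (simp add: fan_point_def wrap_in_torus)

lemma fan_point_eq_iff:
  assumes "r \<in> {0..1}" "r' \<in> {0..1}" "s \<in> {0..1}" "s' \<in> {0..1}"
  shows "fan_point r s = fan_point r' s' \<longleftrightarrow> r = r' \<and> (r = 0 \<or> s = s')"
proof
  have b: "0 \<le> q * (2 - u) \<and> q * (2 - u) \<le> 2" if "q \<in> {0..1}" "u \<in> {0..1}" for q u :: real
    using that mult_mono[of q 1 "2 - u" 2] by simp
  assume "fan_point r s = fan_point r' s'"
  then have "(4 - 4 * r, 2 - r * (2 - s)) = (4 - 4 * r', 2 - r' * (2 - s'))"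
    unfolding fan_point_def using assms b[OF assms(1,3)] b[OF assms(2,4)]
    by (intro wrap_inj_near) (simp_all only: fst_conv snd_conv abs_less_iff atLeastAtMost_iff, linarith+)
  then show "r = r' \<and> (r = 0 \<or> s = s')" by auto
qed (auto simp: fan_point_def)

lemma fan_point_in_triangle:
  assumes "r \<in> {0..1}" "s \<in> {0..1}"
  shows "\<exists>x\<in>polygon fan_triangle. fan_point r s = wrap x"
proof -
  let ?A = "real_point (0,0)" and ?B = "real_point (4,2)" and ?D = "real_point (0,1)"
  have pos: "0 \<le> r * (1 - s)" "0 \<le> r * s" using assms by auto
  then have "(r * (1 - s)) *\<^sub>R ?A + (1 - r) *\<^sub>R ?B + (r * s) *\<^sub>R ?D \<in> convex hull {?A, ?B, ?D}"
    unfolding convex_hull_3 using assms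
    by (intro CollectI exI[of _ "r * (1 - s)"] exI[of _ "1 - r"] exI[of _ "r * s"])
      (auto simp: algebra_simps)
  moreover have "(r * (1 - s)) *\<^sub>R ?A + (1 - r) *\<^sub>R ?B + (r * s) *\<^sub>R ?D = (4 - 4 * r, 2 - r * (2 - s))"
    by (simp add: real_point_def algebra_simps)
  ultimately show ?thesis
    unfolding fan_point_def polygon_def fan_triangle_def by auto
qed

lemma continuous_on_fan_point: "continuous_on S (\<lambda>r. fan_point r s)" "continuous_on S (\<lambda>s. fan_point 1 s)"
  unfolding fan_point_def
  by (intro continuous_on_compose2[OF continuous_on_wrap[of UNIV]] continuous_intros subset_UNIV)+

lemma base_segments_valid:
  "list_all (\<lambda>((u, v), X). within_window X \<and> (case X of [P, Q] \<Rightarrow> u < 10 \<and> v < 10 \<and> u \<noteq> v \<and>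
       fst P mod 6 = fst (position u) mod 6 \<and> snd P mod 6 = snd (position u) mod 6 \<and>
       fst Q mod 6 = fst (position v) mod 6 \<and> snd Q mod 6 = snd (position v) mod 6 \<and>
       \<bar>fst P - fst Q\<bar> < 6 \<and> \<bar>snd P - snd Q\<bar> < 6 \<and> P \<noteq> Q | _ \<Rightarrow> False)) base_segments"
  by code_simp

lemma positions_distinct: "distinct (map (\<lambda>v. (fst (position v) mod 6, snd (position v) mod 6)) [0..<10])"
  by code_simp

lemma wrap_real_point_eq_iff:
  "wrap (real_point P) = wrap (real_point Q) \<longleftrightarrow> fst P mod 6 = fst Q mod 6 \<and> snd P mod 6 = snd Q mod 6"
proof -
  have "(\<exists>k::int. real_of_int a = real_of_int b + 6 * real_of_int k) \<longleftrightarrow> a mod 6 = b mod 6" for a b :: int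
  proof -
    have "(\<exists>k::int. real_of_int a = real_of_int b + 6 * real_of_int k) \<longleftrightarrow> (\<exists>k. a = b + 6 * k)"
      by (intro ex_cong1) linarith
    also have "\<dots> \<longleftrightarrow> a mod 6 = b mod 6"
      by (metis mod_eqE mod_mult_self2)
    finally show ?thesis .
  qed
  then show ?thesis
    unfolding wrap_eq_iff by (simp add: real_point_def)
qed

text \<open>The later vertices are spread evenly over the rim, so that \<open>9\<close> is at its beginning and \<open>n - 1\<close> at
its end.\<close>

definition torus_vertex :: "nat \<Rightarrow> nat \<Rightarrow> complex \<times> complex" where
  "torus_vertex n v = (if v < 10 then wrap (real_point (position v))
     else fan_point 1 ((real v - 9) / (real n - 10)))"

lemma torus_vertex_fan:
  assumes "9 \<le> v" shows "torus_vertex n v = fan_point 1 ((real v - 9) / (real n - 10))"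
proof (cases "v = 9")
  case True
  then show ?thesis by (simp add: torus_vertex_def fan_point_def position_def real_point_def)
qed (use assms in \<open>simp add: torus_vertex_def\<close>)

lemma torus_vertex_hub: "torus_vertex n 0 = fan_point 0 s"
  by (simp add: torus_vertex_def fan_point_def position_def real_point_def)

lemma torus_vertex_base_inj:
  assumes "u < 10" "v < 10" "torus_vertex n u = torus_vertex n v"
  shows "u = v"
proof -
  let ?r = "\<lambda>v. (fst (position v) mod 6, snd (position v) mod 6)"
  have "inj_on ?r {..<10}"
    using positions_distinct by (simp add: distinct_map lessThan_atLeast0)
  moreover have "?r u = ?r v"
    using assms by (simp add: torus_vertex_def wrap_real_point_eq_iff)
  ultimately show ?thesis using assms(1,2) by (meson inj_onD lessThan_iff)
qed

lemma base_segmentE: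
  assumes "((u, v), X) \<in> set base_segments"
  obtains P Q where "X = [P, Q]" "u < 10" "v < 10" "u \<noteq> v" "P \<noteq> Q"
    "torus_vertex n u = wrap (real_point P)" "torus_vertex n v = wrap (real_point Q)"
    "\<bar>fst P - fst Q\<bar> < 6" "\<bar>snd P - snd Q\<bar> < 6" "within_window X"
proof -
  have "within_window X \<and> (case X of [P, Q] \<Rightarrow> u < 10 \<and> v < 10 \<and> u \<noteq> v \<and>
       fst P mod 6 = fst (position u) mod 6 \<and> snd P mod 6 = snd (position u) mod 6 \<and>
       fst Q mod 6 = fst (position v) mod 6 \<and> snd Q mod 6 = snd (position v) mod 6 \<and>
       \<bar>fst P - fst Q\<bar> < 6 \<and> \<bar>snd P - snd Q\<bar> < 6 \<and> P \<noteq> Q | _ \<Rightarrow> False)"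
    using base_segments_valid assms unfolding list_all_iff by fastforce
  then show ?thesis
    using that by (auto simp: torus_vertex_def wrap_real_point_eq_iff split: list.splits)
qed

lemma base_segment_arc:
  assumes "((u, v), X) \<in> set base_segments"
  shows "arc_between (wrap ` polygon X) (torus_vertex n u) (torus_vertex n v)"
proof -
  obtain P Q where X: "X = [P, Q]" "P \<noteq> Q" "\<bar>fst P - fst Q\<bar> < 6" "\<bar>snd P - snd Q\<bar> < 6"
    "torus_vertex n u = wrap (real_point P)" "torus_vertex n v = wrap (real_point Q)"
    using base_segmentE[OF assms] by metis
  define l where "l = linepath (real_point P) (real_point Q)"
  have l: "fst (l t) = real_of_int (fst P) + t * real_of_int (fst Q - fst P)"
    "snd (l t) = real_of_int (snd P) + t * real_of_int (snd Q - snd P)" for t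
    by (simp_all add: l_def linepath_def real_point_def algebra_simps)
  have "inj_on (wrap \<circ> l) {0..1}"
  proof (rule inj_onI)
    fix s t :: real assume st: "s \<in> {0..1}" "t \<in> {0..1}" "(wrap \<circ> l) s = (wrap \<circ> l) t"
    have near: "\<bar>(s - t) * d\<bar> < 6" if "\<bar>d\<bar> < 6" for d :: real
    proof -
      have "\<bar>s - t\<bar> \<le> 1" using st(1,2) by (simp add: abs_le_iff)
      then have "\<bar>s - t\<bar> * \<bar>d\<bar> \<le> \<bar>d\<bar>" by (intro mult_left_le_one_le) auto
      then show ?thesis using that by (simp add: abs_mult)
    qed
    have "\<bar>real_of_int (fst Q - fst P)\<bar> < 6" "\<bar>real_of_int (snd Q - snd P)\<bar> < 6"
      using X(3,4) by linarith+
    then have "l s = l t"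
      using st(3) near[of "fst Q - fst P"] near[of "snd Q - snd P"]
      by (intro wrap_inj_near) (simp_all add: l algebra_simps)
    moreover have "inj_on l {0..1}"
      using X(2) arc_linepath[of "real_point P" "real_point Q"]
      by (auto simp: l_def arc_def real_point_def prod_eq_iff)
    ultimately show "s = t" using st(1,2) by (meson inj_onD)
  qed
  moreover have "continuous_on {0..1} (wrap \<circ> l)"
    unfolding l_def using continuous_on_wrap by (intro continuous_on_compose continuous_intros)
  ultimately have "arc_between ((wrap \<circ> l) ` {0..1}) ((wrap \<circ> l) 0) ((wrap \<circ> l) 1)"
    by (intro arc_between_interval) auto
  moreover have "l ` {0..1} = polygon X"
    unfolding l_def polygon_def X(1) using path_image_linepath[of "real_point P" "real_point Q"]
    by (simp add: path_image_def segment_convex_hull)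
  then have "(wrap \<circ> l) ` {0..1} = wrap ` polygon X" by (metis image_comp)
  moreover have "(wrap \<circ> l) 0 = torus_vertex n u" "(wrap \<circ> l) 1 = torus_vertex n v"
    using X(5,6) by (simp_all add: l_def linepath_def)
  ultimately show ?thesis by simp
qed

lemma base_segment_corner:
  assumes "((u, v), X) \<in> set base_segments" "Q \<in> set X"
  shows "\<exists>a\<in>{u, v}. a < 10 \<and> wrap (real_point Q) = torus_vertex n a"
  using base_segmentE[OF assms(1), of n] assms(2) by (metis empty_iff insert_iff list.simps(15) list.set(1))

lemma sorted_wrt_distinct_elements:
  assumes "sorted_wrt r xs" "x \<in> set xs" "y \<in> set xs" "x \<noteq> y"
  shows "r x y \<or> r y x"
  using assms by (induction xs) auto

lemma base_segments_meet:
  assumes X: "((u, v), X) \<in> set base_segments" and Y: "((u', v'), Y) \<in> set base_segments"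
    and "{u, v} \<noteq> {u', v'}" and z: "z \<in> wrap ` polygon X" "z \<in> wrap ` polygon Y"
  shows "z \<in> torus_vertex n ` ({u, v} \<inter> {u', v'})"
proof -
  have "sorted_wrt (\<lambda>s t. separable_on_torus (snd s) (snd t)) base_segments"
    using base_segments_separable by (simp add: sorted_wrt_map)
  then have sep: "separable_on_torus X Y \<or> separable_on_torus Y X"
    using sorted_wrt_distinct_elements[OF _ X Y] assms(3) by fastforce
  have win: "within_window X" "within_window Y"
    using base_segmentE[OF X] base_segmentE[OF Y] by metis+
  obtain x y where xy: "x \<in> polygon X" "y \<in> polygon Y" "z = wrap x" "wrap x = wrap y" using z by auto
  have "\<exists>P\<in>set X. \<exists>Q\<in>set Y. z = wrap (real_point P) \<and> z = wrap (real_point Q)"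
    using sep separable_on_torus_meet[OF _ win xy(1,2,4)]
      separable_on_torus_meet[OF _ win(2,1) xy(2,1) xy(4)[symmetric]] xy(3,4) by metis
  then obtain a b where "a \<in> {u, v}" "b \<in> {u', v'}" "a < 10" "b < 10"
    "z = torus_vertex n a" "z = torus_vertex n b"
    using base_segment_corner[OF X, of _ n] base_segment_corner[OF Y, of _ n] by metis
  then show ?thesis using torus_vertex_base_inj by blast
qed

lemma no_position_at_apex:
  "list_all (\<lambda>v. \<not> (fst (position v) mod 6 = 0 \<and> snd (position v) mod 6 = 1)) [0..<10]"
  by code_simp

text \<open>The drawing of the base graph touches the fan triangle in the vertices \<open>0\<close> and \<open>9\<close> only: by
separation a common point is a corner of both, and no vertex is placed at the apex.\<close>

lemma base_segment_meets_fan: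
  assumes X: "((u, v), X) \<in> set base_segments" and rs: "r \<in> {0..1}" "s \<in> {0..1}"
    and z: "fan_point r s \<in> wrap ` polygon X"
  shows "0 \<in> {u, v} \<and> r = 0 \<or> 9 \<in> {u, v} \<and> r = 1 \<and> s = 0"
proof -
  have sep: "separable_on_torus fan_triangle X"
    using base_segments_fan_separable X by (auto simp: list_all_iff)
  have win: "within_window fan_triangle" "within_window X"
    using base_segmentE[OF X, of 11 "within_window X"] by (simp_all add: within_window_def fan_triangle_def)
  obtain x where x: "x \<in> polygon fan_triangle" "fan_point r s = wrap x"
    using fan_point_in_triangle[OF rs] by blast
  moreover obtain y where y: "y \<in> polygon X" "fan_point r s = wrap y"
    using z by blast
  moreover have "wrap x = wrap y" using x(2) y(2) by simp
  ultimately
  obtain P Q where PQ: "P \<in> set fan_triangle" "Q \<in> set X"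
    "fan_point r s = wrap (real_point P)" "fan_point r s = wrap (real_point Q)"
    using separable_on_torus_meet[OF sep win] by metis
  obtain a where a: "a \<in> {u, v}" "a < 10" "fan_point r s = torus_vertex 11 a"
    using base_segment_corner[OF X PQ(2)] PQ(4) by metis
  consider "P = (4,2)" | "P = (0,0)" | "P = (0,1)"
    using PQ(1) by (auto simp: fan_triangle_def)
  then show ?thesis
  proof cases
    case 1
    then have hub: "fan_point r s = torus_vertex 11 0"
      using PQ(3) by (simp add: torus_vertex_def position_def)
    then have "a = 0" using a torus_vertex_base_inj[of a 0 11] by simp
    moreover have "r = 0"
      using hub rs fan_point_eq_iff[of r 0 s 0] by (simp add: torus_vertex_hub[of 11 0])
    ultimately show ?thesis using a by simp
  next
    case 2
    then have rim: "fan_point r s = torus_vertex 11 9"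
      using PQ(3) by (simp add: torus_vertex_def position_def)
    then have "a = 9" using a torus_vertex_base_inj[of a 9 11] by simp
    moreover have "r = 1 \<and> s = 0"
      using rim rs fan_point_eq_iff[of r 1 s 0] by (auto simp: torus_vertex_fan)
    ultimately show ?thesis using a by simp
  next
    case 3
    then have "fst (position a) mod 6 = 0 \<and> snd (position a) mod 6 = 1"
      using a PQ(3) wrap_real_point_eq_iff[of "position a" "(0,1)"] by (simp add: torus_vertex_def)
    then show ?thesis using no_position_at_apex a(2) by (auto simp: list_all_iff)
  qed
qed

lemma base_segments_cover: "set (concat (map (\<lambda>((u, v), X). [u, v]) base_segments)) = {..<10}"
  by (simp add: base_segments_def lessThan_nat_numeral lessThan_Suc numeral_eq_Suc) blast

lemma base_vertex_not_fan_point: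
  assumes "a < 10" "r \<in> {0..1}" "s \<in> {0..1}" "fan_point r s = torus_vertex n a"
  shows "r = 0 \<or> r = 1 \<and> s = 0"
proof -
  have "a \<in> set (concat (map (\<lambda>((u, v), X). [u, v]) base_segments))"
    using base_segments_cover assms(1) by blast
  then obtain u v X where X: "((u, v), X) \<in> set base_segments" "a \<in> {u, v}" by auto
  then have "torus_vertex n a \<in> wrap ` polygon X"
    using arc_between_props
    using base_segment_arc[OF X(1), of n] unfolding arc_between_def
    by (metis insert_iff pathfinish_in_path_image pathstart_in_path_image singletonD)
  then show ?thesis
    using base_segment_meets_fan[OF X(1) assms(2,3)] assms(4) by metis
qed

lemma base_segments_complete:
  "list_all (\<lambda>i. (i, Suc i) \<in> set (map fst base_segments)) [0..<9]"
  "list_all (\<lambda>e. e \<in> set (map fst base_segments)) chords"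
  by code_simp+

lemma hamiltonian_fan_embeds_in_torus:
  assumes "n \<ge> 11"
  shows "embeds_in {..<n} (hamiltonian_fan n) torus"
proof -
  let ?\<phi> = "torus_vertex n"
  define t where "t i = (real i - 9) / (real n - 10)" for i
  define spoke where "spoke i = (\<lambda>r. fan_point r (t i)) ` {0..1}" for i
  define rim where "rim i = fan_point 1 ` {t i..t (Suc i)}" for i
  have t_less: "t i < t j \<longleftrightarrow> i < j" and t_eq: "t i = t j \<longleftrightarrow> i = j" for i j
    using assms by (auto simp: t_def divide_strict_right_mono divide_less_cancel)
  have t_range: "t i \<in> {0..1}" if "9 \<le> i" "i < n" for i
    using that assms by (auto simp: t_def divide_simps)
  have t_le: "t i \<le> t j \<longleftrightarrow> i \<le> j" for i j
    using t_less[of j i] by linarith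
  have t9: "t 9 = 0" by (simp add: t_def)
  have fan: "?\<phi> i = fan_point 1 (t i)" if "9 \<le> i" for i
    using torus_vertex_fan[OF that] by (simp add: t_def)
  have hub: "fan_point 0 s = ?\<phi> 0" for s
    by (rule torus_vertex_hub[symmetric])
  have rim_range: "s \<in> {0..1}" if "s \<in> {t i..t (Suc i)}" "9 \<le> i" "Suc i < n" for s i
    using that t_range[of i] t_range[of "Suc i"] by auto
  define B where "B = {({u, v}, wrap ` polygon X) | u v X. ((u, v), X) \<in> set base_segments}"
  define F where "F = {({0, i}, spoke i) | i. 10 \<le> i \<and> i < n} \<union> {({i, Suc i}, rim i) | i. 9 \<le> i \<and> Suc i < n}"
  have base: "\<exists>u v W. e = {u, v} \<and> X = wrap ` polygon W \<and> ((u, v), W) \<in> set base_segments"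
    if "(e, X) \<in> B" for e X
    using that unfolding B_def by blast
  have in_base: "\<exists>X. ({u, v}, X) \<in> B" if uv: "(u, v) \<in> set (map fst base_segments)" for u v
  proof -
    obtain X where "((u, v), X) \<in> set base_segments" using uv by auto
    then show ?thesis unfolding B_def by blast
  qed
  have inj: "inj_on ?\<phi> {..<n}"
  proof (rule linorder_inj_onI)
    fix a b assume ab: "a < b" "a \<in> {..<n}" "b \<in> {..<n}"
    show "?\<phi> a \<noteq> ?\<phi> b"
    proof
      assume eq: "?\<phi> a = ?\<phi> b"
      consider "b < 10" | "9 \<le> a" | "a < 10" "10 \<le> b" by linarith
      then show False
      proof cases
        case 1
        then show False using eq ab torus_vertex_base_inj[of a b n] by simp
      next
        case 2
        then show False
          using eq ab fan[of a] fan[of b] t_range[of a] t_range[of b] t_eq[of a b]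
            fan_point_eq_iff[of 1 1 "t a" "t b"] by auto
      next
        case 3
        then show False
          using eq ab fan[of b] t_range[of b] t_eq[of b 9] t9
            base_vertex_not_fan_point[of a 1 "t b" n] by auto
      qed
    qed
  qed auto
  have fan_meet: "X \<inter> Y \<subseteq> ?\<phi> ` (e \<inter> f)"
    if eX: "(e, X) \<in> F"
      and fY: "(f, Y) \<in> F"
      and ef: "e \<noteq> f" for e f X Y
  proof -
    have spokes: "spoke i \<inter> spoke j \<subseteq> {?\<phi> 0}" if "10 \<le> i" "i < n" "10 \<le> j" "j < n" "i \<noteq> j" for i j
      using that t_range[of i] t_range[of j] t_eq[of i j] hub
      by (auto simp: spoke_def fan_point_eq_iff)
    have spoke_rim: "spoke i \<inter> rim j \<subseteq> ?\<phi> ` ({0, i} \<inter> {j, Suc j})"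
      if "10 \<le> i" "i < n" "9 \<le> j" "Suc j < n" for i j
    proof
      fix z assume "z \<in> spoke i \<inter> rim j"
      then obtain r s where rs: "r \<in> {0..1}" "s \<in> {t j..t (Suc j)}" "z = fan_point r (t i)" "z = fan_point 1 s"
        by (auto simp: spoke_def rim_def)
      then have "r = 1" "s = t i"
        using fan_point_eq_iff[of r 1 "t i" s] t_range[of i] rim_range[of s j] that by auto
      then have "j \<le> i" "i \<le> Suc j" "z = ?\<phi> i"
        using rs t_le fan[of i] that by auto
      then show "z \<in> ?\<phi> ` ({0, i} \<inter> {j, Suc j})" by (auto simp: le_Suc_eq)
    qed
    have rims: "rim i \<inter> rim j \<subseteq> ?\<phi> ` ({i, Suc i} \<inter> {j, Suc j})"
      if "9 \<le> i" "i < j" "Suc j < n" for i j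
    proof
      fix z assume "z \<in> rim i \<inter> rim j"
      then obtain s s' where s: "s \<in> {t i..t (Suc i)}" "s' \<in> {t j..t (Suc j)}" "z = fan_point 1 s" "z = fan_point 1 s'"
        by (auto simp: rim_def)
      then have "s = s'"
        using fan_point_eq_iff[of 1 1 s s'] rim_range[of s i] rim_range[of s' j] that by auto
      then have "t j \<le> t (Suc i)" using s by auto
      then have j: "j = Suc i" using t_le[of j "Suc i"] that(2) by simp
      then have "s = t j" using s \<open>s = s'\<close> by auto
      then show "z \<in> ?\<phi> ` ({i, Suc i} \<inter> {j, Suc j})" using s(3) fan[of j] j that(1) by auto
    qed
    show ?thesis
      using eX fY unfolding F_def
    proof (elim UnE CollectE exE conjE Pair_inject)
      fix i j assume "e = {0, i}" "X = spoke i" "f = {0, j}" "Y = spoke j" "10 \<le> i" "i < n" "10 \<le> j" "j < n"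
      then show ?thesis using spokes[of i j] ef by (cases "i = j") auto
    next
      fix i j assume "e = {0, i}" "X = spoke i" "f = {j, Suc j}" "Y = rim j" "10 \<le> i" "i < n" "9 \<le> j" "Suc j < n"
      then show ?thesis using spoke_rim[of i j] by simp
    next
      fix i j assume "e = {i, Suc i}" "X = rim i" "f = {0, j}" "Y = spoke j" "9 \<le> i" "Suc i < n" "10 \<le> j" "j < n"
      then show ?thesis using spoke_rim[of j i] by (simp add: Int_commute)
    next
      fix i j assume "e = {i, Suc i}" "X = rim i" "f = {j, Suc j}" "Y = rim j" "9 \<le> i" "Suc i < n" "9 \<le> j" "Suc j < n"
      then show ?thesis
        using rims[of i j] rims[of j i] ef Int_commute[of X Y] Int_commute[of e f]
        by (cases rule: linorder_cases[of i j]) simp_all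
    qed
  qed
  have base_fan_meet: "X \<inter> Y \<subseteq> ?\<phi> ` (e \<inter> f)"
    if W: "e = {u, v}" "X = wrap ` polygon W" "((u, v), W) \<in> set base_segments"
      and fY: "(f, Y) \<in> F"
    for e f X Y u v W
  proof
    fix z assume z: "z \<in> X \<inter> Y"
    show "z \<in> ?\<phi> ` (e \<inter> f)"
      using fY unfolding F_def
    proof (elim UnE CollectE exE conjE Pair_inject)
      fix i assume i: "f = {0, i}" "Y = spoke i" "10 \<le> i" "i < n"
      then obtain r where r: "r \<in> {0..1}" "z = fan_point r (t i)" using z by (auto simp: spoke_def)
      have "t i \<noteq> 0" using t_eq[of i 9] t9 i(3) by simp
      then have "0 \<in> e" "r = 0"
        using base_segment_meets_fan[OF W(3) r(1), of "t i"] t_range[of i] i z r W by auto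
      then show ?thesis using r i hub[of "t i"] by simp
    next
      fix i assume i: "f = {i, Suc i}" "Y = rim i" "9 \<le> i" "Suc i < n"
      then obtain s where s: "s \<in> {t i..t (Suc i)}" "z = fan_point 1 s" using z by (auto simp: rim_def)
      then have "9 \<in> e" "s = 0"
        using base_segment_meets_fan[OF W(3), of 1 s] rim_range[of s i] i z W by auto
      moreover from this have "i = 9" using s t_le[of i 9] t9 i(3) by auto
      ultimately show ?thesis using s i fan[of 9] t9 by auto
    qed
  qed
  show ?thesis
  proof (rule embeds_inI[of ?\<phi> _ _ _ "B \<union> F"])
    show "inj_on ?\<phi> {..<n}" by (fact inj)
    show "?\<phi> ` {..<n} \<subseteq> torus"
      by (auto simp: torus_vertex_def fan_point_in_torus wrap_in_torus)
    show "{..<n} = \<Union> (hamiltonian_fan n)"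
    proof
      show "\<Union> (hamiltonian_fan n) \<subseteq> {..<n}"
      proof (rule Union_least)
        fix e assume "e \<in> hamiltonian_fan n"
        then show "e \<subseteq> {..<n}"
          using assms chords_less by (cases rule: hamiltonian_fan_cases) fastforce+
      qed
      show "{..<n} \<subseteq> \<Union> (hamiltonian_fan n)"
      proof
        fix i assume "i \<in> {..<n}"
        then have "i < n" by simp
        show "i \<in> \<Union> (hamiltonian_fan n)"
        proof (cases i)
          case 0
          then have "{i, Suc i} \<in> hamiltonian_fan n" using assms by (intro hamiltonian_fan_edges(1)) simp
          then show ?thesis by blast
        next
          case (Suc j)
          then have "{j, i} \<in> hamiltonian_fan n" using hamiltonian_fan_edges(1)[of j n] \<open>i < n\<close> by simp
          then show ?thesis by blast
        qed
      qed
    qed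
  next
    fix e assume "e \<in> hamiltonian_fan n"
    then show "\<exists>X. (e, X) \<in> B \<union> F"
    proof (cases rule: hamiltonian_fan_cases)
      case (1 i)
      show ?thesis
      proof (cases "i < 9")
        case True
        then have "(i, Suc i) \<in> set (map fst base_segments)"
          using base_segments_complete(1) unfolding list_all_iff by simp
        then show ?thesis using 1 in_base by blast
      next
        case False
        then have "9 \<le> i" by simp
        then have "({i, Suc i}, rim i) \<in> F" using 1 unfolding F_def by blast
        then show ?thesis using 1 by blast
      qed
    next
      case (2 i)
      then show ?thesis unfolding F_def by blast
    next
      case (3 u v)
      then have "(u, v) \<in> set (map fst base_segments)"
        using base_segments_complete(2) by (simp only: list_all_iff)
      then show ?thesis using 3 in_base by blast
    qed
  next
    fix e X assume "(e, X) \<in> B \<union> F"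
    then consider u v W where "e = {u, v}" "X = wrap ` polygon W" "((u, v), W) \<in> set base_segments"
      | i where "e = {0, i}" "X = spoke i" "10 \<le> i" "i < n"
      | i where "e = {i, Suc i}" "X = rim i" "9 \<le> i" "Suc i < n"
      using base[of e X] unfolding F_def by blast
    then show "X \<subseteq> torus \<and> (\<exists>u v. e = {u, v} \<and> arc_between X (?\<phi> u) (?\<phi> v))"
    proof cases
      case 1
      then show ?thesis using base_segment_arc wrap_in_torus by blast
    next
      case (2 i)
      have "arc_between (spoke i) (fan_point 0 (t i)) (fan_point 1 (t i))"
        unfolding spoke_def using 2 t_range[of i]
        by (intro arc_between_interval continuous_on_fan_point inj_onI) (auto simp: fan_point_eq_iff)
      moreover have "spoke i \<subseteq> torus" by (auto simp: spoke_def fan_point_in_torus)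
      moreover have "?\<phi> 0 = fan_point 0 (t i)" "?\<phi> i = fan_point 1 (t i)"
        using 2 hub fan by simp_all
      ultimately show ?thesis using 2(1,2) by metis
    next
      case (3 i)
      have "arc_between (rim i) (fan_point 1 (t i)) (fan_point 1 (t (Suc i)))"
        unfolding rim_def using 3 rim_range[of _ i] t_less[of i "Suc i"]
        by (intro arc_between_interval continuous_on_fan_point inj_onI) (auto simp: fan_point_eq_iff)
      moreover have "rim i \<subseteq> torus" by (auto simp: rim_def fan_point_in_torus)
      moreover have "?\<phi> i = fan_point 1 (t i)" "?\<phi> (Suc i) = fan_point 1 (t (Suc i))"
        using 3 fan by simp_all
      ultimately show ?thesis using 3(1,2) by metis
    qed
  next
    fix e f X Y assume BF: "(e, X) \<in> B \<union> F" "(f, Y) \<in> B \<union> F" and ef: "e \<noteq> f"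
    consider "(e, X) \<in> B" "(f, Y) \<in> B" | "(e, X) \<in> B" "(f, Y) \<in> F"
      | "(e, X) \<in> F" "(f, Y) \<in> B" | "(e, X) \<in> F" "(f, Y) \<in> F"
      using BF by blast
    then show "X \<inter> Y \<subseteq> ?\<phi> ` (e \<inter> f)"
    proof cases
      case 1
      then obtain u v W u' v' W' where eX: "e = {u, v}" "X = wrap ` polygon W" "((u, v), W) \<in> set base_segments"
        and fY: "f = {u', v'}" "Y = wrap ` polygon W'" "((u', v'), W') \<in> set base_segments"
        using base by metis
      show ?thesis
        using base_segments_meet[OF eX(3) fY(3)] ef unfolding eX(1,2) fY(1,2) by (metis IntE subsetI)
    next
      case 2
      obtain u v W where "e = {u, v}" "X = wrap ` polygon W" "((u, v), W) \<in> set base_segments"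
        using base[OF 2(1)] by metis
      then show ?thesis by (rule base_fan_meet[OF _ _ _ 2(2)])
    next
      case 3
      obtain u v W where "f = {u, v}" "Y = wrap ` polygon W" "((u, v), W) \<in> set base_segments"
        using base[OF 3(2)] by metis
      then have "Y \<inter> X \<subseteq> ?\<phi> ` (f \<inter> e)" by (rule base_fan_meet[OF _ _ _ 3(1)])
      then show ?thesis by (simp add: Int_commute)
    next
      case 4
      then show ?thesis by (rule fan_meet) (fact ef)
    qed
  qed
qed

section \<open>Hamiltonian cycles as closed paths\<close>

lemma path_edges_append: "path_edges (p @ x # q) = path_edges (p @ [x]) \<union> path_edges (x # q)"
  by (induction p rule: path_edges.induct) (auto simp: insert_commute)

lemma path_edges_rev: "path_edges (rev p) = path_edges p"
proof (induction p rule: path_edges.induct)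
  case (1 x y p)
  have "path_edges (rev (x # y # p)) = path_edges (rev p @ [y]) \<union> path_edges [y, x]"
    using path_edges_append[of "rev p" y "[x]"] by simp
  then show ?case using 1 by (simp add: insert_commute)
qed auto

lemma path_edges_nth: "path_edges p = {{p ! i, p ! Suc i} | i. Suc i < length p}"
proof (induction p rule: path_edges.induct)
  case (1 x y p)
  have "{{(x # y # p) ! i, (x # y # p) ! Suc i} | i. Suc i < length (x # y # p)} =
      insert {x, y} {{(y # p) ! i, (y # p) ! Suc i} | i. Suc i < length (y # p)}" (is "?L = ?R")
  proof
    show "?L \<subseteq> ?R"
    proof
      fix e assume "e \<in> ?L"
      then obtain i where "Suc i < length (x # y # p)" "e = {(x # y # p) ! i, (x # y # p) ! Suc i}"
        by blast
      then show "e \<in> ?R" by (cases i) auto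
    qed
    show "?R \<subseteq> ?L"
    proof
      fix e assume "e \<in> ?R"
      then consider "e = {x, y}" | i where "Suc i < length (y # p)" "e = {(y # p) ! i, (y # p) ! Suc i}"
        by blast
      then show "e \<in> ?L"
      proof cases
        case 1
        then show ?thesis by (intro CollectI exI[of _ 0]) simp
      next
        case (2 i)
        then show ?thesis by (intro CollectI exI[of _ "Suc i"]) simp
      qed
    qed
  qed
  then show ?case using 1 by simp
qed auto

text \<open>Closed walks as paths returning to their first vertex: splitting and reversal of cycles are then
instances of the corresponding facts about paths.\<close>

lemma cyclic_edges_path: "cyclic_edges (x # p) = path_edges (x # p @ [x])"
proof -
  have "{(x # p) ! i, (x # p) ! (Suc i mod length (x # p))} = {(x # p @ [x]) ! i, (x # p @ [x]) ! Suc i}"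
    if "i < length (x # p)" for i
    using that by (cases "i = length p") (auto simp: nth_Cons' nth_append)
  then show ?thesis
    unfolding cyclic_edges_def path_edges_nth
    by (intro Collect_cong ex_cong1) auto
qed

lemma cyclic_edges_rotate: "cyclic_edges (p @ q) = cyclic_edges (q @ p)"
proof (cases p)
  case Nil
  then show ?thesis by simp
next
  case (Cons x p')
  show ?thesis
  proof (cases q)
    case Nil
    then show ?thesis by simp
  next
    case (Cons y q')
    have "path_edges (x # p' @ y # q' @ [x]) = path_edges (x # p' @ [y]) \<union> path_edges (y # q' @ [x])"
      using path_edges_append[of "x # p'" y "q' @ [x]"] by simp
    moreover have "path_edges (y # q' @ x # p' @ [y]) = path_edges (y # q' @ [x]) \<union> path_edges (x # p' @ [y])"
      using path_edges_append[of "y # q'" x "p' @ [y]"] by simp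
    ultimately show ?thesis
      unfolding \<open>p = x # p'\<close> Cons by (simp add: cyclic_edges_path Un_commute)
  qed
qed

lemma cyclic_edges_reverse: "cyclic_edges (x # rev p) = cyclic_edges (x # p)"
  unfolding cyclic_edges_path using path_edges_rev[of "x # p @ [x]"] by simp

lemma hamiltonian_cycle_from:
  assumes "hamiltonian_cycle V E C" "x \<in> V"
  obtains p where "distinct (x # p)" "set (x # p) = V" "length p \<ge> 2" "C = cyclic_edges (x # p)" "C \<subseteq> E"
proof -
  obtain vs where vs: "distinct vs" "set vs = V" "length vs \<ge> 3" "C = cyclic_edges vs" "C \<subseteq> E"
    using assms(1) unfolding hamiltonian_cycle_def by blast
  obtain p q where pq: "vs = p @ x # q" using assms(2) vs(2) split_list by metis
  show ?thesis
    using that[of "q @ p"] vs cyclic_edges_rotate[of p "x # q"] unfolding pq by auto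
qed

lemma cyclic_edges_image:
  "cyclic_edges vs = (\<lambda>i. {vs ! i, vs ! (Suc i mod length vs)}) ` {..<length vs}"
  unfolding cyclic_edges_def by blast

lemma cyclic_edges_map: "cyclic_edges (map f vs) = (`) f ` cyclic_edges vs"
  unfolding cyclic_edges_image length_map image_image
proof (rule image_cong)
  fix i assume "i \<in> {..<length vs}"
  then have "i < length vs" "Suc i mod length vs < length vs" by (auto intro: mod_less_divisor)
  then show "{map f vs ! i, map f vs ! (Suc i mod length vs)} = f ` {vs ! i, vs ! (Suc i mod length vs)}"
    by simp
qed simp

lemma cyclic_edges_upt: "cyclic_edges [0..<n] = (\<lambda>i. {i, Suc i mod n}) ` {..<n}"
  unfolding cyclic_edges_image by (intro image_cong) auto

lemma cyclic_edges_subset: "e \<in> cyclic_edges vs \<Longrightarrow> e \<subseteq> set vs"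
proof -
  assume "e \<in> cyclic_edges vs"
  then obtain i where i: "i < length vs" "e = {vs ! i, vs ! (Suc i mod length vs)}"
    unfolding cyclic_edges_def by blast
  then have "Suc i mod length vs < length vs" by (intro mod_less_divisor) auto
  then show "e \<subseteq> set vs" using i by simp
qed

section \<open>The unique hamiltonian cycle of the family\<close>

definition base_neighbours :: "nat \<Rightarrow> nat list" where
  "base_neighbours v = (let ps = map fst base_segments in
     map snd (filter (\<lambda>p. fst p = v) ps) @ map fst (filter (\<lambda>p. snd p = v) ps))"

fun extensions :: "nat \<Rightarrow> nat \<Rightarrow> nat list \<Rightarrow> nat list list" where
  "extensions 0 v used = [[]]"
| "extensions (Suc k) v used =
    [w # p. w \<leftarrow> filter (\<lambda>w. w \<notin> set used) (base_neighbours v), p \<leftarrow> extensions k w (w # used)]"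

lemma extensions_complete:
  assumes "distinct p" "set p \<inter> set used = {}" "\<And>v w. {v, w} \<in> path_edges (u # p) \<Longrightarrow> w \<in> set (base_neighbours v)"
  shows "p \<in> set (extensions (length p) u used)"
  using assms
proof (induction p arbitrary: u used)
  case (Cons w p)
  have "p \<in> set (extensions (length p) w (w # used))"
    using Cons.prems by (intro Cons.IH) auto
  moreover have "w \<in> set (base_neighbours u)" using Cons.prems(3) by simp
  ultimately show ?case using Cons.prems(2) by auto
qed simp

text \<open>Here the choice of the six chords matters: on the first ten vertices they admit no hamiltonian path
from \<open>9\<close> to \<open>0\<close> other than the one without chords.\<close>

lemma unique_base_path: "filter (\<lambda>p. 0 \<in> set (base_neighbours (last p))) (extensions 8 9 [9, 0]) = [[8,7,6,5,4,3,2,1]]"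
  by code_simp

lemma base_edge_neighbour:
  assumes "{v, w} \<in> hamiltonian_fan n" "v < 10" "w < 10"
  shows "w \<in> set (base_neighbours v)"
proof -
  obtain a b where ab: "{v, w} = {a, b}" "(a, b) \<in> set (map fst base_segments)"
    using assms(1)
  proof (cases rule: hamiltonian_fan_cases)
    case (1 i)
    then have "i < 9" using assms(2,3) by (auto simp: doubleton_eq_iff)
    then have "(i, Suc i) \<in> set (map fst base_segments)"
      using base_segments_complete(1) unfolding list_all_iff by simp
    then show ?thesis using that 1 by blast
  next
    case (2 i)
    then show ?thesis using assms(2,3) by (auto simp: doubleton_eq_iff)
  next
    case (3 a b)
    then have "(a, b) \<in> set (map fst base_segments)"
      using base_segments_complete(2) by (simp only: list_all_iff)
    then show ?thesis using that 3 by blast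
  qed
  then show ?thesis
    unfolding base_neighbours_def Let_def by (auto simp: doubleton_eq_iff) force+
qed

lemma fan_neighbour:
  assumes "{k, w} \<in> hamiltonian_fan n" "10 \<le> k"
  shows "w = 0 \<or> w = k - 1 \<or> w = Suc k \<and> w < n"
  using assms(1)
proof (cases rule: hamiltonian_fan_cases)
  case (3 a b)
  then show ?thesis using assms(2) chords_less[of a b] by (auto simp: doubleton_eq_iff)
qed (use assms(2) in \<open>auto simp: doubleton_eq_iff\<close>)

text \<open>Once a hamiltonian cycle enters the fan by \<open>0, n - 1\<close>, it has to run along the whole rim down to
\<open>9\<close>: a rim vertex has only its two rim neighbours and the hub as neighbours, and the hub and the
upper neighbour have already been visited.\<close>

lemma hamiltonian_fan_descent:
  assumes p: "distinct (0 # p)" "set (0 # p) = {..<n}" "path_edges (0 # p @ [0]) \<subseteq> hamiltonian_fan n"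
    and "hd p = n - 1" "n \<ge> 11" "p \<noteq> []" "9 \<le> k" "k < n"
  shows "\<exists>q. p = rev [k..<n] @ q"
  using \<open>9 \<le> k\<close> \<open>k < n\<close>
proof (induction "n - k" arbitrary: k)
  case (Suc m)
  show ?case
  proof (cases "k = n - 1")
    case True
    have "[k..<n] = [k]" using True assms(5) upt_conv_Cons[of k n] by simp
    moreover have "p = hd p # tl p" using assms(6) by simp
    ultimately show ?thesis using True assms(4) by (intro exI[of _ "tl p"]) simp
  next
    case False
    then have "m = n - Suc k" "9 \<le> Suc k" "Suc k < n" using Suc(2) Suc.prems by linarith+
    then obtain q where q: "p = rev [Suc k..<n] @ q"
      using Suc(1)[of "Suc k"] by blast
    define l where "l = rev [Suc (Suc k)..<n]"
    have l: "rev [Suc k..<n] = l @ [Suc k]"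
      using False Suc.prems by (simp add: l_def upt_conv_Cons)
    have "k \<in> set (0 # p)" unfolding p(2) using Suc.prems by simp
    then have "q \<noteq> []" using q Suc.prems(1) by auto
    then obtain w q' where w: "q = w # q'" by (cases q) auto
    have "path_edges (0 # p @ [0]) = path_edges ((0 # l) @ [Suc k]) \<union> path_edges (Suc k # w # q' @ [0])"
      using path_edges_append[of "0 # l" "Suc k" "w # q' @ [0]"] q l w by simp
    then have "{Suc k, w} \<in> hamiltonian_fan n" using p(3) by auto
    then have "w = 0 \<or> w = k \<or> w = Suc (Suc k) \<and> w < n"
      using fan_neighbour[of "Suc k" w n] Suc.prems by simp
    moreover have "w \<noteq> 0" "w \<notin> set l" using p(1) q l w by auto
    ultimately have "w = k" by (auto simp: l_def)
    then show ?thesis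
      using q w Suc.prems upt_conv_Cons[of k n] by (intro exI[of _ q']) simp
  qed
qed simp

lemma hamiltonian_fan_cycle_unique:
  assumes n: "n \<ge> 11" and C: "hamiltonian_cycle {..<n} (hamiltonian_fan n) C"
  shows "C = cyclic_edges (0 # rev [9..<n] @ [8,7,6,5,4,3,2,1])"
proof -
  obtain p where p: "distinct (0 # p)" "set (0 # p) = {..<n}" "length p \<ge> 2"
    "C = cyclic_edges (0 # p)" "C \<subseteq> hamiltonian_fan n"
    using hamiltonian_cycle_from[OF C, of 0] n by auto
  \<comment> \<open>The last vertex has only the neighbours \<open>n - 2\<close> and \<open>0\<close>, so it is next to \<open>0\<close> on the cycle.\<close>
  have "hd p = n - 1 \<or> last p = n - 1"
  proof (rule ccontr)
    assume ne: "\<not> (hd p = n - 1 \<or> last p = n - 1)"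
    have "n - 1 \<in> set (0 # p)" unfolding p(2) using n by simp
    then have "n - 1 \<in> set p" using n by simp
    then obtain l r where lr: "p = l @ (n - 1) # r" using split_list by metis
    with ne have "l \<noteq> []" "r \<noteq> []" by auto
    then obtain l' a b r' where l'r': "l = l' @ [a]" "r = b # r'"
      by (metis list.exhaust rev_exhaust)
    have "path_edges (0 # p @ [0]) = path_edges (0 # l' @ [a]) \<union> path_edges (a # (n - 1) # b # r' @ [0])"
      using path_edges_append[of "0 # l'" a "(n - 1) # b # r' @ [0]"] lr l'r' by simp
    then have "{a, n - 1} \<in> hamiltonian_fan n" "{n - 1, b} \<in> hamiltonian_fan n"
      using p(4,5) unfolding cyclic_edges_path by auto
    then have "{n - 1, a} \<in> hamiltonian_fan n" "{n - 1, b} \<in> hamiltonian_fan n"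
      by (simp_all add: insert_commute)
    then have "a = 0 \<or> a = n - 1 - 1" "b = 0 \<or> b = n - 1 - 1"
      using fan_neighbour[of "n - 1" a n] fan_neighbour[of "n - 1" b n] n by linarith+
    moreover have "a \<noteq> 0" "b \<noteq> 0" "a \<noteq> b" using p(1) lr l'r' by auto
    ultimately show False by blast
  qed
  then obtain p' where p': "distinct (0 # p')" "set (0 # p') = {..<n}" "hd p' = n - 1"
    "C = cyclic_edges (0 # p')" "p' \<noteq> []"
  proof
    assume "hd p = n - 1"
    moreover have "p \<noteq> []" using p(3) by auto
    ultimately show ?thesis using that[of p] p by blast
  next
    assume "last p = n - 1"
    moreover have "p \<noteq> []" using p(3) by auto
    ultimately show ?thesis
      using that[of "rev p"] p cyclic_edges_reverse[of 0 p] by (simp add: hd_rev)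
  qed
  have edges: "path_edges (0 # p' @ [0]) \<subseteq> hamiltonian_fan n"
    using p'(4) p(5) by (simp add: cyclic_edges_path)
  obtain q where q: "p' = rev [9..<n] @ q"
    using hamiltonian_fan_descent[OF p'(1,2) edges p'(3) n p'(5), of 9] n by auto
  define l where "l = rev [10..<n]"
  have l: "rev [9..<n] = l @ [9]" using n upt_conv_Cons[of 9 n] by (simp add: l_def)
  have "path_edges (0 # p' @ [0]) = path_edges (0 # l @ [9]) \<union> path_edges (9 # q @ [0])"
    using path_edges_append[of "0 # l" 9 "q @ [0]"] q l by simp
  then have edges': "path_edges (9 # q @ [0]) \<subseteq> hamiltonian_fan n" using edges by blast
  have dist: "distinct q" "set q \<inter> set [9, 0] = {}" using p'(1) q l by auto
  have "set q = {..<n} - set (0 # rev [9..<n])"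
  proof -
    have "set (0 # rev [9..<n]) \<inter> set q = {}" using p'(1) q by auto
    moreover have "set (0 # rev [9..<n]) \<union> set q = {..<n}"
      unfolding p'(2)[symmetric] q by (simp only: set_append list.set Un_insert_left)
    ultimately show ?thesis by blast
  qed
  also have "\<dots> = {1..<9}" using n by auto
  finally have set_q: "set q = {1..<9}" .
  then have "length q = 8" using distinct_card[OF dist(1)] by simp
  have step: "w \<in> set (base_neighbours v)" if "{v, w} \<in> path_edges (9 # q @ [0])" for v w
  proof (rule base_edge_neighbour)
    have "{v, w} \<subseteq> {..<10}"
    proof -
      have "{v, w} \<subseteq> \<Union> (path_edges (9 # q @ [0]))" using that by blast
      also have "\<dots> = insert 9 (insert 0 {1..<9})"
        using Union_path_edges[of "9 # q @ [0]"] set_q by auto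
      also have "\<dots> \<subseteq> {..<10}" by auto
      finally show ?thesis .
    qed
    then show "v < 10" "w < 10" by auto
    show "{v, w} \<in> hamiltonian_fan n" using that edges' by blast
  qed
  have "q \<noteq> []" using \<open>length q = 8\<close> by auto
  then obtain q' z where z: "q = q' @ [z]" by (metis rev_exhaust)
  have "path_edges (9 # q @ [0]) = path_edges (9 # q) \<union> path_edges [z, 0]"
    using path_edges_append[of "9 # q'" z "[0]"] z by simp
  then have "path_edges (9 # q) \<subseteq> path_edges (9 # q @ [0])" "{z, 0} \<in> path_edges (9 # q @ [0])"
    by (simp_all add: subset_insertI)
  then have "q \<in> set (extensions (length q) 9 [9, 0])" "0 \<in> set (base_neighbours (last q))"
    using step extensions_complete[OF dist, of 9] unfolding z last_snoc by blast+
  then have "q \<in> set (filter (\<lambda>p. 0 \<in> set (base_neighbours (last p))) (extensions 8 9 [9, 0]))"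
    using \<open>length q = 8\<close> by simp
  then have "q = [8,7,6,5,4,3,2,1]" unfolding unique_base_path by simp
  then show ?thesis using p'(4) q by simp
qed

lemma hamiltonian_fan_uniquely_hamiltonian:
  assumes "n \<ge> 11"
  shows "uniquely_hamiltonian {..<n} (hamiltonian_fan n)"
proof -
  have "cyclic_edges [0..<n] \<subseteq> hamiltonian_fan n"
  proof
    fix e assume "e \<in> cyclic_edges [0..<n]"
    then obtain i where i: "i < n" "e = {i, [0..<n] ! (Suc i mod n)}"
      unfolding cyclic_edges_def by auto
    show "e \<in> hamiltonian_fan n"
    proof (cases "Suc i = n")
      case True
      then have "e = {0, i}" "10 \<le> i" using i assms by auto
      then show ?thesis using i(1) hamiltonian_fan_edges(2) by simp
    next
      case False
      then show ?thesis using i hamiltonian_fan_edges(1)[of i n] by simp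
    qed
  qed
  then have "hamiltonian_cycle {..<n} (hamiltonian_fan n) (cyclic_edges [0..<n])"
    unfolding hamiltonian_cycle_def using assms
    by (intro conjI exI[of _ "[0..<n]"]) auto
  then show ?thesis
    unfolding uniquely_hamiltonian_def using hamiltonian_fan_cycle_unique[OF assms] by metis
qed

lemma hamiltonian_fan_simple:
  assumes "n \<ge> 11"
  shows "simple_graph {..<n} (hamiltonian_fan n)"
  unfolding simple_graph_def
proof (intro conjI ballI)
  fix e assume "e \<in> hamiltonian_fan n"
  then have "e \<subseteq> {..<n} \<and> card e = 2"
  proof (cases rule: hamiltonian_fan_cases)
    case (3 u v)
    then show ?thesis using assms chords_less[of u v] by auto
  qed (use assms in auto)
  then show "e \<subseteq> {..<n}" "card e = 2" by auto
qed simp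

lemma vertex_degree_ge_3:
  assumes "simple_graph V E" "{v, a} \<in> E" "{v, b} \<in> E" "{v, c} \<in> E" "distinct [a, b, c]"
  shows "vertex_degree E v \<ge> 3"
proof -
  have "E \<subseteq> Pow V" "finite V" using assms(1) unfolding simple_graph_def by auto
  then have fin: "finite {e \<in> E. v \<in> e}" using finite_subset[of E "Pow V"] by simp
  have "{v, a} \<noteq> {v, b}" "{v, a} \<noteq> {v, c}" "{v, b} \<noteq> {v, c}"
    using assms(5) by (auto simp: doubleton_eq_iff)
  then have "card {{v, a}, {v, b}, {v, c}} = 3" by simp
  moreover have "{{v, a}, {v, b}, {v, c}} \<subseteq> {e \<in> E. v \<in> e}" using assms(2-4) by simp
  ultimately show ?thesis unfolding vertex_degree_def using card_mono[OF fin] by metis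
qed

text \<open>Together with the two edges along the cycle, this gives these vertices degree at least three.\<close>

lemma chord_at_inner_vertex:
  "list_all (\<lambda>v. list_ex (\<lambda>c. c \<noteq> v - 1 \<and> c \<noteq> Suc v \<and>
     ((v, c) \<in> set chords \<or> (c, v) \<in> set chords)) [0..<10]) [1..<10]"
  by code_simp

lemma hamiltonian_fan_degree:
  assumes n: "n \<ge> 11" and v: "v < n - 1"
  shows "vertex_degree (hamiltonian_fan n) v \<ge> 3"
proof -
  let ?E = "hamiltonian_fan n"
  note three = vertex_degree_ge_3[OF hamiltonian_fan_simple[OF n]]
  have up: "{v, Suc v} \<in> ?E" using v by (intro hamiltonian_fan_edges) simp
  have down: "{v, v - 1} \<in> ?E" if "v \<noteq> 0"
    using that v hamiltonian_fan_edges(1)[of "v - 1" n] by (simp add: insert_commute)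
  consider "v = 0" | "1 \<le> v" "v < 10" | "10 \<le> v" by linarith
  then show ?thesis
  proof cases
    case 1
    have "{0, 10} \<in> ?E" "{0, 5} \<in> ?E"
      using n by (simp_all add: hamiltonian_fan_edges chords_def)
    then show ?thesis using 1 up three[of 0 1 5 10] by simp
  next
    case 2
    then have "v \<in> set [1..<10]" by simp
    then have "list_ex (\<lambda>c. c \<noteq> v - 1 \<and> c \<noteq> Suc v \<and>
        ((v, c) \<in> set chords \<or> (c, v) \<in> set chords)) [0..<10]"
      using chord_at_inner_vertex unfolding list_all_iff by blast
    then obtain c where c: "c \<noteq> v - 1" "c \<noteq> Suc v" "(v, c) \<in> set chords \<or> (c, v) \<in> set chords"
      unfolding list_ex_iff by blast
    then have "{v, c} \<in> ?E"
      using hamiltonian_fan_edges(3)[of v c n] hamiltonian_fan_edges(3)[of c v n] insert_commute[of v c "{}"]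
      by metis
    then show ?thesis using 2 c up down three[of v "v - 1" "Suc v" c] by simp
  next
    case 3
    then have "{v, 0} \<in> ?E"
      using v hamiltonian_fan_edges(2)[of v n] by (simp add: insert_commute)
    then show ?thesis using 3 up down three[of v "v - 1" "Suc v" 0] by simp
  qed
qed

section \<open>Searching for a second hamiltonian cycle\<close>

fun first_some :: "('a \<Rightarrow> 'b option) \<Rightarrow> 'a list \<Rightarrow> 'b option" where
  "first_some f [] = None"
| "first_some f (x # xs) = (case f x of None \<Rightarrow> first_some f xs | Some y \<Rightarrow> Some y)"

lemma first_some_cong [fundef_cong]:
  "xs = ys \<Longrightarrow> (\<And>x. x \<in> set ys \<Longrightarrow> f x = g x) \<Longrightarrow> first_some f xs = first_some g ys"
  by (induction xs arbitrary: ys) (auto split: option.split)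

lemma first_some_SomeD: "first_some f xs = Some y \<Longrightarrow> \<exists>x\<in>set xs. f x = Some y"
  by (induction xs) (auto split: option.splits)

text \<open>The path is stored with its last vertex first. Soundness of the search is enough, since overlooking
a cycle could only make a certificate fail.\<close>

fun close_path :: "('a \<Rightarrow> 'a list) \<Rightarrow> 'a \<Rightarrow> nat \<Rightarrow> 'a list \<Rightarrow> 'a list option" where
  "close_path nb t 0 (v # p) = (if t \<in> set (nb v) then Some (v # p) else None)"
| "close_path nb t (Suc k) (v # p) = first_some
     (\<lambda>w. if w \<in> set (v # p) then None else close_path nb t k (w # v # p)) (nb v)"
| "close_path nb t k [] = None"

lemma close_path_sound:
  assumes "close_path nb t k p = Some q"
    and nb: "\<And>v w. v \<in> A \<Longrightarrow> w \<in> set (nb v) \<Longrightarrow> w \<in> A \<and> {v, w} \<in> E"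
    and "distinct p" "set p \<subseteq> A" "path_edges p \<subseteq> E"
  shows "distinct q \<and> length q = length p + k \<and> set q \<subseteq> A \<and> path_edges q \<subseteq> E \<and>
    {hd q, t} \<in> E \<and> (\<exists>r. q = r @ p)"
  using assms(1,3-5)
proof (induction k arbitrary: p)
  case 0
  then obtain v p' where "p = v # p'" by (cases p) auto
  then show ?case using 0 nb[of v t] by (auto split: if_splits)
next
  case (Suc k)
  then obtain v p' where p: "p = v # p'" by (cases p) auto
  then obtain w where w: "w \<in> set (nb v)" "w \<notin> set p" "close_path nb t k (w # p) = Some q"
    using Suc.prems(1) by (auto dest!: first_some_SomeD split: if_splits)
  have wv: "w \<in> A" "{w, v} \<in> E" using nb[of v w] w(1) Suc.prems(3) p by (auto simp: insert_commute)
  have "distinct q \<and> length q = length (w # p) + k \<and> set q \<subseteq> A \<and> path_edges q \<subseteq> E \<and>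
    {hd q, t} \<in> E \<and> (\<exists>r. q = r @ w # p)"
    using w wv Suc.prems p by (intro Suc.IH) simp_all
  moreover have "r @ w # p = (r @ [w]) @ p" for r by simp
  ultimately show ?case by (metis length_Cons add_Suc_shift)
qed

definition consecutive :: "nat \<Rightarrow> nat \<Rightarrow> nat \<Rightarrow> bool" where
  "consecutive n i j \<longleftrightarrow> j = Suc i \<or> i = Suc j \<or> i = 0 \<and> Suc j = n \<or> j = 0 \<and> Suc i = n"

lemma consecutive_iff:
  assumes "i < n" "j < n" "i \<noteq> j"
  shows "{i, j} \<in> cyclic_edges [0..<n] \<longleftrightarrow> consecutive n i j"
proof -
  have "{i, j} \<in> cyclic_edges [0..<n] \<longleftrightarrow> (\<exists>k<n. {i, j} = {k, Suc k mod n})"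
    unfolding cyclic_edges_upt by blast
  also have "\<dots> \<longleftrightarrow> j = Suc i mod n \<or> i = Suc j mod n"
    unfolding doubleton_eq_iff using assms(1,2) by blast
  also have "\<dots> \<longleftrightarrow> consecutive n i j"
  proof -
    have "Suc i mod n = (if Suc i = n then 0 else Suc i)" "Suc j mod n = (if Suc j = n then 0 else Suc j)"
      using assms by auto
    then show ?thesis using assms unfolding consecutive_def by auto
  qed
  finally show ?thesis .
qed

definition neighbours :: "nat \<Rightarrow> (nat \<times> nat) list \<Rightarrow> nat \<Rightarrow> nat list" where
  "neighbours n S v = (if v = 0 then n - 1 else v - 1) # (if Suc v = n then 0 else Suc v) #
     List.map_filter (\<lambda>(a, b). if a = v then Some b else if b = v then Some a else None) S"

lemma neighbours_sound:
  assumes "w \<in> set (neighbours n S v)" "v < n" "n \<ge> 3" "\<forall>(a, b)\<in>set S. a < n \<and> b < n"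
  shows "w < n \<and> ({v, w} \<in> cyclic_edges [0..<n] \<or> (v, w) \<in> set S \<or> (w, v) \<in> set S)"
proof -
  consider "w = (if v = 0 then n - 1 else v - 1)" | "w = (if Suc v = n then 0 else Suc v)"
    | "(v, w) \<in> set S" | "(w, v) \<in> set S"
    using assms(1) unfolding neighbours_def
    by (auto simp: List.map_filter_def split: if_splits)
  then show ?thesis
  proof cases
    case 1
    then have "w < n" "v \<noteq> w" using assms(2,3) by (simp_all split: if_splits)
    moreover have "consecutive n v w"
      using 1 assms(2,3) by (cases "v = 0") (simp_all add: consecutive_def)
    ultimately show ?thesis using consecutive_iff[of v n w] assms(2) by simp
  next
    case 2
    then have "w < n" "v \<noteq> w" using assms(2,3) by (simp_all split: if_splits)
    moreover have "consecutive n v w"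
      using 2 assms(2,3) by (cases "Suc v = n") (simp_all add: consecutive_def)
    ultimately show ?thesis using consecutive_iff[of v n w] assms(2) by simp
  qed (use assms(4) in auto)
qed

text \<open>Certificates for the case distinction. \<open>Split\<close> asks whether a chord is present; \<open>Cycle\<close> ends a branch
in which the present chords admit a second hamiltonian cycle, and \<open>Stuck\<close> one in which all possible
chords at a vertex other than \<open>0\<close> are absent.\<close>

datatype refutation = Cycle | Stuck nat | Split nat nat refutation refutation

text \<open>The lists \<open>S\<close> and \<open>F\<close> hold the chords known to be present and absent. A second cycle is looked for
only through the chord \<open>(a, b)\<close> added last: a cycle avoiding it could have ended the branch earlier,
and a cycle through it differs from the given one automatically.\<close>

fun refutes :: "nat \<Rightarrow> (nat \<times> nat) list \<Rightarrow> (nat \<times> nat) list \<Rightarrow> refutation \<Rightarrow> bool" where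
  "refutes n S F Cycle = (case S of [] \<Rightarrow> False
     | (a, b) # _ \<Rightarrow> close_path (neighbours n S) a (n - 2) [b, a] \<noteq> None)"
| "refutes n S F (Stuck i) = (0 < i \<and> i < n \<and> list_all (\<lambda>j. j = i \<or> consecutive n i j \<or>
     (i, j) \<in> set F \<or> (j, i) \<in> set F) [0..<n])"
| "refutes n S F (Split a b r s) = (a < b \<and> b < n \<and> \<not> consecutive n a b \<and>
     refutes n ((a, b) # S) F r \<and> refutes n S ((a, b) # F) s)"

text \<open>The set \<open>G\<close> contains the edges of a graph on the indices \<open>0, \<dots>, n - 1\<close> of its hamiltonian cycle; vertex
\<open>0\<close> is the one that may have degree two.\<close>

lemma refutes_sound:
  assumes n: "n \<ge> 3" and G: "cyclic_edges [0..<n] \<subseteq> G"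
    and unique: "\<And>p. distinct p \<Longrightarrow> set p = {..<n} \<Longrightarrow> cyclic_edges p \<subseteq> G \<Longrightarrow> cyclic_edges p = cyclic_edges [0..<n]"
    and chord: "\<And>i. 0 < i \<Longrightarrow> i < n \<Longrightarrow> \<exists>j<n. j \<noteq> i \<and> {i, j} \<in> G - cyclic_edges [0..<n]"
    and S: "\<forall>(a, b)\<in>set S. a < b \<and> b < n \<and> \<not> consecutive n a b \<and> {a, b} \<in> G"
    and F: "\<forall>(a, b)\<in>set F. {a, b} \<notin> G"
  shows "\<not> refutes n S F r"
  using S F
proof (induction r arbitrary: S F)
  case Cycle
  show ?case
  proof
    assume "refutes n S F Cycle"
    then obtain a b S' q where ab: "S = (a, b) # S'" "close_path (neighbours n S) a (n - 2) [b, a] = Some q"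
      by (auto split: list.splits)
    have lt: "\<forall>(a, b)\<in>set S. a < n \<and> b < n" using Cycle.prems(1) by fastforce
    have ab': "a < b" "b < n" "\<not> consecutive n a b" "{a, b} \<in> G" using Cycle.prems(1) ab(1) by auto
    have nb: "w \<in> {..<n} \<and> {v, w} \<in> G" if "v \<in> {..<n}" "w \<in> set (neighbours n S v)" for v w
    proof -
      have "v < n" using that(1) by simp
      from neighbours_sound[OF that(2) this n lt]
      consider "w < n" "{v, w} \<in> cyclic_edges [0..<n]" | "w < n" "(v, w) \<in> set S" | "w < n" "(w, v) \<in> set S"
        by blast
      then show ?thesis
      proof cases
        case 3
        then have "{w, v} \<in> G" using Cycle.prems(1) by blast
        then show ?thesis using 3(1) by (simp add: insert_commute)
      qed (use G Cycle.prems(1) in blast)+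
    qed
    have "{b, a} \<in> G" using ab'(4) by (simp add: insert_commute)
    then obtain r where q: "distinct q" "length q = n" "set q \<subseteq> {..<n}" "path_edges q \<subseteq> G"
      "{hd q, a} \<in> G" "q = r @ [b, a]"
      using close_path_sound[OF ab(2) nb] ab'(1,2) n by auto
    have range: "set q = {..<n}"
      using q(1-3) by (intro card_subset_eq) (simp_all add: distinct_card)
    have cyc: "cyclic_edges q = insert {a, hd q} (path_edges q)"
    proof -
      have "cyclic_edges q = path_edges (a # r @ [b, a])"
        using cyclic_edges_rotate[of "r @ [b]" "[a]"] q(6) by (simp add: cyclic_edges_path)
      then show ?thesis using q(6) by (cases r) auto
    qed
    have "cyclic_edges q \<subseteq> G" using cyc q(4,5) by (simp add: insert_commute)
    then have "cyclic_edges q = cyclic_edges [0..<n]"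
      by (rule unique[OF q(1) range])
    moreover have "{b, a} \<in> path_edges q"
      using path_edges_append[of r b "[a]"] q(6) by simp
    ultimately have "{a, b} \<in> cyclic_edges [0..<n]" using cyc by (auto simp: insert_commute)
    then show False using ab' consecutive_iff[of a n b] by simp
  qed
next
  case (Stuck i)
  show ?case
  proof
    assume r: "refutes n S F (Stuck i)"
    then obtain j where j: "j < n" "j \<noteq> i" "{i, j} \<in> G" "{i, j} \<notin> cyclic_edges [0..<n]"
      using chord[of i] by auto
    then have "\<not> consecutive n i j" using consecutive_iff[of i n j] r by auto
    then have "(i, j) \<in> set F \<or> (j, i) \<in> set F"
      using r j(1,2) by (auto simp: list_all_iff)
    then show False using Stuck.prems(2) j(3) by (auto simp: insert_commute)
  qed
next
  case (Split a b r s)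
  show ?case
  proof (cases "{a, b} \<in> G")
    case True
    then show ?thesis using Split.IH(1)[of "(a, b) # S" F] Split.prems by auto
  next
    case False
    then show ?thesis using Split.IH(2)[of S "(a, b) # F"] Split.prems by auto
  qed
qed

text \<open>The case distinctions, one for each order. Their shape was found by a backtracking search that
branches at a vertex with few remaining chords.\<close>

lemma refutation_3: "refutes 3 [] []
  (Stuck 1)"
  by code_simp

lemma refutation_4: "refutes 4 [] []
  (Split 1 3 (Split 0 2 Cycle (Stuck 2)) (Stuck 3))"
  by code_simp

lemma refutation_5: "refutes 5 [] []
  (Split 0 3 (Split 1 4 Cycle (Split 2 4 Cycle (Stuck 4))) (Split 1 3 (Split 0 2 Cycle (Split 2 4
   Cycle (Stuck 2))) (Stuck 3)))"
  by code_simp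

lemma refutation_6: "refutes 6 [] []
  (Split 2 4 (Split 1 3 Cycle (Split 3 5 Cycle (Split 1 5 (Split 0 3 Cycle (Stuck 3)) (Split 2 5
   (Split 1 4 Cycle (Stuck 1)) (Stuck 5))))) (Split 1 4 (Split 0 3 Cycle (Split 2 5 Cycle (Split 1 3
   (Split 0 2 Cycle (Stuck 2)) (Split 3 5 (Split 0 2 Cycle (Stuck 2)) (Stuck 3))))) (Split 0 4 (Split
   1 5 Cycle (Split 3 5 Cycle (Split 2 5 (Split 1 3 Cycle (Stuck 1)) (Stuck 5)))) (Stuck 4))))"
  by code_simp

lemma refutation_7: "refutes 7 [] []
  (Split 2 5 (Split 1 4 Cycle (Split 3 6 Cycle (Split 0 3 (Split 1 6 Cycle (Split 4 6 Cycle (Split 2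
   6 Cycle (Stuck 6)))) (Split 1 3 (Split 0 4 Cycle (Split 4 6 Cycle (Split 2 4 Cycle (Stuck 4))))
   (Split 3 5 (Split 2 4 Cycle (Split 4 6 Cycle (Split 1 5 (Split 0 4 Cycle (Stuck 4)) (Split 1 6
   (Split 0 4 Cycle (Stuck 4)) (Stuck 1))))) (Stuck 3)))))) (Split 3 5 (Split 2 4 Cycle (Split 4 6
   Cycle (Split 0 4 (Split 1 6 Cycle (Split 2 6 Cycle (Split 3 6 Cycle (Stuck 6)))) (Split 1 4 (Split
   0 2 Cycle (Split 2 6 Cycle (Stuck 2))) (Stuck 4))))) (Split 1 5 (Split 2 6 Cycle (Split 0 2 (Split
   3 6 Cycle (Split 4 6 Cycle (Split 1 6 Cycle (Stuck 6)))) (Split 2 4 (Split 0 3 Cycle (Split 3 6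
   Cycle (Split 1 3 Cycle (Stuck 3)))) (Stuck 2)))) (Split 0 5 (Split 1 6 Cycle (Split 4 6 Cycle
   (Split 2 6 (Split 1 3 Cycle (Split 1 4 Cycle (Stuck 1))) (Split 3 6 (Split 1 4 Cycle (Split 2 4
   Cycle (Split 0 4 Cycle (Stuck 4)))) (Stuck 6))))) (Stuck 5)))))"
  by code_simp

lemma refutation_8: "refutes 8 [] []
  (Split 2 6 (Split 1 5 Cycle (Split 3 7 Cycle (Split 5 7 (Split 1 4 Cycle (Split 0 3 Cycle (Split 3
   6 Cycle (Split 4 6 Cycle (Split 1 3 (Split 0 4 Cycle (Split 4 7 Cycle (Split 2 4 Cycle (Stuck
   4)))) (Split 3 5 (Split 0 4 Cycle (Split 4 7 Cycle (Split 2 4 Cycle (Stuck 4)))) (Stuck 3)))))))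
   (Split 3 5 (Split 1 4 Cycle (Split 4 7 Cycle (Split 2 4 Cycle (Split 4 6 Cycle (Split 1 7 (Split 0
   4 Cycle (Stuck 4)) (Split 2 7 (Split 0 4 Cycle (Stuck 4)) (Stuck 7))))))) (Split 0 5 (Split 1 3
   Cycle (Split 1 7 Cycle (Split 1 6 Cycle (Split 4 7 Cycle (Split 1 4 (Split 2 7 Cycle (Stuck 7))
   (Stuck 1)))))) (Split 2 5 (Split 1 3 Cycle (Split 1 4 Cycle (Split 3 6 Cycle (Split 0 3 (Split 1 7
   Cycle (Split 1 6 Cycle (Stuck 1))) (Stuck 3))))) (Stuck 5))))))) (Split 3 6 (Split 2 5 Cycle
   (Split 4 7 Cycle (Split 2 4 (Split 1 5 Cycle (Split 5 7 Cycle (Split 1 3 Cycle (Split 3 5 Cycle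
   (Split 1 4 (Split 0 5 Cycle (Stuck 5)) (Split 1 6 (Split 0 5 Cycle (Stuck 5)) (Split 1 7 (Split 0
   5 Cycle (Stuck 5)) (Stuck 1)))))))) (Split 2 7 (Split 1 4 Cycle (Split 0 5 Cycle (Split 1 5 (Split
   4 6 Cycle (Split 0 4 Cycle (Stuck 4))) (Split 3 5 (Split 0 4 Cycle (Split 4 6 Cycle (Stuck 4)))
   (Split 5 7 (Split 0 4 Cycle (Split 4 6 Cycle (Stuck 4))) (Stuck 5)))))) (Split 0 2 (Split 1 5
   Cycle (Split 1 3 Cycle (Split 1 7 Cycle (Split 3 7 (Split 1 6 Cycle (Split 1 4 Cycle (Stuck 1)))
   (Split 5 7 (Split 1 4 Cycle (Split 1 6 Cycle (Stuck 1))) (Stuck 7)))))) (Stuck 2)))))) (Split 4 6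
   (Split 3 5 Cycle (Split 5 7 Cycle (Split 2 5 (Split 1 5 Cycle (Split 1 3 Cycle (Split 3 7 Cycle
   (Split 1 4 Cycle (Split 1 6 (Split 0 3 Cycle (Stuck 3)) (Split 1 7 (Split 0 3 Cycle (Stuck 3))
   (Stuck 1))))))) (Split 1 5 (Split 0 3 Cycle (Split 2 7 Cycle (Split 0 2 (Split 3 7 Cycle (Split 1
   3 Cycle (Stuck 3))) (Split 2 4 (Split 3 7 Cycle (Split 1 3 Cycle (Stuck 3))) (Stuck 2))))) (Split
   0 5 (Split 1 7 Cycle (Split 3 7 Cycle (Split 4 7 Cycle (Split 0 3 (Split 2 7 Cycle (Stuck 7))
   (Split 1 3 (Split 2 7 Cycle (Stuck 7)) (Stuck 3)))))) (Stuck 5)))))) (Split 1 6 (Split 0 5 Cycle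
   (Split 2 7 Cycle (Split 2 4 (Split 3 7 Cycle (Split 1 3 Cycle (Split 3 5 Cycle (Split 1 5 (Split 0
   3 Cycle (Stuck 3)) (Split 2 5 (Split 0 3 Cycle (Stuck 3)) (Split 5 7 (Split 0 3 Cycle (Stuck 3))
   (Stuck 5))))))) (Split 2 5 (Split 4 7 Cycle (Split 1 4 Cycle (Split 0 4 (Split 5 7 Cycle (Split 1
   7 Cycle (Split 3 7 Cycle (Stuck 7)))) (Stuck 4)))) (Split 0 2 (Split 1 5 Cycle (Split 3 7 Cycle
   (Split 5 7 Cycle (Split 1 7 Cycle (Split 4 7 (Split 3 5 Cycle (Stuck 5)) (Stuck 7)))))) (Stuck
   2)))))) (Split 0 6 (Split 1 7 Cycle (Split 5 7 Cycle (Split 3 7 (Split 1 4 Cycle (Split 4 7 Cycle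
   (Split 0 4 Cycle (Split 1 3 (Split 2 4 Cycle (Stuck 4)) (Split 1 5 (Split 2 4 Cycle (Stuck 4))
   (Stuck 1)))))) (Split 4 7 (Split 1 5 Cycle (Split 3 5 Cycle (Split 0 5 Cycle (Split 2 5 (Split 1 3
   Cycle (Split 1 4 Cycle (Stuck 1))) (Stuck 5))))) (Split 2 7 (Split 1 3 Cycle (Split 1 5 Cycle
   (Split 0 3 Cycle (Split 1 4 (Split 3 5 Cycle (Stuck 3)) (Stuck 1))))) (Stuck 7)))))) (Stuck 6))))))"
  by code_simp

lemma refutation_9: "refutes 9 [] []
  (Split 2 5 (Split 1 4 Cycle (Split 3 6 Cycle (Split 4 7 (Split 1 6 Cycle (Split 3 8 Cycle (Split 5
   8 Cycle (Split 1 3 (Split 0 6 Cycle (Split 6 8 Cycle (Split 2 6 Cycle (Split 4 6 Cycle (Stuck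
   6))))) (Split 1 5 (Split 6 8 Cycle (Split 0 6 Cycle (Split 4 6 Cycle (Split 2 6 Cycle (Stuck
   6))))) (Split 1 8 (Split 0 3 Cycle (Split 0 6 Cycle (Split 2 6 (Split 3 5 Cycle (Split 3 7 Cycle
   (Stuck 3))) (Split 4 6 (Split 3 7 Cycle (Split 3 5 Cycle (Stuck 3))) (Split 6 8 (Split 3 7 Cycle
   (Split 3 5 Cycle (Stuck 3))) (Stuck 6)))))) (Split 1 7 (Split 6 8 Cycle (Split 4 8 Cycle (Split 2
   8 Cycle (Stuck 8)))) (Stuck 1)))))))) (Split 4 8 (Split 1 7 Cycle (Split 0 3 Cycle (Split 3 7
   Cycle (Split 0 7 (Split 1 3 Cycle (Split 1 6 Cycle (Split 1 5 Cycle (Split 1 8 Cycle (Stuck 1)))))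
   (Split 2 7 (Split 1 3 Cycle (Split 3 5 Cycle (Split 3 8 Cycle (Stuck 3)))) (Split 5 7 (Split 1 6
   Cycle (Split 0 6 Cycle (Split 4 6 Cycle (Split 6 8 Cycle (Split 2 6 (Split 3 5 Cycle (Split 1 3
   Cycle (Split 3 8 Cycle (Stuck 3)))) (Stuck 6)))))) (Stuck 7))))))) (Split 4 6 (Split 1 5 Cycle
   (Split 1 3 Cycle (Split 3 7 Cycle (Split 3 5 Cycle (Split 5 7 Cycle (Split 0 3 (Split 1 7 Cycle
   (Split 1 8 Cycle (Split 1 6 Cycle (Stuck 1)))) (Split 3 8 (Split 1 7 Cycle (Split 0 7 Cycle (Split
   2 7 Cycle (Stuck 7)))) (Stuck 3)))))))) (Split 0 4 (Split 1 3 Cycle (Split 1 8 Cycle (Split 1 5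
   Cycle (Split 3 8 Cycle (Split 1 6 (Split 3 7 Cycle (Split 3 5 Cycle (Split 0 3 Cycle (Stuck 3))))
   (Split 1 7 (Split 6 8 Cycle (Split 5 8 Cycle (Split 2 8 Cycle (Stuck 8)))) (Stuck 1))))))) (Split
   2 4 (Split 1 3 Cycle (Split 3 5 Cycle (Split 3 7 (Split 1 6 Cycle (Split 6 8 Cycle (Split 2 6
   Cycle (Split 1 5 (Split 0 6 Cycle (Stuck 6)) (Split 1 7 (Split 0 6 Cycle (Stuck 6)) (Split 1 8
   (Split 0 6 Cycle (Stuck 6)) (Stuck 1))))))) (Split 3 8 (Split 1 7 Cycle (Split 0 6 Cycle (Split 2
   7 Cycle (Split 1 6 (Split 5 7 Cycle (Split 0 7 Cycle (Stuck 7))) (Split 2 6 (Split 5 7 Cycle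
   (Split 0 7 Cycle (Stuck 7))) (Split 6 8 (Split 5 7 Cycle (Split 0 7 Cycle (Stuck 7))) (Stuck
   6))))))) (Split 0 3 (Split 1 6 Cycle (Split 1 5 Cycle (Split 1 8 Cycle (Split 2 8 Cycle (Split 1 7
   (Split 5 8 Cycle (Split 6 8 Cycle (Stuck 8))) (Stuck 1)))))) (Stuck 3)))))) (Stuck 4))))))))
   (Split 2 6 (Split 1 5 Cycle (Split 3 7 Cycle (Split 5 7 (Split 1 6 Cycle (Split 1 4 Cycle (Split 3
   8 Cycle (Split 3 6 Cycle (Split 4 6 Cycle (Split 6 8 Cycle (Split 0 3 (Split 1 8 Cycle (Split 4 8
   Cycle (Split 5 8 Cycle (Split 2 8 Cycle (Stuck 8))))) (Split 1 3 (Split 0 4 Cycle (Split 4 8 Cycle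
   (Split 4 7 Cycle (Split 2 4 Cycle (Stuck 4))))) (Split 3 5 (Split 4 8 Cycle (Split 4 7 Cycle
   (Split 2 4 Cycle (Split 0 4 (Split 1 7 Cycle (Split 1 8 Cycle (Stuck 1))) (Stuck 4))))) (Stuck
   3)))))))))) (Split 5 8 (Split 1 7 Cycle (Split 0 3 Cycle (Split 4 7 Cycle (Split 1 3 (Split 0 7
   Cycle (Split 2 7 Cycle (Stuck 7))) (Split 3 6 (Split 0 7 Cycle (Split 2 7 Cycle (Stuck 7))) (Split
   3 8 (Split 0 7 Cycle (Split 2 7 Cycle (Stuck 7))) (Split 3 5 (Split 0 4 Cycle (Split 1 4 Cycle
   (Split 2 4 Cycle (Split 4 6 Cycle (Split 0 7 (Split 4 8 Cycle (Stuck 4)) (Split 2 7 (Split 4 8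
   Cycle (Stuck 4)) (Stuck 7))))))) (Stuck 3)))))))) (Split 0 5 (Split 1 3 Cycle (Split 1 8 Cycle
   (Split 3 8 Cycle (Split 1 6 Cycle (Split 4 8 Cycle (Split 1 4 (Split 3 6 Cycle (Split 3 5 Cycle
   (Split 0 3 Cycle (Stuck 3)))) (Split 1 7 (Split 6 8 Cycle (Split 2 8 Cycle (Stuck 8))) (Stuck
   1)))))))) (Split 3 5 (Split 1 4 Cycle (Split 4 7 Cycle (Split 2 4 Cycle (Split 4 6 Cycle (Split 0
   4 (Split 1 3 Cycle (Split 1 7 Cycle (Split 1 8 Cycle (Split 1 6 Cycle (Stuck 1))))) (Split 4 8
   (Split 1 7 Cycle (Split 0 7 Cycle (Split 2 7 Cycle (Stuck 7)))) (Stuck 4))))))) (Stuck 5)))))))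
   (Split 2 7 (Split 1 6 Cycle (Split 3 8 Cycle (Split 3 6 (Split 1 4 Cycle (Split 5 8 Cycle (Split 4
   7 Cycle (Split 0 4 (Split 1 3 Cycle (Split 1 8 Cycle (Split 1 7 Cycle (Split 1 5 Cycle (Stuck
   1))))) (Split 4 8 (Split 1 5 Cycle (Split 3 5 Cycle (Split 5 7 Cycle (Split 0 5 Cycle (Stuck
   5))))) (Split 2 4 (Split 1 5 Cycle (Split 5 7 Cycle (Split 3 5 Cycle (Split 1 8 (Split 0 5 Cycle
   (Stuck 5)) (Split 2 8 (Split 0 5 Cycle (Stuck 5)) (Split 6 8 (Split 0 5 Cycle (Stuck 5)) (Stuck
   8))))))) (Split 4 6 (Split 1 5 Cycle (Split 3 5 Cycle (Split 5 7 Cycle (Split 1 8 (Split 0 5 Cycle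
   (Stuck 5)) (Split 2 8 (Split 0 5 Cycle (Stuck 5)) (Split 6 8 (Split 0 5 Cycle (Stuck 5)) (Stuck
   8))))))) (Stuck 4)))))))) (Split 4 6 (Split 1 5 Cycle (Split 3 5 Cycle (Split 5 7 Cycle (Split 5 8
   (Split 1 3 Cycle (Split 0 3 Cycle (Split 3 7 Cycle (Stuck 3)))) (Split 0 5 (Split 1 3 Cycle (Split
   1 8 Cycle (Split 1 7 Cycle (Split 4 8 Cycle (Split 1 4 (Split 6 8 Cycle (Split 2 8 Cycle (Stuck
   8))) (Stuck 1)))))) (Stuck 5)))))) (Split 6 8 (Split 1 5 Cycle (Split 0 3 Cycle (Split 3 7 Cycle
   (Split 5 7 Cycle (Split 0 4 (Split 1 3 Cycle (Split 3 5 Cycle (Stuck 3))) (Split 1 4 (Split 3 5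
   Cycle (Split 0 5 Cycle (Split 5 8 Cycle (Stuck 5)))) (Split 2 4 (Split 1 3 Cycle (Split 3 5 Cycle
   (Stuck 3))) (Split 4 7 (Split 1 3 Cycle (Split 3 5 Cycle (Stuck 3))) (Split 4 8 (Split 1 3 Cycle
   (Split 3 5 Cycle (Stuck 3))) (Stuck 4)))))))))) (Split 0 6 (Split 1 3 Cycle (Split 1 8 Cycle
   (Split 1 7 Cycle (Split 5 8 Cycle (Split 1 4 (Split 3 5 Cycle (Split 3 7 Cycle (Split 0 3 Cycle
   (Stuck 3)))) (Split 1 5 (Split 4 8 Cycle (Split 2 8 Cycle (Stuck 8))) (Stuck 1))))))) (Stuck
   6))))))) (Split 2 4 (Split 1 3 Cycle (Split 3 5 Cycle (Split 3 7 (Split 1 6 Cycle (Split 3 6 Cycle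
   (Split 5 8 Cycle (Split 0 6 (Split 1 5 Cycle (Split 1 8 Cycle (Split 1 4 Cycle (Split 1 7 Cycle
   (Stuck 1))))) (Split 6 8 (Split 1 5 Cycle (Split 0 5 Cycle (Split 5 7 Cycle (Stuck 5)))) (Split 4
   6 (Split 1 5 Cycle (Split 5 7 Cycle (Split 1 4 (Split 0 5 Cycle (Stuck 5)) (Split 1 7 (Split 0 5
   Cycle (Stuck 5)) (Split 1 8 (Split 0 5 Cycle (Stuck 5)) (Stuck 1)))))) (Stuck 6))))))) (Split 3 8
   (Split 1 7 Cycle (Split 0 5 Cycle (Split 0 7 (Split 1 5 Cycle (Split 1 6 Cycle (Split 1 4 Cycle
   (Split 1 8 Cycle (Stuck 1))))) (Split 5 7 (Split 1 6 Cycle (Split 0 6 Cycle (Split 3 6 Cycle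
   (Split 4 6 Cycle (Split 6 8 Cycle (Stuck 6)))))) (Split 4 7 (Split 1 5 Cycle (Split 5 8 Cycle
   (Stuck 5))) (Stuck 7)))))) (Split 0 3 (Split 1 5 Cycle (Split 1 8 Cycle (Split 1 4 Cycle (Split 2
   8 Cycle (Split 1 6 (Split 5 7 Cycle (Split 5 8 Cycle (Split 0 5 Cycle (Stuck 5)))) (Split 1 7
   (Split 5 8 Cycle (Split 6 8 Cycle (Split 4 8 Cycle (Stuck 8)))) (Stuck 1))))))) (Split 3 6 (Split
   1 5 Cycle (Split 5 7 Cycle (Split 4 7 Cycle (Split 0 5 (Split 1 7 Cycle (Split 1 8 Cycle (Split 1
   4 Cycle (Split 1 6 Cycle (Stuck 1))))) (Split 5 8 (Split 1 7 Cycle (Split 0 7 Cycle (Stuck 7)))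
   (Stuck 5)))))) (Stuck 3))))))) (Split 2 8 (Split 1 7 Cycle (Split 0 3 Cycle (Split 4 7 (Split 1 5
   Cycle (Split 3 6 Cycle (Split 5 8 Cycle (Split 0 6 (Split 1 3 Cycle (Split 3 5 Cycle (Split 3 7
   Cycle (Split 3 8 Cycle (Stuck 3))))) (Split 1 6 (Split 3 5 Cycle (Split 5 7 Cycle (Split 0 5 Cycle
   (Stuck 5)))) (Split 6 8 (Split 3 5 Cycle (Split 0 5 Cycle (Split 5 7 Cycle (Stuck 5)))) (Split 4 6
   (Split 3 5 Cycle (Split 5 7 Cycle (Split 0 5 (Split 1 3 Cycle (Split 1 8 Cycle (Split 1 4 Cycle
   (Stuck 1)))) (Stuck 5)))) (Stuck 6)))))))) (Split 5 7 (Split 1 6 Cycle (Split 4 6 Cycle (Split 6 8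
   Cycle (Split 0 6 (Split 1 3 Cycle (Split 1 4 Cycle (Split 1 8 Cycle (Split 1 5 Cycle (Stuck 1)))))
   (Split 3 6 (Split 1 4 Cycle (Split 0 4 Cycle (Split 4 8 Cycle (Stuck 4)))) (Stuck 6)))))) (Split 3
   7 (Split 1 4 Cycle (Split 4 8 Cycle (Split 0 4 (Split 1 8 Cycle (Split 1 6 Cycle (Split 1 3 Cycle
   (Split 1 5 Cycle (Stuck 1))))) (Split 4 6 (Split 1 5 Cycle (Split 0 5 Cycle (Split 5 8 Cycle
   (Split 3 5 Cycle (Stuck 5))))) (Stuck 4))))) (Split 0 7 (Split 1 3 Cycle (Split 1 6 Cycle (Split 3
   8 Cycle (Split 1 8 Cycle (Split 3 5 (Split 1 4 Cycle (Split 4 8 Cycle (Split 0 4 Cycle (Split 4 6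
   Cycle (Stuck 4))))) (Split 3 6 (Split 1 5 Cycle (Split 1 4 Cycle (Stuck 1))) (Stuck 3)))))))
   (Stuck 7))))))) (Split 0 2 (Split 1 3 Cycle (Split 1 8 Cycle (Split 1 5 (Split 1 6 Cycle (Split 1
   4 Cycle (Split 3 6 Cycle (Split 4 8 Cycle (Split 0 4 Cycle (Split 4 6 (Split 3 7 Cycle (Split 3 8
   Cycle (Split 0 3 Cycle (Split 3 5 Cycle (Stuck 3))))) (Split 4 7 (Split 6 8 Cycle (Split 0 6 Cycle
   (Stuck 6))) (Stuck 4)))))))) (Split 1 6 (Split 3 7 Cycle (Split 5 8 Cycle (Split 0 5 Cycle (Split
   0 4 (Split 3 5 Cycle (Split 5 7 Cycle (Stuck 5))) (Split 1 4 (Split 5 7 Cycle (Split 3 5 Cycle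
   (Stuck 5))) (Split 4 6 (Split 3 5 Cycle (Split 5 7 Cycle (Stuck 5))) (Split 4 7 (Split 3 5 Cycle
   (Split 3 8 Cycle (Split 0 3 Cycle (Split 3 6 Cycle (Stuck 3))))) (Split 4 8 (Split 3 5 Cycle
   (Split 5 7 Cycle (Stuck 5))) (Stuck 4))))))))) (Split 1 4 (Split 3 5 Cycle (Split 3 8 Cycle (Split
   0 3 Cycle (Split 3 6 (Split 5 7 Cycle (Split 5 8 Cycle (Split 0 5 Cycle (Stuck 5)))) (Split 3 7
   (Split 5 8 Cycle (Split 6 8 Cycle (Split 4 8 Cycle (Stuck 8)))) (Stuck 3)))))) (Split 1 7 (Split 3
   8 Cycle (Split 6 8 Cycle (Split 0 6 Cycle (Split 3 6 (Split 5 8 Cycle (Split 4 8 Cycle (Stuck 8)))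
   (Split 4 6 (Split 5 8 Cycle (Split 0 5 Cycle (Split 3 5 Cycle (Split 5 7 Cycle (Stuck 5)))))
   (Stuck 6)))))) (Stuck 1))))))) (Stuck 2)))))))"
  by code_simp

lemma refutation_10: "refutes 10 [] []
  (Split 2 8 (Split 1 7 Cycle (Split 3 9 Cycle (Split 1 5 (Split 4 9 Cycle (Split 4 7 Cycle (Split 6
   9 Cycle (Split 0 4 Cycle (Split 2 6 Cycle (Split 3 7 (Split 2 4 Cycle (Split 4 6 Cycle (Split 1 4
   Cycle (Split 4 8 Cycle (Stuck 4))))) (Split 7 9 (Split 4 6 Cycle (Split 0 6 Cycle (Split 1 6 Cycle
   (Split 6 8 Cycle (Split 3 6 (Split 1 4 Cycle (Split 2 4 Cycle (Split 4 8 Cycle (Stuck 4)))) (Stuck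
   6)))))) (Split 2 7 (Split 3 6 Cycle (Split 4 8 Cycle (Split 4 6 Cycle (Split 6 8 Cycle (Split 1 3
   Cycle (Split 1 6 Cycle (Split 3 8 Cycle (Split 1 4 (Split 0 6 Cycle (Stuck 6)) (Split 2 4 (Split 0
   3 Cycle (Split 3 5 Cycle (Stuck 3))) (Stuck 4)))))))))) (Split 0 7 (Split 1 4 Cycle (Split 3 6
   Cycle (Split 1 3 Cycle (Split 4 8 Cycle (Split 0 3 (Split 2 4 Cycle (Split 4 6 Cycle (Stuck 4)))
   (Split 3 5 (Split 2 4 Cycle (Split 4 6 Cycle (Stuck 4))) (Split 3 8 (Split 2 4 Cycle (Split 4 6
   Cycle (Stuck 4))) (Stuck 3)))))))) (Split 5 7 (Split 1 6 Cycle (Split 4 6 Cycle (Split 6 8 Cycle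
   (Split 0 6 (Split 1 9 Cycle (Split 2 9 Cycle (Split 5 9 Cycle (Stuck 9)))) (Split 3 6 (Split 1 4
   Cycle (Split 2 4 Cycle (Split 4 8 Cycle (Stuck 4)))) (Stuck 6)))))) (Stuck 7))))))))))) (Split 5 9
   (Split 1 6 Cycle (Split 1 4 Cycle (Split 3 6 Cycle (Split 4 8 Cycle (Split 0 6 Cycle (Split 1 3
   (Split 0 4 Cycle (Split 4 6 Cycle (Split 4 9 Cycle (Split 2 4 Cycle (Split 4 7 (Split 6 9 Cycle
   (Split 2 6 Cycle (Split 6 8 Cycle (Stuck 6)))) (Stuck 4)))))) (Split 1 8 (Split 4 7 Cycle (Split 0
   4 Cycle (Split 2 6 Cycle (Split 0 3 (Split 2 4 Cycle (Split 4 6 Cycle (Split 4 9 Cycle (Stuck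
   4)))) (Split 3 5 (Split 4 9 Cycle (Split 2 4 Cycle (Split 4 6 Cycle (Stuck 4)))) (Split 3 7 (Split
   4 6 Cycle (Split 6 8 Cycle (Split 6 9 Cycle (Stuck 6)))) (Split 3 8 (Split 2 4 Cycle (Split 4 6
   Cycle (Split 4 9 Cycle (Stuck 4)))) (Stuck 3)))))))) (Split 1 9 (Split 0 4 Cycle (Split 0 3 Cycle
   (Split 3 7 (Split 4 6 Cycle (Split 6 8 Cycle (Split 6 9 Cycle (Split 2 6 Cycle (Stuck 6)))))
   (Split 3 8 (Split 4 7 Cycle (Split 2 4 Cycle (Split 4 6 Cycle (Split 4 9 Cycle (Stuck 4)))))
   (Split 3 5 (Split 4 9 Cycle (Split 2 4 Cycle (Split 4 6 Cycle (Split 4 7 (Split 6 9 Cycle (Split 2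
   6 Cycle (Split 6 8 Cycle (Stuck 6)))) (Stuck 4))))) (Stuck 3)))))) (Stuck 1))))))))) (Split 3 5
   (Split 4 9 Cycle (Split 2 4 Cycle (Split 4 6 Cycle (Split 4 7 (Split 1 6 Cycle (Split 6 9 Cycle
   (Split 2 6 Cycle (Split 6 8 Cycle (Split 3 6 Cycle (Split 1 9 (Split 0 6 Cycle (Stuck 6)) (Split 2
   9 (Split 0 6 Cycle (Stuck 6)) (Split 7 9 (Split 0 6 Cycle (Stuck 6)) (Stuck 9))))))))) (Split 1 4
   (Split 0 7 Cycle (Split 6 9 Cycle (Split 2 7 Cycle (Split 3 7 Cycle (Split 2 6 Cycle (Split 5 7
   (Split 0 6 Cycle (Split 3 6 Cycle (Split 1 6 Cycle (Split 6 8 Cycle (Stuck 6))))) (Split 7 9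
   (Split 0 6 Cycle (Split 3 6 Cycle (Split 1 6 Cycle (Split 6 8 Cycle (Stuck 6))))) (Stuck 7))))))))
   (Split 0 4 (Split 1 9 Cycle (Split 7 9 Cycle (Split 2 9 Cycle (Split 0 7 (Split 6 9 Cycle (Stuck
   9)) (Split 2 7 (Split 6 9 Cycle (Stuck 9)) (Split 3 7 (Split 6 9 Cycle (Stuck 9)) (Split 5 7
   (Split 6 9 Cycle (Stuck 9)) (Stuck 7)))))))) (Split 4 8 (Split 7 9 Cycle (Split 2 7 Cycle (Split 6
   9 Cycle (Split 3 7 Cycle (Split 0 7 (Split 2 9 Cycle (Split 1 9 Cycle (Stuck 9))) (Split 5 7
   (Split 2 6 Cycle (Split 1 6 Cycle (Split 3 6 Cycle (Split 6 8 Cycle (Split 1 3 (Split 0 6 Cycle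
   (Stuck 6)) (Split 1 8 (Split 0 6 Cycle (Stuck 6)) (Split 1 9 (Split 0 6 Cycle (Stuck 6)) (Stuck
   1)))))))) (Stuck 7))))))) (Stuck 4)))))))) (Split 5 7 (Split 1 6 Cycle (Split 4 6 Cycle (Split 6 8
   Cycle (Split 3 6 (Split 1 4 Cycle (Split 4 9 Cycle (Split 2 4 Cycle (Split 4 8 Cycle (Split 4 7
   Cycle (Split 1 3 (Split 0 4 Cycle (Stuck 4)) (Split 1 8 (Split 0 4 Cycle (Stuck 4)) (Split 1 9
   (Split 0 4 Cycle (Stuck 4)) (Stuck 1))))))))) (Split 6 9 (Split 1 4 Cycle (Split 0 3 Cycle (Split
   3 8 Cycle (Split 3 7 Cycle (Split 4 8 Cycle (Split 0 4 (Split 1 3 Cycle (Stuck 3)) (Split 2 4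
   (Split 1 3 Cycle (Stuck 3)) (Split 4 7 (Split 1 3 Cycle (Stuck 3)) (Split 4 9 (Split 1 3 Cycle
   (Stuck 3)) (Stuck 4)))))))))) (Split 0 6 (Split 1 3 Cycle (Split 1 9 Cycle (Split 1 8 Cycle (Split
   4 9 Cycle (Split 1 4 (Split 7 9 Cycle (Split 2 9 Cycle (Stuck 9))) (Stuck 1)))))) (Split 2 6
   (Split 1 3 Cycle (Split 1 4 Cycle (Split 3 8 Cycle (Split 3 7 Cycle (Split 1 8 (Split 0 3 Cycle
   (Stuck 3)) (Split 1 9 (Split 0 3 Cycle (Stuck 3)) (Stuck 1))))))) (Stuck 6)))))))) (Split 0 5
   (Split 1 6 Cycle (Split 4 9 Cycle (Split 1 9 (Split 3 6 Cycle (Split 4 7 Cycle (Split 6 9 Cycle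
   (Split 0 6 Cycle (Split 2 6 Cycle (Split 0 7 Cycle (Split 2 7 (Split 4 6 Cycle (Split 6 8 Cycle
   (Stuck 6))) (Split 3 7 (Split 6 8 Cycle (Split 4 6 Cycle (Stuck 6))) (Split 7 9 (Split 4 6 Cycle
   (Split 6 8 Cycle (Stuck 6))) (Stuck 7)))))))))) (Split 7 9 (Split 1 4 Cycle (Split 3 6 Cycle
   (Split 1 8 Cycle (Split 6 8 Cycle (Split 1 3 (Split 4 6 Cycle (Split 0 6 Cycle (Split 6 9 Cycle
   (Split 2 6 Cycle (Stuck 6))))) (Stuck 1)))))) (Split 6 9 (Split 1 3 Cycle (Split 1 8 Cycle (Split
   3 7 Cycle (Split 4 7 Cycle (Split 0 7 Cycle (Split 1 4 (Split 2 7 Cycle (Stuck 7)) (Stuck 1)))))))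
   (Split 2 9 (Split 1 4 Cycle (Split 1 3 Cycle (Split 1 8 Cycle (Stuck 1)))) (Stuck 9))))))) (Split
   2 5 (Split 1 4 Cycle (Split 3 6 Cycle (Split 1 3 (Split 4 7 Cycle (Split 6 9 Cycle (Split 0 7
   Cycle (Split 2 9 Cycle (Split 2 7 Cycle (Split 2 6 Cycle (Split 4 9 Cycle (Split 4 6 Cycle (Split
   0 6 (Split 1 9 Cycle (Split 7 9 Cycle (Stuck 9))) (Split 1 6 (Split 3 7 Cycle (Split 7 9 Cycle
   (Stuck 7))) (Split 6 8 (Split 3 7 Cycle (Split 7 9 Cycle (Stuck 7))) (Stuck 6)))))))))))) (Split 3
   7 (Split 1 6 Cycle (Split 6 9 Cycle (Split 4 6 Cycle (Split 6 8 Cycle (Split 2 6 Cycle (Split 1 9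
   (Split 0 6 Cycle (Stuck 6)) (Split 2 9 (Split 0 6 Cycle (Stuck 6)) (Split 4 9 (Split 0 6 Cycle
   (Stuck 6)) (Split 7 9 (Split 1 8 Cycle (Stuck 1)) (Stuck 9)))))))))) (Split 3 8 (Split 7 9 Cycle
   (Split 4 7 Cycle (Split 2 7 Cycle (Split 1 6 (Split 0 7 Cycle (Stuck 7)) (Split 1 8 (Split 0 7
   Cycle (Stuck 7)) (Split 1 9 (Split 0 7 Cycle (Stuck 7)) (Stuck 1))))))) (Split 0 3 (Split 1 9
   Cycle (Split 1 6 Cycle (Split 7 9 Cycle (Split 4 9 Cycle (Split 2 9 Cycle (Split 1 8 (Split 6 9
   Cycle (Stuck 9)) (Stuck 1))))))) (Stuck 3))))))) (Split 5 8 (Split 4 7 Cycle (Split 6 9 Cycle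
   (Split 7 9 (Split 3 6 Cycle (Split 1 6 Cycle (Split 0 3 Cycle (Split 3 8 Cycle (Split 4 6 Cycle
   (Split 0 6 Cycle (Split 6 8 Cycle (Split 2 6 (Split 1 3 Cycle (Split 3 7 Cycle (Stuck 3))) (Stuck
   6))))))))) (Split 3 7 (Split 4 9 Cycle (Split 1 4 Cycle (Split 2 4 Cycle (Split 4 6 Cycle (Split 4
   8 Cycle (Split 1 3 (Split 0 4 Cycle (Stuck 4)) (Split 1 6 (Split 0 4 Cycle (Stuck 4)) (Split 1 8
   (Split 0 4 Cycle (Stuck 4)) (Split 1 9 (Split 0 4 Cycle (Stuck 4)) (Stuck 1)))))))))) (Split 2 7
   (Split 1 4 Cycle (Split 1 3 Cycle (Split 3 6 Cycle (Split 1 6 Cycle (Split 3 8 Cycle (Split 1 8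
   (Split 0 3 Cycle (Stuck 3)) (Split 1 9 (Split 0 3 Cycle (Stuck 3)) (Stuck 1)))))))) (Split 0 7
   (Split 1 3 Cycle (Split 1 6 Cycle (Split 1 9 Cycle (Split 4 9 Cycle (Split 1 8 Cycle (Split 1 4
   (Split 2 9 Cycle (Stuck 9)) (Stuck 1))))))) (Stuck 7))))))) (Stuck 5)))))))))) (Split 3 8 (Split 2
   7 Cycle (Split 4 9 Cycle (Split 2 6 (Split 5 9 Cycle (Split 5 7 Cycle (Split 7 9 Cycle (Split 1 5
   Cycle (Split 3 7 Cycle (Split 0 7 (Split 1 9 Cycle (Split 2 9 Cycle (Split 3 9 Cycle (Split 6 9
   Cycle (Stuck 9))))) (Split 1 7 (Split 2 9 Cycle (Split 2 5 Cycle (Split 4 7 Cycle (Split 0 4 Cycle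
   (Split 2 4 Cycle (Split 5 8 Cycle (Split 0 5 (Split 6 9 Cycle (Split 1 9 Cycle (Split 3 9 Cycle
   (Stuck 9)))) (Split 3 5 (Split 4 8 Cycle (Split 1 4 Cycle (Split 4 6 Cycle (Stuck 4)))) (Stuck
   5))))))))) (Split 4 7 (Split 3 9 Cycle (Split 3 5 Cycle (Split 2 5 Cycle (Split 6 9 Cycle (Split 5
   8 Cycle (Split 1 9 (Split 0 5 Cycle (Stuck 5)) (Split 2 9 (Split 0 5 Cycle (Stuck 5)) (Stuck
   9)))))))) (Stuck 7))))))))) (Split 2 5 (Split 4 7 Cycle (Split 6 9 Cycle (Split 1 4 Cycle (Split 3
   6 Cycle (Split 4 6 (Split 1 7 Cycle (Split 7 9 Cycle (Split 3 9 Cycle (Split 3 7 Cycle (Split 5 9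
   Cycle (Split 5 7 Cycle (Split 1 9 (Split 0 7 Cycle (Stuck 7)) (Split 2 9 (Split 0 7 Cycle (Stuck
   7)) (Stuck 9))))))))) (Split 0 4 (Split 1 7 Cycle (Split 1 3 Cycle (Split 1 9 Cycle (Split 7 9
   Cycle (Split 1 5 Cycle (Split 3 9 Cycle (Split 1 6 (Split 5 9 Cycle (Split 2 9 Cycle (Stuck 9)))
   (Split 1 8 (Split 5 9 Cycle (Split 2 9 Cycle (Stuck 9))) (Stuck 1))))))))) (Split 2 4 (Split 1 7
   Cycle (Split 3 7 Cycle (Split 1 3 Cycle (Split 0 7 (Split 1 5 Cycle (Split 1 6 Cycle (Split 1 9
   Cycle (Split 1 8 Cycle (Stuck 1))))) (Split 7 9 (Split 1 6 Cycle (Split 0 6 Cycle (Split 6 8 Cycle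
   (Stuck 6)))) (Split 5 7 (Split 1 6 Cycle (Split 6 8 Cycle (Split 1 5 (Split 0 6 Cycle (Stuck 6))
   (Split 1 8 (Split 0 6 Cycle (Stuck 6)) (Split 1 9 (Split 0 6 Cycle (Stuck 6)) (Stuck 1))))))
   (Stuck 7))))))) (Split 4 8 (Split 1 7 Cycle (Split 3 9 Cycle (Split 7 9 Cycle (Split 3 7 Cycle
   (Split 5 9 Cycle (Split 1 9 (Split 0 6 Cycle (Split 0 7 Cycle (Split 5 7 (Split 1 6 Cycle (Split 6
   8 Cycle (Stuck 6))) (Stuck 7)))) (Split 2 9 (Split 1 6 Cycle (Split 1 3 Cycle (Split 1 5 Cycle
   (Split 1 8 Cycle (Stuck 1))))) (Stuck 9)))))))) (Stuck 4))))))))) (Split 2 4 (Split 1 7 Cycle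
   (Split 3 9 Cycle (Split 3 7 Cycle (Split 5 9 Cycle (Split 3 5 Cycle (Split 7 9 (Split 1 6 Cycle
   (Split 3 6 Cycle (Split 0 5 Cycle (Split 5 8 Cycle (Split 6 8 Cycle (Split 0 6 (Split 1 5 Cycle
   (Split 5 7 Cycle (Stuck 5))) (Split 4 6 (Split 1 5 Cycle (Split 5 7 Cycle (Stuck 5))) (Split 6 9
   (Split 1 5 Cycle (Split 5 7 Cycle (Stuck 5))) (Stuck 6))))))))) (Split 5 7 (Split 1 6 Cycle (Split
   6 9 Cycle (Split 3 6 Cycle (Split 4 6 Cycle (Split 6 8 Cycle (Split 0 6 (Split 1 9 Cycle (Split 2
   9 Cycle (Stuck 9))) (Stuck 6))))))) (Split 0 7 (Split 1 9 Cycle (Split 2 9 Cycle (Split 6 9 Cycle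
   (Stuck 9)))) (Split 4 7 (Split 1 5 Cycle (Split 6 9 Cycle (Split 5 8 Cycle (Split 1 9 (Split 0 5
   Cycle (Stuck 5)) (Split 2 9 (Split 0 5 Cycle (Stuck 5)) (Stuck 9)))))) (Stuck 7)))))))))) (Split 2
   9 (Split 1 4 Cycle (Split 0 7 Cycle (Split 1 8 Cycle (Split 4 6 (Split 1 5 Cycle (Split 5 9 Cycle
   (Split 3 5 Cycle (Split 5 7 Cycle (Split 0 5 (Split 3 7 Cycle (Split 4 7 Cycle (Split 7 9 Cycle
   (Split 1 7 Cycle (Stuck 7))))) (Split 5 8 (Split 1 7 Cycle (Split 3 7 Cycle (Split 7 9 Cycle
   (Split 4 7 Cycle (Stuck 7))))) (Stuck 5))))))) (Split 4 7 (Split 1 6 Cycle (Split 0 5 Cycle (Split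
   6 9 Cycle (Split 3 6 Cycle (Split 5 8 Cycle (Split 0 6 (Split 3 5 Cycle (Split 5 7 Cycle (Split 1
   5 Cycle (Split 5 9 Cycle (Stuck 5))))) (Split 6 8 (Split 1 5 Cycle (Split 3 5 Cycle (Split 5 9
   Cycle (Split 5 7 Cycle (Stuck 5))))) (Stuck 6)))))))) (Split 0 4 (Split 3 7 Cycle (Split 1 9 Cycle
   (Split 1 7 Cycle (Split 1 3 Cycle (Split 7 9 Cycle (Split 1 5 Cycle (Split 1 6 (Split 5 7 Cycle
   (Stuck 7)) (Stuck 1)))))))) (Split 4 8 (Split 1 7 Cycle (Split 7 9 Cycle (Split 3 7 Cycle (Split 5
   7 (Split 1 6 Cycle (Split 0 6 Cycle (Split 3 6 Cycle (Split 6 9 Cycle (Split 6 8 Cycle (Stuck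
   6)))))) (Stuck 7))))) (Stuck 4)))))))) (Split 0 2 (Split 1 7 Cycle (Split 1 3 Cycle (Split 1 9
   Cycle (Split 1 5 (Split 4 7 Cycle (Split 6 9 Cycle (Split 1 4 Cycle (Split 0 4 Cycle (Split 4 6
   (Split 7 9 Cycle (Split 3 9 Cycle (Split 5 9 Cycle (Stuck 9)))) (Split 4 8 (Split 3 9 Cycle (Split
   7 9 Cycle (Split 5 9 Cycle (Stuck 9)))) (Stuck 4))))))) (Split 1 6 (Split 5 7 Cycle (Split 7 9
   Cycle (Split 3 7 Cycle (Split 5 9 Cycle (Split 0 5 Cycle (Split 0 7 (Split 3 9 Cycle (Split 6 9
   Cycle (Stuck 9))) (Split 4 7 (Split 3 5 Cycle (Split 5 8 Cycle (Stuck 5))) (Stuck 7)))))))) (Split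
   1 4 (Split 5 9 Cycle (Split 7 9 Cycle (Split 3 5 Cycle (Split 3 9 Cycle (Split 0 5 (Split 6 9
   Cycle (Stuck 9)) (Split 5 7 (Split 6 9 Cycle (Stuck 9)) (Split 5 8 (Split 6 9 Cycle (Stuck 9))
   (Stuck 5)))))))) (Split 1 8 (Split 3 9 Cycle (Split 7 9 Cycle (Split 0 7 Cycle (Split 5 9 (Split 4
   7 Cycle (Split 0 4 Cycle (Split 4 6 Cycle (Split 4 8 Cycle (Stuck 4))))) (Split 6 9 (Split 3 7
   Cycle (Split 5 7 Cycle (Split 4 7 Cycle (Stuck 7)))) (Stuck 9)))))) (Stuck 1)))))))) (Stuck
   2)))))))) (Split 4 8 (Split 3 7 Cycle (Split 5 9 Cycle (Split 1 5 (Split 0 7 Cycle (Split 2 9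
   Cycle (Split 2 7 Cycle (Split 2 6 Cycle (Split 2 4 (Split 3 9 Cycle (Split 0 3 Cycle (Split 3 6
   Cycle (Split 1 3 Cycle (Split 3 5 Cycle (Stuck 3)))))) (Split 0 2 (Split 3 9 Cycle (Split 7 9
   Cycle (Split 4 9 Cycle (Split 1 9 Cycle (Split 1 7 (Split 6 9 Cycle (Stuck 9)) (Split 4 7 (Split 6
   9 Cycle (Stuck 9)) (Split 5 7 (Split 6 9 Cycle (Stuck 9)) (Stuck 7)))))))) (Split 2 5 (Split 6 9
   Cycle (Split 1 7 Cycle (Split 4 6 Cycle (Split 3 9 Cycle (Split 3 6 Cycle (Split 4 7 (Split 0 3
   Cycle (Split 1 3 Cycle (Split 3 5 Cycle (Stuck 3)))) (Split 5 7 (Split 0 6 Cycle (Split 1 6 Cycle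
   (Split 6 8 Cycle (Stuck 6)))) (Split 7 9 (Split 0 6 Cycle (Split 1 6 Cycle (Split 6 8 Cycle (Stuck
   6)))) (Stuck 7))))))))) (Stuck 2)))))))) (Split 2 5 (Split 1 7 Cycle (Split 3 9 Cycle (Split 1 4
   Cycle (Split 3 6 Cycle (Split 1 3 (Split 0 7 Cycle (Split 4 7 Cycle (Split 6 9 Cycle (Split 2 6
   Cycle (Split 2 7 Cycle (Split 4 6 Cycle (Split 5 7 (Split 0 6 Cycle (Split 1 6 Cycle (Split 6 8
   Cycle (Stuck 6)))) (Split 7 9 (Split 0 6 Cycle (Split 1 6 Cycle (Split 6 8 Cycle (Stuck 6))))
   (Stuck 7))))))))) (Split 3 5 (Split 2 7 Cycle (Split 4 7 Cycle (Split 6 9 Cycle (Split 4 6 Cycle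
   (Split 0 7 (Split 1 6 Cycle (Split 1 9 Cycle (Split 1 8 Cycle (Stuck 1)))) (Split 7 9 (Split 1 6
   Cycle (Split 2 6 Cycle (Split 0 6 Cycle (Split 6 8 Cycle (Stuck 6))))) (Split 5 7 (Split 1 6 Cycle
   (Split 2 6 Cycle (Split 6 8 Cycle (Split 1 8 (Split 0 6 Cycle (Stuck 6)) (Split 1 9 (Split 0 6
   Cycle (Stuck 6)) (Stuck 1)))))) (Stuck 7)))))))) (Split 0 3 (Split 1 9 Cycle (Split 7 9 Cycle
   (Split 1 6 Cycle (Split 4 9 Cycle (Split 2 9 Cycle (Split 1 8 (Split 6 9 Cycle (Stuck 9)) (Stuck
   1))))))) (Stuck 3)))))))) (Split 0 5 (Split 1 9 Cycle (Split 1 7 Cycle (Split 7 9 Cycle (Split 1 6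
   Cycle (Split 4 9 Cycle (Split 2 9 (Split 1 3 Cycle (Split 1 4 Cycle (Split 1 8 Cycle (Stuck 1))))
   (Split 3 9 (Split 1 4 Cycle (Split 2 6 Cycle (Split 2 4 Cycle (Split 0 2 (Split 1 8 Cycle (Split 1
   3 Cycle (Stuck 1))) (Split 2 7 (Split 1 8 Cycle (Split 1 3 Cycle (Stuck 1))) (Stuck 2)))))) (Split
   6 9 (Split 1 8 Cycle (Split 5 7 Cycle (Split 4 7 Cycle (Split 0 7 Cycle (Split 2 7 (Split 1 4
   Cycle (Split 1 3 Cycle (Stuck 1))) (Stuck 7)))))) (Stuck 9))))))))) (Split 3 5 (Split 2 7 Cycle
   (Split 4 9 Cycle (Split 4 7 Cycle (Split 6 9 Cycle (Split 2 4 Cycle (Split 4 6 Cycle (Split 2 6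
   (Split 1 7 Cycle (Split 3 9 Cycle (Split 5 7 Cycle (Split 7 9 Cycle (Split 1 9 (Split 0 7 Cycle
   (Stuck 7)) (Split 2 9 (Split 0 7 Cycle (Stuck 7)) (Stuck 9))))))) (Split 2 9 (Split 1 6 Cycle
   (Split 0 7 Cycle (Split 1 7 (Split 3 6 Cycle (Split 6 8 Cycle (Split 0 6 Cycle (Stuck 6)))) (Split
   5 7 (Split 0 6 Cycle (Split 3 6 Cycle (Split 6 8 Cycle (Stuck 6)))) (Split 7 9 (Split 0 6 Cycle
   (Split 3 6 Cycle (Split 6 8 Cycle (Stuck 6)))) (Stuck 7)))))) (Split 0 2 (Split 1 7 Cycle (Split 1
   4 Cycle (Split 1 3 Cycle (Split 1 9 Cycle (Split 3 9 (Split 1 6 Cycle (Split 1 8 Cycle (Stuck 1)))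
   (Split 7 9 (Split 1 6 Cycle (Split 1 8 Cycle (Stuck 1))) (Stuck 9))))))) (Stuck 2)))))))))) (Split
   5 7 (Split 3 6 Cycle (Split 6 9 Cycle (Split 4 6 Cycle (Split 6 8 Cycle (Split 2 6 (Split 1 7
   Cycle (Split 1 3 Cycle (Split 3 9 Cycle (Split 1 6 Cycle (Split 1 4 Cycle (Split 1 8 (Split 0 3
   Cycle (Stuck 3)) (Split 1 9 (Split 0 3 Cycle (Stuck 3)) (Stuck 1)))))))) (Split 1 6 (Split 0 3
   Cycle (Split 2 9 Cycle (Split 2 7 Cycle (Split 1 3 (Split 0 2 Cycle (Split 2 4 Cycle (Stuck 2)))
   (Split 3 9 (Split 0 2 Cycle (Split 2 4 Cycle (Stuck 2))) (Stuck 3)))))) (Split 0 6 (Split 1 9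
   Cycle (Split 3 9 Cycle (Split 7 9 Cycle (Split 1 8 Cycle (Split 4 9 Cycle (Split 1 7 Cycle (Split
   1 3 (Split 2 9 Cycle (Stuck 9)) (Split 1 4 (Split 2 9 Cycle (Stuck 9)) (Stuck 1))))))))) (Stuck
   6)))))))) (Split 5 8 (Split 7 9 Cycle (Split 4 7 Cycle (Split 6 9 Cycle (Split 2 7 (Split 3 9
   Cycle (Split 1 4 Cycle (Split 1 3 Cycle (Split 3 6 Cycle (Split 1 6 Cycle (Split 0 3 (Split 1 9
   Cycle (Split 1 8 Cycle (Split 1 7 Cycle (Stuck 1)))) (Stuck 3))))))) (Split 1 7 (Split 2 9 Cycle
   (Split 0 3 Cycle (Split 2 6 Cycle (Split 1 3 (Split 0 2 Cycle (Split 2 4 Cycle (Stuck 2))) (Split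
   3 6 (Split 0 2 Cycle (Split 2 4 Cycle (Stuck 2))) (Split 3 9 (Split 2 4 Cycle (Split 0 2 Cycle
   (Stuck 2))) (Stuck 3))))))) (Split 0 7 (Split 1 9 Cycle (Split 1 6 Cycle (Split 3 9 Cycle (Split 4
   9 Cycle (Split 1 8 Cycle (Split 1 3 (Split 2 9 Cycle (Stuck 9)) (Split 1 4 (Split 2 9 Cycle (Stuck
   9)) (Stuck 1)))))))) (Stuck 7))))))) (Stuck 5))))))))) (Split 5 8 (Split 4 7 Cycle (Split 6 9
   Cycle (Split 1 4 (Split 2 7 Cycle (Split 0 3 Cycle (Split 2 5 Cycle (Split 2 6 (Split 5 9 Cycle
   (Split 7 9 Cycle (Split 1 7 Cycle (Split 5 7 Cycle (Split 3 9 Cycle (Split 3 7 Cycle (Split 1 9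
   (Split 0 7 Cycle (Stuck 7)) (Split 2 9 (Split 0 7 Cycle (Stuck 7)) (Split 4 9 (Split 0 7 Cycle
   (Stuck 7)) (Stuck 9)))))))))) (Split 2 9 (Split 3 6 Cycle (Split 0 7 Cycle (Split 1 6 Cycle (Split
   0 6 (Split 1 3 Cycle (Split 3 5 Cycle (Split 3 9 Cycle (Split 3 7 Cycle (Stuck 3))))) (Split 4 6
   (Split 1 7 Cycle (Split 3 7 Cycle (Split 7 9 Cycle (Split 5 7 Cycle (Stuck 7))))) (Split 6 8
   (Split 3 7 Cycle (Split 1 7 Cycle (Split 5 7 Cycle (Split 7 9 Cycle (Stuck 7))))) (Stuck 6)))))))
   (Split 0 2 (Split 3 7 Cycle (Split 3 5 Cycle (Split 3 9 Cycle (Split 1 3 Cycle (Split 1 9 Cycle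
   (Split 3 6 (Split 7 9 Cycle (Split 5 9 Cycle (Split 4 9 Cycle (Stuck 9)))) (Stuck 3))))))) (Split
   2 4 (Split 3 7 Cycle (Split 1 3 Cycle (Split 3 5 Cycle (Split 3 6 (Split 0 7 Cycle (Split 1 7
   Cycle (Split 7 9 Cycle (Split 5 7 Cycle (Stuck 7))))) (Split 3 9 (Split 0 6 Cycle (Split 1 6 Cycle
   (Split 0 7 Cycle (Split 4 6 (Split 1 7 Cycle (Split 7 9 Cycle (Split 5 7 Cycle (Stuck 7)))) (Split
   6 8 (Split 1 7 Cycle (Split 5 7 Cycle (Split 7 9 Cycle (Stuck 7)))) (Stuck 6)))))) (Stuck 3))))))
   (Stuck 2)))))))) (Split 2 4 (Split 3 7 Cycle (Split 1 3 Cycle (Split 3 5 Cycle (Split 3 6 (Split 1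
   7 Cycle (Split 7 9 Cycle (Split 1 5 Cycle (Split 2 7 Cycle (Split 5 7 Cycle (Split 1 6 (Split 0 7
   Cycle (Stuck 7)) (Split 1 8 (Split 0 7 Cycle (Stuck 7)) (Split 1 9 (Split 0 7 Cycle (Stuck 7))
   (Stuck 1))))))))) (Split 3 9 (Split 1 6 Cycle (Split 0 7 Cycle (Split 2 6 Cycle (Split 1 7 (Split
   4 6 Cycle (Split 6 8 Cycle (Split 0 6 Cycle (Stuck 6)))) (Split 2 7 (Split 4 6 Cycle (Split 0 6
   Cycle (Split 6 8 Cycle (Stuck 6)))) (Split 5 7 (Split 0 6 Cycle (Split 4 6 Cycle (Split 6 8 Cycle
   (Stuck 6)))) (Split 7 9 (Split 4 6 Cycle (Split 0 6 Cycle (Split 6 8 Cycle (Stuck 6)))) (Stuck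
   7)))))))) (Split 0 3 (Split 1 7 Cycle (Split 1 5 Cycle (Split 1 9 Cycle (Split 2 9 Cycle (Split 1
   6 (Split 7 9 Cycle (Split 4 9 Cycle (Split 5 9 Cycle (Stuck 9)))) (Split 1 8 (Split 5 9 Cycle
   (Split 7 9 Cycle (Split 4 9 Cycle (Stuck 9)))) (Stuck 1))))))) (Stuck 3))))))) (Split 4 6 (Split 3
   7 Cycle (Split 5 9 Cycle (Split 7 9 Cycle (Split 3 5 Cycle (Split 5 7 Cycle (Split 2 7 (Split 1 3
   Cycle (Split 3 9 Cycle (Split 3 6 Cycle (Split 1 9 (Split 0 3 Cycle (Stuck 3)) (Split 2 9 (Split 0
   3 Cycle (Stuck 3)) (Split 4 9 (Split 0 3 Cycle (Stuck 3)) (Stuck 9))))))) (Split 1 7 (Split 2 9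
   Cycle (Split 2 5 Cycle (Split 2 6 Cycle (Split 1 9 (Split 0 2 Cycle (Stuck 2)) (Split 3 9 (Split 0
   2 Cycle (Stuck 2)) (Split 4 9 (Split 0 2 Cycle (Stuck 2)) (Stuck 9))))))) (Split 0 7 (Split 1 9
   Cycle (Split 1 5 Cycle (Split 3 9 Cycle (Split 1 6 Cycle (Split 4 9 Cycle (Split 1 8 Cycle (Split
   2 9 (Split 1 3 Cycle (Stuck 1)) (Stuck 9)))))))) (Stuck 7))))))))) (Split 0 4 (Split 1 7 Cycle
   (Split 1 5 Cycle (Split 3 9 Cycle (Split 1 6 (Split 7 9 Cycle (Split 0 7 Cycle (Split 3 7 Cycle
   (Split 5 7 Cycle (Split 2 7 Cycle (Stuck 7)))))) (Split 1 9 (Split 3 6 Cycle (Split 2 7 Cycle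
   (Split 0 3 Cycle (Split 2 5 Cycle (Split 0 2 Cycle (Split 1 3 (Split 2 6 Cycle (Split 2 9 Cycle
   (Stuck 2))) (Split 3 5 (Split 2 6 Cycle (Split 2 9 Cycle (Stuck 2))) (Split 3 7 (Split 2 9 Cycle
   (Split 2 6 Cycle (Stuck 2))) (Stuck 3))))))))) (Split 1 3 (Split 2 7 Cycle (Split 2 5 Cycle (Split
   2 9 Cycle (Split 0 2 Cycle (Split 4 9 (Split 2 6 Cycle (Stuck 2)) (Split 5 9 (Split 2 6 Cycle
   (Stuck 2)) (Split 7 9 (Split 2 6 Cycle (Stuck 2)) (Stuck 9)))))))) (Split 1 8 (Split 7 9 Cycle
   (Split 3 7 Cycle (Split 5 9 Cycle (Split 2 9 Cycle (Split 0 3 (Split 4 9 Cycle (Stuck 9)) (Split 3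
   5 (Split 4 9 Cycle (Stuck 9)) (Split 3 6 (Split 4 9 Cycle (Stuck 9)) (Stuck 3)))))))) (Stuck
   1)))))))) (Split 4 9 (Split 3 6 Cycle (Split 0 7 Cycle (Split 2 6 (Split 1 3 Cycle (Split 3 5
   Cycle (Split 1 7 Cycle (Split 3 9 Cycle (Split 3 7 Cycle (Split 0 3 (Split 2 7 Cycle (Split 7 9
   Cycle (Split 5 7 Cycle (Stuck 7)))) (Stuck 3))))))) (Split 1 6 (Split 0 3 Cycle (Split 2 5 Cycle
   (Split 2 9 Cycle (Split 2 7 Cycle (Split 0 2 (Split 3 9 Cycle (Split 3 5 Cycle (Split 3 7 Cycle
   (Split 1 3 Cycle (Stuck 3))))) (Stuck 2)))))) (Split 0 6 (Split 3 9 Cycle (Split 3 7 Cycle (Split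
   3 5 Cycle (Split 5 7 Cycle (Split 7 9 Cycle (Split 1 7 Cycle (Split 2 7 (Split 0 3 Cycle (Split 1
   3 Cycle (Stuck 3))) (Stuck 7)))))))) (Split 6 8 (Split 3 7 Cycle (Split 5 7 Cycle (Split 7 9 Cycle
   (Split 1 7 (Split 2 5 Cycle (Split 0 2 Cycle (Split 2 9 Cycle (Split 2 7 Cycle (Stuck 2)))))
   (Split 2 7 (Split 1 3 Cycle (Split 3 5 Cycle (Split 0 3 Cycle (Split 3 9 Cycle (Stuck 3)))))
   (Stuck 7)))))) (Stuck 6))))))) (Stuck 4)))))))) (Split 6 8 (Split 5 7 Cycle (Split 7 9 Cycle
   (Split 2 7 (Split 1 7 Cycle (Split 1 5 Cycle (Split 3 9 Cycle (Split 3 7 Cycle (Split 1 6 Cycle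
   (Split 1 3 (Split 0 5 Cycle (Split 2 5 Cycle (Split 4 9 Cycle (Split 4 7 Cycle (Split 2 4 Cycle
   (Split 0 4 (Split 3 5 Cycle (Split 5 9 Cycle (Stuck 5))) (Split 1 4 (Split 3 5 Cycle (Split 5 9
   Cycle (Stuck 5))) (Split 4 6 (Split 5 9 Cycle (Split 3 5 Cycle (Stuck 5))) (Stuck 4)))))))))
   (Split 3 5 (Split 1 4 Cycle (Split 4 9 Cycle (Split 4 7 Cycle (Split 2 4 Cycle (Split 4 6 Cycle
   (Split 1 8 (Split 0 4 Cycle (Stuck 4)) (Split 1 9 (Split 0 4 Cycle (Stuck 4)) (Stuck 1))))))))
   (Split 0 3 (Split 1 9 Cycle (Split 1 8 Cycle (Split 1 4 Cycle (Stuck 1)))) (Split 3 6 (Split 5 9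
   Cycle (Split 1 4 Cycle (Split 2 5 Cycle (Split 0 5 (Split 1 8 Cycle (Split 1 9 Cycle (Stuck 1)))
   (Stuck 5))))) (Stuck 3)))))))))) (Split 1 7 (Split 0 5 Cycle (Split 2 9 Cycle (Split 2 4 (Split 3
   9 Cycle (Split 3 7 Cycle (Split 1 3 Cycle (Split 3 5 Cycle (Split 0 3 (Split 5 9 Cycle (Split 2 5
   Cycle (Split 1 5 Cycle (Stuck 5)))) (Split 3 6 (Split 5 9 Cycle (Split 1 5 Cycle (Split 2 5 Cycle
   (Stuck 5)))) (Stuck 3))))))) (Split 2 5 (Split 0 3 Cycle (Split 4 9 Cycle (Split 4 7 Cycle (Split
   3 7 Cycle (Split 1 4 Cycle (Split 3 6 Cycle (Split 0 4 (Split 3 5 Cycle (Split 1 3 Cycle (Split 3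
   9 Cycle (Stuck 3)))) (Split 4 6 (Split 3 9 Cycle (Split 1 3 Cycle (Split 3 5 Cycle (Stuck 3))))
   (Stuck 4))))))))) (Split 0 2 (Split 1 5 Cycle (Split 3 9 Cycle (Split 5 9 Cycle (Split 6 9 Cycle
   (Split 1 9 Cycle (Split 3 5 (Split 4 9 Cycle (Stuck 9)) (Stuck 5))))))) (Split 2 6 (Split 5 9
   Cycle (Split 1 5 Cycle (Split 3 5 (Split 4 9 Cycle (Split 0 4 Cycle (Split 1 4 Cycle (Split 4 7
   Cycle (Split 4 6 Cycle (Stuck 4)))))) (Stuck 5)))) (Stuck 2))))))) (Split 3 7 (Split 2 5 Cycle
   (Split 4 9 Cycle (Split 4 7 Cycle (Split 2 6 Cycle (Split 2 4 (Split 1 5 Cycle (Split 3 9 Cycle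
   (Split 5 9 Cycle (Split 3 5 Cycle (Split 0 5 (Split 1 9 Cycle (Split 2 9 Cycle (Split 6 9 Cycle
   (Stuck 9)))) (Stuck 5)))))) (Split 2 9 (Split 1 4 Cycle (Split 0 5 Cycle (Split 0 4 (Split 5 9
   Cycle (Split 3 5 Cycle (Split 1 5 Cycle (Stuck 5)))) (Split 4 6 (Split 1 5 Cycle (Split 5 9 Cycle
   (Split 3 5 Cycle (Stuck 5)))) (Stuck 4))))) (Split 0 2 (Split 1 5 Cycle (Split 1 6 Cycle (Split 1
   3 Cycle (Split 1 9 Cycle (Split 1 4 (Split 5 9 Cycle (Split 0 5 Cycle (Split 3 5 Cycle (Stuck
   5)))) (Split 1 8 (Split 5 9 Cycle (Split 6 9 Cycle (Split 3 9 Cycle (Stuck 9)))) (Stuck 1)))))))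
   (Stuck 2)))))))) (Split 0 7 (Split 1 9 Cycle (Split 5 9 Cycle (Split 1 8 Cycle (Split 6 9 Cycle
   (Split 3 9 (Split 1 4 Cycle (Split 2 9 Cycle (Split 2 5 Cycle (Split 2 6 Cycle (Split 0 2 (Split 1
   5 Cycle (Split 1 6 Cycle (Split 1 3 Cycle (Stuck 1)))) (Split 2 4 (Split 1 5 Cycle (Split 0 5
   Cycle (Split 3 5 Cycle (Stuck 5)))) (Stuck 2))))))) (Split 4 9 (Split 1 5 Cycle (Split 3 5 Cycle
   (Split 3 6 Cycle (Split 0 5 Cycle (Split 2 5 (Split 1 3 Cycle (Split 0 3 Cycle (Stuck 3))) (Stuck
   5)))))) (Split 2 9 (Split 1 3 Cycle (Split 1 5 Cycle (Split 1 6 Cycle (Split 0 5 (Split 1 4 Cycle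
   (Stuck 1)) (Split 2 5 (Split 1 4 Cycle (Stuck 1)) (Split 3 5 (Split 1 4 Cycle (Stuck 1)) (Stuck
   5))))))) (Stuck 9)))))))) (Split 4 7 (Split 3 5 Cycle (Split 5 9 Cycle (Split 3 6 Cycle (Split 2 5
   (Split 1 5 Cycle (Split 1 3 Cycle (Split 3 9 Cycle (Split 1 6 Cycle (Split 1 4 Cycle (Split 1 8
   (Split 0 3 Cycle (Stuck 3)) (Split 1 9 (Split 0 3 Cycle (Stuck 3)) (Stuck 1)))))))) (Split 1 5
   (Split 0 3 Cycle (Split 2 9 Cycle (Split 2 6 Cycle (Split 0 2 (Split 3 9 Cycle (Split 1 3 Cycle
   (Stuck 3))) (Split 2 4 (Split 3 9 Cycle (Split 1 3 Cycle (Stuck 3))) (Stuck 2)))))) (Split 0 5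
   (Split 1 9 Cycle (Split 3 9 Cycle (Split 6 9 Cycle (Split 4 9 Cycle (Split 2 9 (Split 1 3 Cycle
   (Split 0 3 Cycle (Stuck 3))) (Stuck 9)))))) (Stuck 5))))))) (Stuck 7)))))))) (Split 1 8 (Split 0 7
   Cycle (Split 2 9 Cycle (Split 2 5 (Split 4 9 Cycle (Split 1 4 Cycle (Split 3 6 Cycle (Split 4 6
   (Split 3 9 Cycle (Split 1 3 Cycle (Split 3 7 Cycle (Split 3 5 Cycle (Split 5 7 Cycle (Split 1 7
   (Split 0 3 Cycle (Stuck 3)) (Split 2 7 (Split 0 3 Cycle (Stuck 3)) (Split 4 7 (Split 0 3 Cycle
   (Stuck 3)) (Split 7 9 (Split 0 3 Cycle (Stuck 3)) (Stuck 7)))))))))) (Split 4 7 (Split 0 3 Cycle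
   (Split 6 9 Cycle (Split 1 6 Cycle (Split 0 6 (Split 1 9 Cycle (Split 7 9 Cycle (Split 3 9 Cycle
   (Split 5 9 Cycle (Stuck 9))))) (Split 2 6 (Split 3 9 Cycle (Split 1 3 Cycle (Split 3 5 Cycle
   (Split 3 7 Cycle (Stuck 3))))) (Stuck 6)))))) (Split 0 4 (Split 1 7 Cycle (Split 7 9 Cycle (Split
   3 7 Cycle (Split 5 9 Cycle (Split 1 9 Cycle (Split 3 9 Cycle (Split 6 9 (Split 5 7 Cycle (Split 2
   7 Cycle (Stuck 7))) (Stuck 9)))))))) (Split 2 4 (Split 3 9 Cycle (Split 1 3 Cycle (Split 3 5 Cycle
   (Split 0 3 (Split 6 9 Cycle (Split 5 9 Cycle (Split 7 9 Cycle (Split 1 9 Cycle (Stuck 9)))))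
   (Split 3 7 (Split 0 6 Cycle (Split 6 9 Cycle (Split 1 6 Cycle (Split 2 6 Cycle (Stuck 6)))))
   (Stuck 3)))))) (Stuck 4)))))))) (Split 2 6 (Split 5 9 Cycle (Split 1 5 Cycle (Split 3 7 Cycle
   (Split 0 5 (Split 7 9 Cycle (Split 6 9 Cycle (Split 1 9 Cycle (Split 3 9 Cycle (Split 4 9 Cycle
   (Stuck 9)))))) (Split 5 7 (Split 0 3 Cycle (Split 4 9 Cycle (Split 6 9 Cycle (Split 1 4 Cycle
   (Split 3 6 Cycle (Split 4 6 Cycle (Split 0 4 (Split 7 9 Cycle (Split 1 9 Cycle (Split 3 9 Cycle
   (Stuck 9)))) (Split 2 4 (Split 3 9 Cycle (Split 1 3 Cycle (Split 3 5 Cycle (Stuck 3)))) (Split 4 7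
   (Split 3 9 Cycle (Split 1 3 Cycle (Split 3 5 Cycle (Stuck 3)))) (Stuck 4)))))))))) (Split 3 5
   (Split 4 9 Cycle (Split 1 4 Cycle (Split 4 7 Cycle (Split 2 4 Cycle (Split 4 6 Cycle (Split 0 4
   (Split 7 9 Cycle (Split 2 7 Cycle (Split 1 7 Cycle (Stuck 7)))) (Stuck 4))))))) (Stuck 5)))))))
   (Split 2 4 (Split 3 9 Cycle (Split 1 3 Cycle (Split 3 5 Cycle (Split 3 6 (Split 5 9 Cycle (Split 1
   5 Cycle (Split 5 7 Cycle (Split 1 9 (Split 0 5 Cycle (Stuck 5)) (Split 4 9 (Split 0 5 Cycle (Stuck
   5)) (Split 6 9 (Split 0 5 Cycle (Stuck 5)) (Split 7 9 (Split 0 5 Cycle (Stuck 5)) (Stuck 9))))))))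
   (Split 3 7 (Split 0 5 Cycle (Split 6 9 Cycle (Split 1 6 Cycle (Split 1 5 (Split 0 6 Cycle (Split 4
   6 Cycle (Stuck 6))) (Split 5 7 (Split 0 6 Cycle (Split 4 6 Cycle (Stuck 6))) (Split 5 9 (Split 4 6
   Cycle (Split 0 6 Cycle (Stuck 6))) (Stuck 5))))))) (Split 0 3 (Split 5 9 Cycle (Split 1 7 Cycle
   (Split 7 9 Cycle (Split 2 7 Cycle (Split 4 9 Cycle (Split 1 9 Cycle (Split 4 7 (Split 6 9 Cycle
   (Stuck 9)) (Split 5 7 (Split 6 9 Cycle (Stuck 9)) (Stuck 7))))))))) (Stuck 3))))))) (Split 2 7
   (Split 0 3 Cycle (Split 6 9 Cycle (Split 1 6 Cycle (Split 4 6 (Split 5 9 Cycle (Split 1 5 Cycle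
   (Split 3 5 Cycle (Split 5 7 Cycle (Split 1 9 (Split 0 5 Cycle (Stuck 5)) (Split 3 9 (Split 0 5
   Cycle (Stuck 5)) (Split 4 9 (Split 0 5 Cycle (Stuck 5)) (Split 7 9 (Split 0 5 Cycle (Stuck 5))
   (Stuck 9))))))))) (Split 3 6 (Split 4 9 Cycle (Split 1 4 Cycle (Split 4 7 Cycle (Split 1 9 (Split
   0 4 Cycle (Stuck 4)) (Split 3 9 (Split 0 4 Cycle (Stuck 4)) (Split 5 9 (Split 0 4 Cycle (Stuck 4))
   (Split 7 9 (Split 0 4 Cycle (Stuck 4)) (Stuck 9)))))))) (Split 0 6 (Split 3 7 Cycle (Split 1 3
   Cycle (Split 3 9 Cycle (Split 0 4 (Split 3 5 Cycle (Stuck 3)) (Split 1 4 (Split 3 5 Cycle (Stuck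
   3)) (Split 4 7 (Split 3 5 Cycle (Stuck 3)) (Split 4 9 (Split 3 5 Cycle (Stuck 3)) (Stuck 4))))))))
   (Stuck 6))))))) (Split 0 2 (Split 1 7 Cycle (Split 3 9 Cycle (Split 7 9 Cycle (Split 1 3 Cycle
   (Split 1 9 Cycle (Split 5 9 (Split 3 6 Cycle (Split 4 7 Cycle (Split 6 9 Cycle (Split 1 6 Cycle
   (Split 0 6 Cycle (Split 3 7 (Split 4 6 Cycle (Stuck 6)) (Split 5 7 (Split 4 6 Cycle (Stuck 6))
   (Stuck 7)))))))) (Split 4 9 (Split 3 5 Cycle (Split 3 7 Cycle (Split 0 3 Cycle (Split 1 5 Cycle
   (Split 0 5 Cycle (Split 3 6 (Split 5 7 Cycle (Stuck 5)) (Stuck 3))))))) (Split 6 9 (Split 1 5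
   Cycle (Split 3 7 Cycle (Split 5 7 Cycle (Split 0 5 Cycle (Split 4 7 (Split 3 5 Cycle (Stuck 5))
   (Stuck 7)))))) (Stuck 9))))))))) (Stuck 2)))))))) (Split 0 8 (Split 1 9 Cycle (Split 7 9 Cycle
   (Split 3 9 (Split 1 4 Cycle (Split 2 7 Cycle (Split 4 9 Cycle (Split 0 4 Cycle (Split 4 7 (Split 1
   6 Cycle (Split 2 5 Cycle (Split 6 9 Cycle (Split 0 6 Cycle (Split 5 9 Cycle (Split 3 6 Cycle
   (Split 2 6 (Split 1 7 Cycle (Split 1 3 Cycle (Split 1 5 Cycle (Stuck 1)))) (Split 4 6 (Split 1 5
   Cycle (Split 0 5 Cycle (Split 3 5 Cycle (Split 5 7 Cycle (Stuck 5))))) (Stuck 6))))))))) (Split 4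
   6 (Split 1 5 Cycle (Split 5 9 Cycle (Split 0 5 Cycle (Split 3 5 Cycle (Split 5 7 Cycle (Split 0 7
   (Split 2 5 Cycle (Stuck 5)) (Split 1 7 (Split 2 5 Cycle (Stuck 5)) (Split 3 7 (Split 2 5 Cycle
   (Stuck 5)) (Stuck 7))))))))) (Split 2 4 (Split 1 5 Cycle (Split 1 7 Cycle (Split 3 7 Cycle (Split
   1 3 Cycle (Split 0 7 (Split 1 6 Cycle (Stuck 1)) (Split 5 7 (Split 1 6 Cycle (Stuck 1)) (Stuck
   7))))))) (Stuck 4)))))))) (Split 4 9 (Split 1 5 Cycle (Split 3 7 Cycle (Split 5 9 Cycle (Split 0 5
   Cycle (Split 3 5 (Split 1 4 Cycle (Split 1 6 Cycle (Split 2 9 Cycle (Split 2 7 Cycle (Split 2 4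
   Cycle (Split 0 2 (Split 1 7 Cycle (Split 1 3 Cycle (Stuck 1))) (Split 2 5 (Split 1 3 Cycle (Split
   1 7 Cycle (Stuck 1))) (Split 2 6 (Split 1 3 Cycle (Split 1 7 Cycle (Stuck 1))) (Stuck 2)))))))))
   (Split 2 5 (Split 1 3 Cycle (Split 0 3 Cycle (Split 3 6 Cycle (Stuck 3)))) (Split 5 7 (Split 1 6
   Cycle (Split 3 6 Cycle (Split 0 6 Cycle (Split 6 9 Cycle (Split 4 6 Cycle (Split 0 3 (Split 2 6
   Cycle (Stuck 6)) (Split 1 3 (Split 2 6 Cycle (Stuck 6)) (Stuck 3)))))))) (Stuck 5)))))))) (Split 5
   9 (Split 1 6 Cycle (Split 4 7 Cycle (Split 6 9 Cycle (Split 0 6 Cycle (Split 2 6 (Split 1 3 Cycle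
   (Split 1 7 Cycle (Split 1 5 Cycle (Split 3 7 Cycle (Split 0 7 (Split 1 4 Cycle (Stuck 1)) (Split 2
   7 (Split 1 4 Cycle (Stuck 1)) (Split 5 7 (Split 1 4 Cycle (Stuck 1)) (Stuck 7)))))))) (Split 3 6
   (Split 1 4 Cycle (Split 2 7 Cycle (Split 0 4 Cycle (Split 2 4 (Split 1 7 Cycle (Split 1 5 Cycle
   (Split 1 3 Cycle (Stuck 1)))) (Split 4 6 (Split 1 7 Cycle (Split 3 7 Cycle (Split 0 7 Cycle (Split
   5 7 Cycle (Stuck 7))))) (Stuck 4)))))) (Split 4 6 (Split 1 5 Cycle (Split 1 7 Cycle (Split 3 7
   Cycle (Split 0 7 Cycle (Split 5 7 Cycle (Split 1 3 (Split 2 7 Cycle (Stuck 7)) (Split 1 4 (Split 2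
   7 Cycle (Stuck 7)) (Stuck 1)))))))) (Stuck 6)))))))) (Split 6 9 (Split 1 7 Cycle (Split 5 7 Cycle
   (Split 0 7 Cycle (Split 3 7 (Split 1 4 Cycle (Split 2 9 Cycle (Split 2 7 Cycle (Split 2 5 Cycle
   (Split 4 7 Cycle (Split 0 4 Cycle (Split 2 6 Cycle (Split 0 5 (Split 2 4 Cycle (Split 4 6 Cycle
   (Stuck 4))) (Split 1 5 (Split 0 2 Cycle (Split 2 4 Cycle (Stuck 2))) (Split 3 5 (Split 2 4 Cycle
   (Split 4 6 Cycle (Stuck 4))) (Stuck 5))))))))))) (Split 2 7 (Split 1 3 Cycle (Split 1 5 Cycle
   (Split 0 3 Cycle (Split 1 6 Cycle (Split 1 4 (Split 3 5 Cycle (Split 3 6 Cycle (Stuck 3))) (Stuck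
   1)))))) (Split 4 7 (Split 1 5 Cycle (Split 3 5 Cycle (Split 0 5 Cycle (Split 3 6 Cycle (Split 0 3
   (Split 2 5 Cycle (Stuck 5)) (Split 1 3 (Split 2 5 Cycle (Stuck 5)) (Stuck 3))))))) (Stuck 7)))))))
   (Split 2 9 (Split 1 3 Cycle (Split 1 7 Cycle (Split 0 3 Cycle (Split 1 5 (Split 3 6 Cycle (Split 1
   6 Cycle (Split 0 6 Cycle (Split 2 6 Cycle (Split 3 5 (Split 4 6 Cycle (Stuck 6)) (Split 3 7 (Split
   4 6 Cycle (Stuck 6)) (Stuck 3))))))) (Split 1 6 (Split 3 7 Cycle (Split 5 7 Cycle (Split 0 7 Cycle
   (Split 0 5 Cycle (Split 2 7 Cycle (Split 2 5 (Split 4 7 Cycle (Stuck 7)) (Split 3 5 (Split 4 7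
   Cycle (Stuck 7)) (Stuck 5)))))))) (Split 1 4 (Split 3 5 Cycle (Split 3 7 Cycle (Split 0 7 (Split 3
   6 Cycle (Stuck 3)) (Split 2 7 (Split 3 6 Cycle (Stuck 3)) (Split 4 7 (Split 3 6 Cycle (Stuck 3))
   (Split 5 7 (Split 3 6 Cycle (Stuck 3)) (Stuck 7))))))) (Stuck 1))))))) (Stuck 9)))))))) (Stuck
   8))))))))"
  by code_simp

lemma refutation_exists:
  assumes "3 \<le> n" "n \<le> 10"
  shows "\<exists>r. refutes n [] [] r"
proof -
  have "n = 3 \<or> n = 4 \<or> n = 5 \<or> n = 6 \<or> n = 7 \<or> n = 8 \<or> n = 9 \<or> n = 10"
    using assms by linarith
  then show ?thesis
    by (elim disjE) (hypsubst, rule exI, rule refutation_3 refutation_4 refutation_5 refutation_6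
        refutation_7 refutation_8 refutation_9 refutation_10)+
qed

section \<open>Uniquely hamiltonian graphs of small order\<close>

lemma cyclic_edges_at:
  assumes "0 < i" "i < n" "n \<ge> 3"
  shows "card {e \<in> cyclic_edges [0..<n]. i \<in> e} = 2"
proof -
  have "{e \<in> cyclic_edges [0..<n]. i \<in> e} = {{i, i - 1}, {i, Suc i mod n}}"
  proof (intro equalityI subsetI)
    fix e assume e: "e \<in> {e \<in> cyclic_edges [0..<n]. i \<in> e}"
    then obtain k where k: "k < n" "e = {k, Suc k mod n}" "i \<in> e"
      unfolding cyclic_edges_upt by blast
    then consider "i = k" | "i = Suc k mod n" by blast
    then show "e \<in> {{i, i - 1}, {i, Suc i mod n}}"
    proof cases
      case 2
      then have "Suc k \<noteq> n" using assms(1) by auto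
      then have "k = i - 1" using 2 k(1) by simp
      then show ?thesis using 2 k(2) by (simp add: insert_commute)
    qed (use k in simp)
  next
    fix e assume "e \<in> {{i, i - 1}, {i, Suc i mod n}}"
    moreover have "{i, i - 1} \<in> cyclic_edges [0..<n]"
      using consecutive_iff[of i n "i - 1"] assms by (simp add: consecutive_def)
    moreover have "{i, Suc i mod n} \<in> cyclic_edges [0..<n]"
      unfolding cyclic_edges_upt using assms(2) by blast
    ultimately show "e \<in> {e \<in> cyclic_edges [0..<n]. i \<in> e}" by blast
  qed
  moreover have "i - 1 \<noteq> Suc i mod n"
  proof (cases "Suc i = n")
    case False
    then have "Suc i mod n = Suc i" using assms by simp
    then show ?thesis by simp
  qed (use assms in simp)
  then have "{i, i - 1} \<noteq> {i, Suc i mod n}" by (auto simp: doubleton_eq_iff)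
  ultimately show ?thesis by simp
qed

text \<open>No surface is involved in the lower bound. Number the vertices along the hamiltonian cycle,
starting with the possible vertex of degree two; every other vertex has a further neighbour, and
these chords satisfy the hypotheses that the certificates refute.\<close>

lemma uniquely_hamiltonian_order:
  assumes simple: "simple_graph V E" and ham: "uniquely_hamiltonian V E"
    and deg: "card {v \<in> V. vertex_degree E v = 2} \<le> 1"
  shows "card V \<ge> 11"
proof (rule ccontr)
  assume small: "\<not> card V \<ge> 11"
  obtain C where C: "hamiltonian_cycle V E C" "\<And>D. hamiltonian_cycle V E D \<Longrightarrow> D = C"
    using ham unfolding uniquely_hamiltonian_def by blast
  have fin: "finite V" and edge: "\<And>e. e \<in> E \<Longrightarrow> e \<subseteq> V \<and> card e = 2"
    using simple unfolding simple_graph_def by auto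
  have "V \<noteq> {}" using C(1) unfolding hamiltonian_cycle_def by force
  have "\<forall>v\<in>{v \<in> V. vertex_degree E v = 2}. \<forall>w\<in>{v \<in> V. vertex_degree E v = 2}. v = w"
    using deg fin card_le_Suc0_iff_eq[of "{v \<in> V. vertex_degree E v = 2}"] by simp
  then obtain x where x: "x \<in> V" "\<And>v. v \<in> V \<Longrightarrow> v \<noteq> x \<Longrightarrow> vertex_degree E v \<noteq> 2"
    using \<open>V \<noteq> {}\<close> by blast
  obtain p where p: "distinct (x # p)" "set (x # p) = V" "length p \<ge> 2" "C = cyclic_edges (x # p)" "C \<subseteq> E"
    by (rule hamiltonian_cycle_from[OF C(1) x(1)])
  define n where "n = length (x # p)"
  define f where "f = nth (x # p)"
  have n: "3 \<le> n" "n = card V" using p(1-3) distinct_card[OF p(1)] by (auto simp: n_def)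
  have f: "map f [0..<n] = x # p" unfolding f_def n_def by (rule map_nth)
  have f0: "f 0 = x" by (simp add: f_def)
  have im: "f ` {..<n} = V" using arg_cong[OF f, of set] p(2) by (simp add: lessThan_atLeast0)
  have inj: "inj_on f {..<n}" using p(1) distinct_map[of f "[0..<n]"] unfolding f by (simp add: lessThan_atLeast0)
  have C_image: "C = (`) f ` cyclic_edges [0..<n]"
    using p(4) f cyclic_edges_map[of f "[0..<n]"] by simp
  have sub: "e \<subseteq> {..<n}" if "e \<in> cyclic_edges q" "set q = {..<n}" for e q
    using cyclic_edges_subset[OF that(1)] that(2) by simp
  have inj': "inj_on ((`) f) (Pow {..<n})" using inj by (rule inj_on_image_Pow)
  define G where "G = {e. e \<subseteq> {..<n} \<and> f ` e \<in> E}"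
  have sub0: "e \<subseteq> {..<n}" if "e \<in> cyclic_edges [0..<n]" for e
    using sub[OF that] by (simp add: lessThan_atLeast0)
  have G1: "cyclic_edges [0..<n] \<subseteq> G"
  proof
    fix e assume "e \<in> cyclic_edges [0..<n]"
    then show "e \<in> G" using sub0[of e] p(5) unfolding G_def C_image by blast
  qed
  have G2: "cyclic_edges q = cyclic_edges [0..<n]"
    if q: "distinct q" "set q = {..<n}" "cyclic_edges q \<subseteq> G" for q
  proof -
    have "hamiltonian_cycle V E (cyclic_edges (map f q))"
      unfolding hamiltonian_cycle_def
    proof (intro conjI exI[of _ "map f q"])
      show "cyclic_edges (map f q) \<subseteq> E"
        unfolding cyclic_edges_map
      proof (rule image_subsetI)
        fix e assume "e \<in> cyclic_edges q"
        then show "f ` e \<in> E" using q(3) unfolding G_def by blast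
      qed
      show "distinct (map f q)" using q(1,2) inj by (simp add: distinct_map)
      show "set (map f q) = V" using q(2) im by simp
      show "3 \<le> length (map f q)" using distinct_card[OF q(1)] q(2) n(1) by simp
    qed simp
    then have "cyclic_edges (map f q) = C" by (rule C(2))
    then have "(`) f ` cyclic_edges q = (`) f ` cyclic_edges [0..<n]"
      unfolding C_image cyclic_edges_map .
    moreover have "cyclic_edges q \<subseteq> Pow {..<n}" "cyclic_edges [0..<n] \<subseteq> Pow {..<n}"
      using sub[OF _ q(2)] sub0 by blast+
    ultimately show ?thesis by (simp only: inj_on_image_eq_iff[OF inj'])
  qed
  have G3: "\<exists>j<n. j \<noteq> i \<and> {i, j} \<in> G - cyclic_edges [0..<n]" if i: "0 < i" "i < n" for i
  proof -
    have "f i \<in> V" using i im by blast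
    moreover have "f i \<noteq> x" using inj_onD[OF inj, of i 0] i f0 by auto
    ultimately have "card {e \<in> E. f i \<in> e} \<noteq> 2" using x(2)[of "f i"] unfolding vertex_degree_def by simp
    moreover have "card {e \<in> C. f i \<in> e} = 2"
    proof -
      have mem: "f i \<in> f ` e \<longleftrightarrow> i \<in> e" if "e \<subseteq> {..<n}" for e
        using inj_on_image_mem_iff[OF inj _ that] i by simp
      have "{e \<in> C. f i \<in> e} = (`) f ` {e \<in> cyclic_edges [0..<n]. i \<in> e}"
        unfolding C_image using mem sub0 by blast
      moreover have "inj_on ((`) f) {e \<in> cyclic_edges [0..<n]. i \<in> e}"
        using sub0 by (intro inj_on_subset[OF inj']) blast
      ultimately show ?thesis using cyclic_edges_at[OF i n(1)] by (simp add: card_image)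
    qed
    ultimately have "{e \<in> E. f i \<in> e} \<noteq> {e \<in> C. f i \<in> e}" by metis
    then obtain e where e: "e \<in> E" "f i \<in> e" "e \<notin> C" using p(5) by blast
    then obtain w where w: "e = {f i, w}" "w \<noteq> f i" "w \<in> V"
    proof -
      obtain a b where "e = {a, b}" "a \<noteq> b" using edge[OF e(1)] card_2_iff by metis
      then show ?thesis using that[of a] that[of b] edge[OF e(1)] e(2) by auto
    qed
    then obtain j where j: "j < n" "w = f j" using im by blast
    have img: "f ` {i, j} = e" using w(1) j(2) by simp
    then have "{i, j} \<in> G" using i(2) j(1) e(1) unfolding G_def by simp
    moreover have "{i, j} \<notin> cyclic_edges [0..<n]" using img e(3) C_image by blast
    ultimately show ?thesis using j w(2) by blast
  qed
  have "\<not> refutes n [] [] r" for r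
    by (rule refutes_sound[OF n(1) G1 G2 G3]) simp_all
  then show False using refutation_exists[of n] n small by auto
qed

section \<open>Toric uniquely hamiltonian graphs\<close>

theorem mainTheorem3:
  fixes n :: nat
  assumes "n > 0"
  shows "(\<exists>(V :: nat set) E. simple_graph V E \<and> card V = n \<and> toric V E \<and>
            uniquely_hamiltonian V E \<and> card {v \<in> V. vertex_degree E v = 2} \<le> 1)
         \<longleftrightarrow> n \<ge> 11"
proof
  assume "\<exists>(V :: nat set) E. simple_graph V E \<and> card V = n \<and> toric V E \<and>
            uniquely_hamiltonian V E \<and> card {v \<in> V. vertex_degree E v = 2} \<le> 1"
  then show "n \<ge> 11" using uniquely_hamiltonian_order by metis
next
  assume n: "n \<ge> 11"
  let ?E = "hamiltonian_fan n"
  have step: "{i, j} \<in> ?E" if "j = Suc i" "j < 10" for i j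
    using that n hamiltonian_fan_edges(1)[of i n] by simp
  have chord: "{i, j} \<in> ?E" if "(i, j) \<in> set chords" for i j
    using that by (rule hamiltonian_fan_edges(3))
  have "{1,2} \<in> ?E" "{2,3} \<in> ?E" "{3,4} \<in> ?E" "{4,5} \<in> ?E" "{5,6} \<in> ?E" "{6,7} \<in> ?E" "{8,9} \<in> ?E"
    by (rule step; simp)+
  moreover have "{1,8} \<in> ?E" "{4,8} \<in> ?E" "{2,6} \<in> ?E" "{7,9} \<in> ?E" "{3,9} \<in> ?E"
    by (rule chord; simp add: chords_def)+
  ultimately have "\<not> embeds_in {..<n} ?E (UNIV :: complex set)"
    using n by (intro K33_subdivision_not_planar) auto
  then have "toric {..<n} ?E"
    unfolding toric_def using hamiltonian_fan_embeds_in_torus[OF n] by blast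
  moreover have "{v \<in> {..<n}. vertex_degree ?E v = 2} \<subseteq> {n - 1}"
  proof
    fix v assume v: "v \<in> {v \<in> {..<n}. vertex_degree ?E v = 2}"
    then have "\<not> v < n - 1" using hamiltonian_fan_degree[OF n, of v] by auto
    then show "v \<in> {n - 1}" using v by auto
  qed
  then have "card {v \<in> {..<n}. vertex_degree ?E v = 2} \<le> 1"
    using card_mono[of "{n - 1}"] by fastforce
  ultimately show "\<exists>(V :: nat set) E. simple_graph V E \<and> card V = n \<and> toric V E \<and>
            uniquely_hamiltonian V E \<and> card {v \<in> V. vertex_degree E v = 2} \<le> 1"
    using hamiltonian_fan_simple[OF n] hamiltonian_fan_uniquely_hamiltonian[OF n] card_lessThan[of n]
    by blast
qed

end
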